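(* Let $k$ be odd and let $\ell_1,\dots,\ell_k$ be affine functions on $\mathbb{R}^2$, oriented alike, whose zero lines pass through a common point $p$ and have distinct positive slopes, labeled in increasing order of slope. Put $$G=\sum_{d=1}^k(-1)^{d-1}\,\mathrm{sign}\,\ell_d,\qquad F=\{G=1\}.$$ Then (equalities of sets being up to null sets): (i) $G$ is $\{\pm1\}$-valued a.e., so $G=2\chi_F-1$ a.e., and $F$ is the union of $k$ of the $2k$ sectors into which the lines cut the plane, taken alternately; replacing every $\ell_d$ by $-\ell_d$ replaces $F$ by its complement. Conversely, every union of alternate sectors of an odd number $k$ of concurrent lines of distinct positive slopes is of this form; and if $F'$ is a union of alternate sectors of $k$ concurrent lines of distinct positive slopes ($k\ge1$ arbitrary) with $\mathbf{H}(2\chi_{F'}-1)=2\chi_{F'}-1$ in the spectral sense, then $k$ is odd. (ii) $2\chi_F-1$ is odd with respect to $p$ and homogeneous of degree $0$ about $p$, and $\mathbf{H}(2\chi_F-1)=2\chi_F-1$ in the spectral sense; the spectrum (the support of the Fourier transform of $2\chi_F-1$) consists of the $k$ lines through the origin normal to the boundary lines. (iii) Let $k=3$, relabel the functions so that $\ell_3$ is the one of intermediate slope, so that automatically $\ell_3=\lambda_1\ell_1+\lambda_2\ell_2$ with $\lambda_1,\lambda_2>0$. Then $F=\{H(\ell_1)+H(\ell_2)-H(\ell_3)=1\}$. Moreover, let $u=y-x$, $v=y-\frac x2$ and $S=\{(x,y):\{u\}+\{v\}>1\}$ ($\{\cdot\}$ the fractional part). At every vertex $p$ of the arrangement of lines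 $\{u\in\mathbb{Z}\}\cup\{v\in\mathbb{Z}\}\cup\{u+v\in\mathbb{Z}\}$ the set $S$ blows up to such a three-line fan: as $\varepsilon\to0^+$, $\chi_S(p+\varepsilon(z-p))\to\chi_F(z)$ for a.e. $z$, where $F=\{H(\ell_1)+H(\ell_2)-H(\ell_3)=1\}$ with $\ell_1=u(p)-u$, $\ell_2=v(p)-v$, $\ell_3=\ell_1+\ell_2$.
   Context: $H=\chi_{[0,\infty)}$ is the Heaviside function. Affine functions $\ell_d=a_dy-b_dx+c_d$ are oriented alike if all the coefficients $a_d$ have the same (nonzero) sign; their zero lines have slopes $b_d/a_d$. A vertex of an arrangement of lines is a point lying on at least two of its lines. A function $G$ is homogeneous of degree $0$ about $p$ if $G(p+\lambda(z-p))=G(z)$ for $\lambda>0$, and odd with respect to $p$ if $G(2p-z)=-G(z)$ (a.e.). $\mathbf{H}$ is the double Hilbert transform (Fourier symbol $-1$ on the open first and third quadrants, $+1$ on the open second and fourth). For $f\in L^\infty(\mathbb{R}^2)$, "$\mathbf{H}f=f$ in the spectral sense" means that the tempered distribution $\hat f$ is supported in $Q_{2,4}\cup\{0\}$, where $Q_{2,4}$ is the union of the open second and fourth quadrants of the frequency plane. *)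

theory Defs
  imports "HOL-Analysis.Analysis"
begin

type_synonym plane = "real \<times> real"

text \<open>Throughout, \<open>fst\<close> is the coordinate \<open>x\<close> and \<open>snd\<close> the coordinate \<open>y\<close>.
  Almost everywhere refers to the completed measure \<open>lebesgue\<close>, so that sets and functions
  which are only determined up to null sets remain measurable.\<close>

definition ae_eq :: "plane set \<Rightarrow> plane set \<Rightarrow> bool"
  where "ae_eq A B \<longleftrightarrow> (AE z in lebesgue. z \<in> A \<longleftrightarrow> z \<in> B)"

definition L_infinity :: "('a::euclidean_space \<Rightarrow> complex) \<Rightarrow> bool"
  where "L_infinity f \<longleftrightarrow>
    f \<in> borel_measurable lebesgue \<and> (\<exists>C. AE x in lebesgue. norm (f x) \<le> C)"

definition deriv_along :: "'a::euclidean_space \<Rightarrow> ('a \<Rightarrow> complex) \<Rightarrow> 'a \<Rightarrow> complex"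
  where "deriv_along v \<phi> = (\<lambda>x. frechet_derivative \<phi> (at x) v)"

definition smooth :: "('a::euclidean_space \<Rightarrow> complex) \<Rightarrow> bool"
  where "smooth \<phi> \<longleftrightarrow> (\<forall>vs x. fold deriv_along vs \<phi> differentiable (at x))"

definition test_function_on :: "'a::euclidean_space set \<Rightarrow> ('a \<Rightarrow> complex) \<Rightarrow> bool"
  where "test_function_on U \<phi> \<longleftrightarrow>
    smooth \<phi> \<and> compact (closure {x. \<phi> x \<noteq> 0}) \<and> closure {x. \<phi> x \<noteq> 0} \<subseteq> U"

definition fourier :: "('a::euclidean_space \<Rightarrow> complex) \<Rightarrow> 'a \<Rightarrow> complex"
  where "fourier \<phi> \<xi> = (LINT x|lebesgue. cis (- 2 * pi * (x \<bullet> \<xi>)) * \<phi> x)"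

text \<open>The tempered distribution \<open>f\<close>-hat, by duality.  The support of a distribution only
  involves its values on compactly supported test functions.\<close>

definition fourier_dist :: "('a::euclidean_space \<Rightarrow> complex) \<Rightarrow> ('a \<Rightarrow> complex) \<Rightarrow> complex"
  where "fourier_dist f \<phi> = (LINT x|lebesgue. f x * fourier \<phi> x)"

definition dist_support :: "(('a::euclidean_space \<Rightarrow> complex) \<Rightarrow> complex) \<Rightarrow> 'a set"
  where "dist_support T =
    - \<Union>{U. open U \<and> (\<forall>\<phi>. test_function_on U \<phi> \<longrightarrow> T \<phi> = 0)}"

definition spectrum :: "('a::euclidean_space \<Rightarrow> complex) \<Rightarrow> 'a set"
  where "spectrum f = dist_support (fourier_dist f)"

definition Q24 :: "plane set"
  where "Q24 = {(x, y). x < 0 \<and> y > 0} \<union> {(x, y). x > 0 \<and> y < 0}"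

text \<open>\<open>\<^bold>H f = f\<close> in the spectral sense, for the double Hilbert transform \<open>\<^bold>H\<close>, whose symbol
  is \<open>1\<close> on \<open>Q24\<close> and \<open>-1\<close> on the open first and third quadrants.\<close>

definition hilbert_fixed :: "(plane \<Rightarrow> complex) \<Rightarrow> bool"
  where "hilbert_fixed f \<longleftrightarrow> L_infinity f \<and> spectrum f \<subseteq> Q24 \<union> {0}"

definition zero_line :: "(plane \<Rightarrow> real) \<Rightarrow> plane set"
  where "zero_line l = {z. l z = 0}"

text \<open>The lines through \<open>p\<close> whose slopes are the elements of \<open>M\<close>.\<close>

definition pencil :: "plane \<Rightarrow> real set \<Rightarrow> plane set set"
  where "pencil p M = (\<lambda>m. {z. snd z - snd p = m * (fst z - fst p)}) ` M"

definition normal_line :: "plane set \<Rightarrow> plane set"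
  where "normal_line L = {\<xi>. \<forall>z\<in>L. \<forall>w\<in>L. \<xi> \<bullet> (z - w) = 0}"

definition sectors :: "plane set set \<Rightarrow> plane set set"
  where "sectors LL = components (- \<Union>LL)"

text \<open>For concurrent lines, the closures of two distinct sectors meet in the common point alone
  unless the sectors are neighbours, in which case they share a boundary ray (or, for a single
  line, that line).\<close>

definition adjacent :: "plane set \<Rightarrow> plane set \<Rightarrow> bool"
  where "adjacent A B \<longleftrightarrow> A \<noteq> B \<and> infinite (closure A \<inter> closure B)"

definition alternate :: "plane set set \<Rightarrow> plane set set \<Rightarrow> bool"
  where "alternate LL SS \<longleftrightarrow> SS \<subseteq> sectors LL \<and>
    (\<forall>A\<in>sectors LL. \<forall>B\<in>sectors LL. adjacent A B \<longrightarrow> (A \<in> SS \<longleftrightarrow> B \<notin> SS))"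

definition alternate_union :: "plane set set \<Rightarrow> plane set \<Rightarrow> bool"
  where "alternate_union LL F \<longleftrightarrow> (\<exists>SS. alternate LL SS \<and> ae_eq F (\<Union>SS))"

definition oriented_alike :: "nat set \<Rightarrow> (nat \<Rightarrow> real) \<Rightarrow> bool"
  where "oriented_alike I a \<longleftrightarrow> (\<forall>d\<in>I. a d > 0) \<or> (\<forall>d\<in>I. a d < 0)"

definition fan ::
  "nat \<Rightarrow> plane \<Rightarrow> (nat \<Rightarrow> plane \<Rightarrow> real) \<Rightarrow> (nat \<Rightarrow> real) \<Rightarrow> (nat \<Rightarrow> real) \<Rightarrow> (nat \<Rightarrow> real) \<Rightarrow> bool"
  where "fan k p l a b c \<longleftrightarrow>
    (\<forall>d\<in>{1..k}. \<forall>x y. l d (x, y) = a d * y - b d * x + c d) \<and>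
    oriented_alike {1..k} a \<and>
    (\<forall>d\<in>{1..k}. l d p = 0) \<and>
    (\<forall>d\<in>{1..k}. b d / a d > 0) \<and>
    strict_mono_on {1..k} (\<lambda>d. b d / a d)"

definition sign_sum :: "nat \<Rightarrow> (nat \<Rightarrow> plane \<Rightarrow> real) \<Rightarrow> plane \<Rightarrow> real"
  where "sign_sum k l z = (\<Sum>d=1..k. (- 1) ^ (d - 1) * sgn (l d z))"

definition fan_set :: "nat \<Rightarrow> (nat \<Rightarrow> plane \<Rightarrow> real) \<Rightarrow> plane set"
  where "fan_set k l = {z. sign_sum k l z = 1}"

definition pm :: "plane set \<Rightarrow> plane \<Rightarrow> real"
  where "pm F z = 2 * indicator F z - 1"

definition odd_about :: "plane \<Rightarrow> (plane \<Rightarrow> real) \<Rightarrow> bool"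
  where "odd_about p g \<longleftrightarrow> (AE z in lebesgue. g (2 *\<^sub>R p - z) = - g z)"

definition homogeneous0_about :: "plane \<Rightarrow> (plane \<Rightarrow> real) \<Rightarrow> bool"
  where "homogeneous0_about p g \<longleftrightarrow> (\<forall>t>0. \<forall>z. g (p + t *\<^sub>R (z - p)) = g z)"

definition heaviside :: "real \<Rightarrow> real"
  where "heaviside = indicator {0..}"

text \<open>A relabelling \<open>s\<close> of three lines, with slopes \<open>b d / a d\<close>, after which the third one has
  the intermediate slope.\<close>

definition middle_last :: "(nat \<Rightarrow> real) \<Rightarrow> (nat \<Rightarrow> real) \<Rightarrow> (nat \<Rightarrow> nat) \<Rightarrow> bool"
  where "middle_last a b s \<longleftrightarrow> bij_betw s {1..3} {1..3} \<and>
    (let m = (\<lambda>d. b (s d) / a (s d)) in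
      m 1 < m 3 \<and> m 3 < m 2 \<or> m 2 < m 3 \<and> m 3 < m 1)"

definition three_set ::
  "(plane \<Rightarrow> real) \<Rightarrow> (plane \<Rightarrow> real) \<Rightarrow> (plane \<Rightarrow> real) \<Rightarrow> plane set"
  where "three_set l1 l2 l3 = {z. heaviside (l1 z) + heaviside (l2 z) - heaviside (l3 z) = 1}"

definition u :: "plane \<Rightarrow> real"
  where "u = (\<lambda>(x, y). y - x)"

definition v :: "plane \<Rightarrow> real"
  where "v = (\<lambda>(x, y). y - x / 2)"

definition S :: "plane set"
  where "S = {z. frac (u z) + frac (v z) > 1}"

definition arrangement :: "plane set set"
  where "arrangement =
    (\<Union>n::int. {{z. u z = of_int n}, {z. v z = of_int n}, {z. u z + v z = of_int n}})"

definition vertex :: "plane set set \<Rightarrow> plane \<Rightarrow> bool"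
  where "vertex LL p \<longleftrightarrow> (\<exists>L\<in>LL. \<exists>L'\<in>LL. L \<noteq> L' \<and> p \<in> L \<and> p \<in> L')"

end

theory Submission
  imports Defs "HOL-Probability.Probability"
begin

text \<open>Off the lines the alternating sum of an odd number of signs equals their product: as the slope
  varies, the sign of the linear form at a fixed point changes at most once. The product of the signs
  is what alternates from each sector to its neighbours, since neighbouring sectors lie on different
  sides of exactly one line.

  On the Fourier side, a function invariant under translations by \<open>\<tau>\<close> has its spectrum in
  the orthogonal complement of \<open>\<tau>\<close>, so the spectrum of the alternating sum lies in the union of
  the normal lines. All of these lines occur, and an even number of lines is excluded, by Abel
  summation: with exponential weights the Fourier transforms of the sign of a linear form and of a
  homogeneous function on a double cone are explicit, and tested against a nonnegative bump they stay
  away from \<open>0\<close> in the limit.\<close>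

section \<open>Smooth functions\<close>

text \<open>The functions to be transformed are bounded but not integrable, and their transforms are
  tested on compactly supported smooth functions only. Two facts carry the pairing: the transform of
  a test function is integrable, and an exponential weight makes the weighted function integrable,
  so that the transform can be moved onto it. The weights are placed in coordinates in which the
  result is explicit. For a line of slope \<open>m\<close> these are \<open>x\<close> and
  \<open>y - m * x\<close>; the transform is then a Poisson kernel that concentrates on the normal
  line, times a conjugate Poisson kernel. For a double cone they are \<open>x\<close> and the slope
  \<open>y / x\<close>; the transform is then an average over the slopes \<open>t\<close> of one
  kernel taken at \<open>a + t * b\<close>. The limits are never evaluated: a lower bound uniform in
  the weight suffices, and it exists because the factors have a fixed sign near the chosen
  frequency. The Poisson kernel has height of order \<open>1 / \<epsilon>\<close> on a strip of
  width of order \<open>\<epsilon>\<close>; the cone kernel is negative away from 0, and positive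
  slopes keep \<open>a + t * b\<close> away from 0 near \<open>(1, 1)\<close>.\<close>

lemma smooth_coinduct:
  assumes "\<phi> \<in> A" and "\<And>f x. f \<in> A \<Longrightarrow> f differentiable (at x)"
    and "\<And>f e. f \<in> A \<Longrightarrow> deriv_along e f \<in> A"
  shows "smooth \<phi>"
proof -
  have "fold deriv_along vs f \<in> A" if "f \<in> A" for vs f
    using that by (induction vs arbitrary: f) (auto simp: assms(3))
  then show ?thesis
    using assms(1,2) unfolding smooth_def by blast
qed

lemma smooth_differentiable: "smooth \<phi> \<Longrightarrow> \<phi> differentiable (at x)"
  unfolding smooth_def by (drule spec[of _ "[]"]) simp

lemma smooth_deriv_along: "smooth \<phi> \<Longrightarrow> smooth (deriv_along e \<phi>)"
  unfolding smooth_def by (metis fold_Cons comp_apply)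

lemma deriv_alongI: "(f has_derivative f') (at x) \<Longrightarrow> deriv_along e f x = f' e"
  unfolding deriv_along_def by (metis frechet_derivative_at)

lemma has_derivative_deriv_along:
  "f differentiable (at x) \<Longrightarrow> (f has_derivative (\<lambda>e. deriv_along e f x)) (at x)"
  unfolding deriv_along_def by (simp add: frechet_derivative_works[symmetric])

inductive_set alg :: "('a::euclidean_space \<Rightarrow> complex) set \<Rightarrow> ('a \<Rightarrow> complex) set"
  for B where
  base: "f \<in> B \<Longrightarrow> f \<in> alg B"
| const: "(\<lambda>_. k) \<in> alg B"
| add: "f \<in> alg B \<Longrightarrow> g \<in> alg B \<Longrightarrow> (\<lambda>x. f x + g x) \<in> alg B"
| mult: "f \<in> alg B \<Longrightarrow> g \<in> alg B \<Longrightarrow> (\<lambda>x. f x * g x) \<in> alg B"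

lemma alg_differentiable:
  assumes "f \<in> alg B" "\<And>f x. f \<in> B \<Longrightarrow> f differentiable (at x)"
  shows "f differentiable (at x)"
  using assms(1) by induction (auto intro: assms(2) differentiable_add differentiable_mult)

text \<open>The sum and product rules keep derivatives inside a generated algebra. The generators
  need not be closed under differentiation among themselves: it is enough that their derivatives are
  polynomials in generators.\<close>

lemma smooth_alg:
  assumes "f \<in> alg B" and d: "\<And>f x. f \<in> B \<Longrightarrow> f differentiable (at x)"
    and B: "\<And>f e. f \<in> B \<Longrightarrow> deriv_along e f \<in> alg B"
  shows "smooth f"
proof (rule smooth_coinduct[of f "alg B"])
  show "deriv_along e g \<in> alg B" if "g \<in> alg B" for g e
    using that
  proof induction
    case (base f) then show ?case by (rule B)
  next
    case (const k)
    have "deriv_along e (\<lambda>_. k) = (\<lambda>_. 0)"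
      by (rule ext, rule deriv_alongI) (rule has_derivative_const)
    then show ?case by (simp add: alg.const)
  next
    case (add f g)
    have "deriv_along e (\<lambda>x. f x + g x) = (\<lambda>x. deriv_along e f x + deriv_along e g x)"
      using add by (intro ext deriv_alongI has_derivative_add has_derivative_deriv_along
          alg_differentiable[OF _ d])
    then show ?case using add by (simp add: alg.add)
  next
    case (mult f g)
    have "deriv_along e (\<lambda>x. f x * g x)
      = (\<lambda>x. f x * deriv_along e g x + deriv_along e f x * g x)"
      using mult by (intro ext deriv_alongI has_derivative_mult has_derivative_deriv_along
          alg_differentiable[OF _ d])
    then show ?case using mult by (simp add: alg.add alg.mult)
  qed
  show "g differentiable (at x)" if "g \<in> alg B" for g x
    using alg_differentiable[OF that d] .
qed (fact assms(1))

lemma smooth_algebra: "f \<in> alg {f. smooth f} \<Longrightarrow> smooth f"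
  by (erule smooth_alg) (auto intro: alg.base smooth_differentiable smooth_deriv_along)

lemma smooth_const: "smooth (\<lambda>_. k)"
  by (intro smooth_algebra alg.const)

lemma smooth_add: "smooth f \<Longrightarrow> smooth g \<Longrightarrow> smooth (\<lambda>x. f x + g x)"
  by (intro smooth_algebra alg.add alg.base) auto

lemma smooth_mult: "smooth f \<Longrightarrow> smooth g \<Longrightarrow> smooth (\<lambda>x. f x * g x)"
  by (intro smooth_algebra alg.mult alg.base) auto

lemma smooth_diff: "smooth f \<Longrightarrow> smooth g \<Longrightarrow> smooth (\<lambda>x. f x - g x)"
  using smooth_add[OF _ smooth_mult[OF smooth_const[of "-1"]], of f g] by simp

lemma has_derivative_cis_inner:
  "((\<lambda>z. cis (2 * pi * (z \<bullet> w))) has_derivative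
     (\<lambda>e. (2 * pi * (e \<bullet> w) * \<i>) * cis (2 * pi * (z \<bullet> w)))) (at z)"
proof -
  have "((\<lambda>z. \<i> * complex_of_real (2 * pi * (z \<bullet> w))) has_derivative
     (\<lambda>e. \<i> * complex_of_real (2 * pi * (e \<bullet> w)))) (at z)"
    by (auto intro!: derivative_eq_intros)
  from has_derivative_compose[OF this DERIV_exp[unfolded has_field_derivative_def]]
  show ?thesis
    unfolding cis_conv_exp by (simp add: mult_ac)
qed

lemma deriv_along_cis:
  "deriv_along e (\<lambda>z. cis (2 * pi * (z \<bullet> w)))
   = (\<lambda>z. (2 * pi * (e \<bullet> w) * \<i>) * cis (2 * pi * (z \<bullet> w)))"
  by (rule ext, rule deriv_alongI) (rule has_derivative_cis_inner)

lemma smooth_cis: "smooth (\<lambda>z::'a::euclidean_space. cis (2 * pi * (z \<bullet> w)))"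
proof -
  let ?e = "\<lambda>z::'a. cis (2 * pi * (z \<bullet> w))"
  have "?e differentiable (at x)" for x
    using has_derivative_cis_inner unfolding differentiable_def by blast
  then show ?thesis
    by (intro smooth_alg[of ?e "{?e}"])
      (auto simp: deriv_along_cis intro: alg.mult[OF alg.const alg.base] alg.base)
qed

section \<open>Flat exponentials and smooth bumps\<close>

definition exp_flat :: "nat \<Rightarrow> real \<Rightarrow> real"
  where "exp_flat n t = (if t > 0 then exp (- 1 / t) / t ^ n else 0)"

lemma exp_flat_tendsto: "((\<lambda>t. exp (- 1 / t) / t ^ n) \<longlongrightarrow> 0) (at_right (0::real))"
proof -
  have "((\<lambda>x::real. x ^ n / exp x) \<longlongrightarrow> 0) at_top"
    by (rule tendsto_power_div_exp_0)
  then have "((\<lambda>t::real. (inverse t) ^ n / exp (inverse t)) \<longlongrightarrow> 0) (at_right 0)"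
    by (rule filterlim_compose) (rule filterlim_inverse_at_top_right)
  then show ?thesis
    by (rule Lim_transform_eventually)
      (auto simp: exp_minus field_simps)
qed

text \<open>The powers of \<open>t\<close> in the denominator are there to make the family closed
  under differentiation, up to linear combinations. At 0 all members and all derivatives vanish,
  which is the only point where an argument beyond calculus rules is required.\<close>

lemma exp_flat_has_derivative:
  "(exp_flat n has_real_derivative exp_flat (n + 2) t - real n * exp_flat (n + 1) t) (at t)"
proof -
  consider "t > 0" | "t < 0" | "t = 0" by linarith
  then show ?thesis
  proof cases
    case 1
    have "((\<lambda>t. exp (- 1 / t) / t ^ n) has_real_derivative
       exp_flat (n + 2) t - real n * exp_flat (n + 1) t) (at t)"
      using 1 unfolding exp_flat_def
      apply (auto intro!: derivative_eq_intros simp: field_simps power2_eq_square)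
      apply (cases n)
       apply (auto simp: field_simps)
      done
    moreover have "\<forall>\<^sub>F s in nhds t. exp_flat n s = exp (- 1 / s) / s ^ n"
      using eventually_nhds_in_open[of "{0<..}" t] 1
      by (auto elim!: eventually_mono simp: exp_flat_def)
    ultimately show ?thesis
      by (subst DERIV_cong_ev[OF refl _ refl])
  next
    case 2
    have "\<forall>\<^sub>F s in nhds t. exp_flat n s = 0"
      using eventually_nhds_in_open[of "{..<0}" t] 2
      by (auto elim!: eventually_mono simp: exp_flat_def)
    moreover have "((\<lambda>_. 0) has_real_derivative exp_flat (n + 2) t - real n * exp_flat (n + 1) t) (at t)"
      using 2 by (auto simp: exp_flat_def)
    ultimately show ?thesis
      by (subst DERIV_cong_ev[OF refl _ refl])
  next
    case 3
    \<comment> \<open>For positive \<open>h\<close> the difference quotient at 0 is the member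
      \<open>exp_flat (n + 1) h\<close> of the same family, which tends to 0.\<close>
    have "((\<lambda>h. exp_flat n h / h) \<longlongrightarrow> 0) (at_right 0)"
      by (rule Lim_transform_eventually[OF exp_flat_tendsto[of "n + 1"]])
        (auto simp: exp_flat_def eventually_at_right_less intro!: eventually_at_rightI[of 0 1])
    moreover have "((\<lambda>h. exp_flat n h / h) \<longlongrightarrow> 0) (at_left 0)"
      by (rule Lim_transform_eventually[OF tendsto_const])
        (auto simp: exp_flat_def intro!: eventually_at_leftI[of "-1" 0])
    ultimately have "((\<lambda>h. exp_flat n h / h) \<longlongrightarrow> 0) (at 0)"
      by (simp add: filterlim_split_at)
    then show ?thesis
      using 3 by (simp add: DERIV_def exp_flat_def)
  qed
qed

definition bump :: "'a::euclidean_space \<Rightarrow> real \<Rightarrow> 'a \<Rightarrow> real"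
  where "bump \<xi> r z = exp_flat 0 (r\<^sup>2 - (z - \<xi>) \<bullet> (z - \<xi>))"

lemma bump_nonneg: "bump \<xi> r z \<ge> 0"
  by (simp add: bump_def exp_flat_def)

lemma bump_pos_iff: "r > 0 \<Longrightarrow> bump \<xi> r z > 0 \<longleftrightarrow> z \<in> ball \<xi> r"
  by (auto simp: bump_def exp_flat_def dist_norm power2_norm_eq_inner[symmetric] norm_minus_commute
      power_strict_mono[of _ _ 2] power_mono_iff dest: power_less_imp_less_base)

lemma bump_smooth: "smooth (\<lambda>z. complex_of_real (bump \<xi> r z))"
proof -
  \<comment> \<open>The linear forms are generators because the chain rule produces the factor
    \<open>- 2 * (e \<bullet> (z - \<xi>))\<close>.\<close>
  define B where "B = range (\<lambda>n (z::'a). complex_of_real (exp_flat n (r\<^sup>2 - (z - \<xi>) \<bullet> (z - \<xi>))))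
     \<union> range (\<lambda>w z. complex_of_real (z \<bullet> w))"
  have lin: "((\<lambda>z. complex_of_real (z \<bullet> w)) has_derivative (\<lambda>e. complex_of_real (e \<bullet> w))) (at z)"
    for w z :: 'a
    by (auto intro!: derivative_eq_intros)
  have fl: "((\<lambda>z. complex_of_real (exp_flat n (r\<^sup>2 - (z - \<xi>) \<bullet> (z - \<xi>)))) has_derivative
     (\<lambda>e. complex_of_real ((exp_flat (n + 2) (r\<^sup>2 - (z - \<xi>) \<bullet> (z - \<xi>))
        - real n * exp_flat (n + 1) (r\<^sup>2 - (z - \<xi>) \<bullet> (z - \<xi>))) * (- 2 * (e \<bullet> (z - \<xi>)))))) (at z)"
    for n z
  proof -
    have "((\<lambda>z. r\<^sup>2 - (z - \<xi>) \<bullet> (z - \<xi>)) has_derivative (\<lambda>e. - 2 * (e \<bullet> (z - \<xi>)))) (at z)"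
      by (auto intro!: derivative_eq_intros ext simp: inner_commute)
    from has_derivative_compose[OF this
        exp_flat_has_derivative[unfolded has_field_derivative_def, of n "r\<^sup>2 - (z - \<xi>) \<bullet> (z - \<xi>)"]]
    show ?thesis
      by (rule has_derivative_of_real)
  qed
  have fl_B: "(\<lambda>z. complex_of_real (exp_flat n (r\<^sup>2 - (z - \<xi>) \<bullet> (z - \<xi>)))) \<in> B" for n
    by (auto simp: B_def)
  have lin_B: "(\<lambda>z. complex_of_real (z \<bullet> w)) \<in> B" for w
    by (auto simp: B_def)
  show ?thesis
    unfolding bump_def
  proof (rule smooth_alg[of _ B])
    show "f differentiable (at x)" if "f \<in> B" for f x
      using that lin fl unfolding B_def differentiable_def by blast
    show "deriv_along e f \<in> alg B" if f: "f \<in> B" for f e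
    proof -
      consider n where "f = (\<lambda>z. complex_of_real (exp_flat n (r\<^sup>2 - (z - \<xi>) \<bullet> (z - \<xi>))))"
        | w where "f = (\<lambda>z. complex_of_real (z \<bullet> w))"
        using f unfolding B_def by auto
      then show ?thesis
      proof cases
        case 1
        have "deriv_along e f = (\<lambda>z. (complex_of_real (exp_flat (n + 2) (r\<^sup>2 - (z - \<xi>) \<bullet> (z - \<xi>)))
           + of_real (- real n) * complex_of_real (exp_flat (n + 1) (r\<^sup>2 - (z - \<xi>) \<bullet> (z - \<xi>))))
           * (complex_of_real (z \<bullet> (- 2 *\<^sub>R e)) + of_real (2 * (e \<bullet> \<xi>))))"
          unfolding 1 by (rule ext, subst deriv_alongI[OF fl])
            (simp add: inner_diff_right inner_commute algebra_simps)
        also have "\<dots> \<in> alg B"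
          by (intro alg.mult[OF alg.add[OF alg.base alg.mult[OF alg.const alg.base]]
                alg.add[OF alg.base alg.const]] fl_B lin_B)
        finally show ?thesis .
      next
        case 2
        have "deriv_along e f = (\<lambda>z. complex_of_real (e \<bullet> w))"
          unfolding 2 by (rule ext, rule deriv_alongI[OF lin])
        then show ?thesis by (simp add: alg.const)
      qed
    qed
  qed (auto simp: B_def intro!: alg.base)
qed

lemma test_function_bump:
  assumes "r > 0" "cball \<xi> r \<subseteq> U"
  shows "test_function_on U (\<lambda>z. complex_of_real (bump \<xi> r z))"
proof -
  have "{z. complex_of_real (bump \<xi> r z) \<noteq> 0} = ball \<xi> r"
    using bump_pos_iff[OF assms(1), of \<xi>] bump_nonneg[of \<xi> r] by (auto simp: less_le)
  then show ?thesis
    using assms by (simp add: test_function_on_def bump_smooth)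
qed


section \<open>Operations on test functions\<close>

lemma has_derivative_zero_on_open:
  assumes "open W" "x \<in> W" "\<And>y. y \<in> W \<Longrightarrow> f y = (0::complex)"
  shows "(f has_derivative (\<lambda>_. 0)) (at x)"
  by (rule has_derivative_transform_within_open[OF has_derivative_const[of 0] assms(1,2)])
    (simp add: assms(3))

lemma test_function_closure_subset:
  assumes "test_function_on U \<phi>" "smooth \<psi>" "closure {x. \<psi> x \<noteq> 0} \<subseteq> closure {x. \<phi> x \<noteq> 0}"
  shows "test_function_on U \<psi>"
  using assms closed_Int_compact[of "closure {x. \<psi> x \<noteq> 0}" "closure {x. \<phi> x \<noteq> 0}"]
  unfolding test_function_on_def by (auto simp: Int_absorb2)

lemma test_function_mult:
  assumes "test_function_on U \<phi>" "smooth g"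
  shows "test_function_on U (\<lambda>x. g x * \<phi> x)"
proof -
  have "closure {x. g x * \<phi> x \<noteq> 0} \<subseteq> closure {x. \<phi> x \<noteq> 0}"
    by (intro closure_mono) auto
  then show ?thesis
    using assms by (intro test_function_closure_subset[OF assms(1)] smooth_mult)
      (auto simp: test_function_on_def)
qed

lemma test_function_deriv_along:
  assumes "test_function_on U \<phi>"
  shows "test_function_on U (deriv_along e \<phi>)"
proof -
  have "deriv_along e \<phi> x = 0" if "x \<notin> closure {x. \<phi> x \<noteq> 0}" for x
    by (rule deriv_alongI[OF has_derivative_zero_on_open[of "- closure {x. \<phi> x \<noteq> 0}"]])
      (use that closure_subset[of "{x. \<phi> x \<noteq> 0}"] in \<open>auto simp: open_Compl\<close>)
  then have "closure {x. deriv_along e \<phi> x \<noteq> 0} \<subseteq> closure {x. \<phi> x \<noteq> 0}"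
    by (intro closure_minimal) auto
  then show ?thesis
    using assms by (intro test_function_closure_subset[OF assms] smooth_deriv_along)
      (auto simp: test_function_on_def)
qed

text \<open>The divisor may have zeros off the support of \<open>\<phi>\<close>. There the numerator
  vanishes identically, and division by 0 gives 0, so the quotient is 0 on the open complement of
  the support whatever \<open>g\<close> does.\<close>

lemma test_function_divide:
  assumes \<phi>: "test_function_on U \<phi>" and g: "smooth g"
    and nz: "\<And>x. x \<in> closure {x. \<phi> x \<noteq> 0} \<Longrightarrow> g x \<noteq> 0"
  shows "test_function_on U (\<lambda>x. \<phi> x / g x)"
proof -
  define K where "K = closure {x. \<phi> x \<noteq> 0}"
  \<comment> \<open>The invariant class for the coinduction: the quotient rule gives a numerator
    that again vanishes off \<open>K\<close> and a squared denominator that is again nonzero on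
    \<open>K\<close>.\<close>
  define A where "A = {(\<lambda>x. F x / g x) | F g. smooth F \<and> smooth g
    \<and> (\<forall>x. x \<notin> K \<longrightarrow> F x = 0) \<and> (\<forall>x\<in>K. g x \<noteq> 0)}"
  have K: "open (- K)"
    by (simp add: K_def open_Compl)
  have D: "((\<lambda>x. F x / g x) has_derivative (\<lambda>e. (deriv_along e F x * g x - F x * deriv_along e g x)
      / (g x * g x))) (at x) \<and> (x \<notin> K \<longrightarrow> (\<forall>e. deriv_along e F x = 0))"
    if F: "smooth F" "\<And>x. x \<notin> K \<Longrightarrow> F x = 0" and G: "smooth g" "\<And>x. x \<in> K \<Longrightarrow> g x \<noteq> 0"
    for F g x
  proof (cases "x \<in> K")
    case True
    then show ?thesis
      using has_derivative_divide'[OF has_derivative_deriv_along has_derivative_deriv_along]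
        F G smooth_differentiable by blast
  next
    case False
    then have 1: "deriv_along e F x = 0" for e
      by (intro deriv_alongI[OF has_derivative_zero_on_open[of "- K"]]) (use K F(2) in auto)
    have "((\<lambda>x. F x / g x) has_derivative (\<lambda>_. 0)) (at x)"
      by (rule has_derivative_zero_on_open[of "- K"]) (use K False F(2) in auto)
    with 1 False F(2) show ?thesis by simp
  qed
  have "smooth (\<lambda>x. \<phi> x / g x)"
  proof (rule smooth_coinduct[of _ A])
    show "(\<lambda>x. \<phi> x / g x) \<in> A"
      using \<phi> g nz closure_subset[of "{x. \<phi> x \<noteq> 0}"]
      unfolding A_def K_def test_function_on_def by blast
    fix f assume "f \<in> A"
    then obtain F g where f: "f = (\<lambda>x. F x / g x)" and F: "smooth F" "\<And>x. x \<notin> K \<Longrightarrow> F x = 0"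
      and G: "smooth g" "\<And>x. x \<in> K \<Longrightarrow> g x \<noteq> 0"
      unfolding A_def by blast
    note D' = D[OF F G]
    show "f differentiable (at x)" for x
      using D'[of x] unfolding f differentiable_def by blast
    show "deriv_along e f \<in> A" for e
    proof -
      have "deriv_along e f = (\<lambda>x. (deriv_along e F x * g x - F x * deriv_along e g x) / (g x * g x))"
        unfolding f by (rule ext, rule deriv_alongI) (use D' in blast)
      moreover have "smooth (\<lambda>x. deriv_along e F x * g x - F x * deriv_along e g x)"
        "smooth (\<lambda>x. g x * g x)"
        using F(1) G(1) by (intro smooth_diff smooth_mult smooth_deriv_along; simp)+
      moreover have "deriv_along e F x * g x - F x * deriv_along e g x = 0" if "x \<notin> K" for x
        using D'[of x] F(2) that by simp
      ultimately show ?thesis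
        using G(2) unfolding A_def
        by (intro CollectI exI[of _ "\<lambda>x. deriv_along e F x * g x - F x * deriv_along e g x"]
            exI[of _ "\<lambda>x. g x * g x"]) simp
    qed
  qed
  moreover have "{x. \<phi> x / g x \<noteq> 0} = {x. \<phi> x \<noteq> 0}"
    using nz closure_subset[of "{x. \<phi> x \<noteq> 0}"] by auto
  ultimately show ?thesis
    using \<phi> by (simp only: test_function_on_def)
qed

section \<open>Fourier transforms of test functions\<close>

lemma borel_measurable_cis [measurable (raw)]:
  "f \<in> borel_measurable M \<Longrightarrow> (\<lambda>x. cis (f x)) \<in> borel_measurable M"
  unfolding cis_conv_exp by measurable

lemma integrable_lborel_translate:
  fixes f :: "'a::euclidean_space \<Rightarrow> 'b::{banach, second_countable_topology}"
  assumes "integrable lborel f"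
  shows "integrable lborel (\<lambda>x. f (c + x))"
proof -
  have "integrable (distr lborel borel ((+) c)) f"
    using assms by (simp add: lborel_distr_plus)
  then show ?thesis
    by (subst (asm) integrable_distr_eq)
      (use borel_measurable_integrable[OF assms] in auto)
qed

lemma integral_lborel_translate:
  fixes f :: "'a::euclidean_space \<Rightarrow> 'b::{banach, second_countable_topology}"
  assumes "f \<in> borel_measurable borel"
  shows "(LINT x|lborel. f (c + x)) = (LINT x|lborel. f x)"
proof -
  have "(LINT x|distr lborel borel ((+) c). f x) = (LINT x|lborel. f (c + x))"
    using assms by (subst integral_distr) auto
  then show ?thesis
    by (simp add: lborel_distr_plus)
qed

lemma smooth_continuous: "smooth \<phi> \<Longrightarrow> continuous_on A \<phi>"
  by (meson continuous_at_imp_continuous_on differentiable_imp_continuous_within smooth_differentiable)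

lemma smooth_borel [measurable_dest]: "smooth \<phi> \<Longrightarrow> \<phi> \<in> borel_measurable borel"
  by (intro borel_measurable_continuous_onI smooth_continuous)

lemma test_function_smooth: "test_function_on U \<phi> \<Longrightarrow> smooth \<phi>"
  by (simp add: test_function_on_def)

lemma test_function_integrable:
  assumes "test_function_on U \<phi>"
  shows "integrable lborel \<phi>"
proof -
  have "integrable lborel (\<lambda>x. indicator (closure {x. \<phi> x \<noteq> 0}) x *\<^sub>R \<phi> x)"
    using assms by (intro borel_integrable_compact smooth_continuous) (auto simp: test_function_on_def)
  also have "(\<lambda>x. indicator (closure {x. \<phi> x \<noteq> 0}) x *\<^sub>R \<phi> x) = \<phi>"
    using closure_subset[of "{x. \<phi> x \<noteq> 0}"] by (auto simp: fun_eq_iff indicator_def)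
  finally show ?thesis .
qed

lemma test_function_bounded:
  assumes "test_function_on U \<phi>"
  obtains B where "\<And>x. norm (\<phi> x) \<le> B" "B \<ge> 0"
proof -
  have "compact (\<phi> ` closure {x. \<phi> x \<noteq> 0})"
    using assms by (intro compact_continuous_image smooth_continuous) (auto simp: test_function_on_def)
  then obtain B where B: "\<And>x. x \<in> closure {x. \<phi> x \<noteq> 0} \<Longrightarrow> norm (\<phi> x) \<le> B"
    by (meson bounded_iff compact_imp_bounded imageI)
  have "norm (\<phi> x) \<le> max B 0" for x
    using B[of x] closure_subset[of "{x. \<phi> x \<noteq> 0}"] by (cases "\<phi> x = 0") auto
  then show thesis
    by (intro that[of "max B 0"]) auto
qed

lemma has_vector_derivative_deriv_along:
  assumes "smooth \<phi>"
  shows "((\<lambda>t. \<phi> (x + t *\<^sub>R e)) has_vector_derivative deriv_along e \<phi> (x + t *\<^sub>R e)) (at t within T)"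
proof -
  have "((\<lambda>t. x + t *\<^sub>R e) has_derivative (\<lambda>h. h *\<^sub>R e)) (at t within T)"
    by (auto intro!: derivative_eq_intros)
  from has_derivative_compose[OF this
      has_derivative_deriv_along[OF smooth_differentiable[OF assms]]]
  have D: "((\<lambda>t. \<phi> (x + t *\<^sub>R e)) has_derivative (\<lambda>h. deriv_along (h *\<^sub>R e) \<phi> (x + t *\<^sub>R e)))
    (at t within T)" .
  have "linear (\<lambda>h. deriv_along h \<phi> (x + t *\<^sub>R e))"
    using has_derivative_linear[OF has_derivative_deriv_along[OF smooth_differentiable[OF assms]]] .
  then show ?thesis
    using D linear_cmul[of "\<lambda>h. deriv_along h \<phi> (x + t *\<^sub>R e)"]
    by (simp add: has_vector_derivative_def)
qed

lemma norm_diff_along_le: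
  assumes "smooth \<phi>" and B: "\<And>x. norm (deriv_along e \<phi> x) \<le> B"
  shows "norm (\<phi> (x + t *\<^sub>R e) - \<phi> x) \<le> B * \<bar>t\<bar>"
proof -
  have "norm (\<phi> (x + t *\<^sub>R e) - \<phi> (x + 0 *\<^sub>R e)) \<le> B * norm (t - 0)"
  proof (rule differentiable_bound[where S = UNIV and f = "\<lambda>t. \<phi> (x + t *\<^sub>R e)"])
    show "((\<lambda>t. \<phi> (x + t *\<^sub>R e)) has_derivative (\<lambda>h. h *\<^sub>R deriv_along e \<phi> (x + s *\<^sub>R e)))
        (at s within UNIV)" for s
      using has_vector_derivative_deriv_along[OF assms(1)]
      by (simp add: has_vector_derivative_def)
    show "onorm (\<lambda>h. h *\<^sub>R deriv_along e \<phi> (x + s *\<^sub>R e)) \<le> B" for s :: real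
      by (rule onorm_le) (simp add: mult.commute[of B] mult_left_mono[OF B])
  qed auto
  then show ?thesis by simp
qed

text \<open>The difference quotients of \<open>\<phi>\<close> have integral 0 by translation
  invariance, and they converge to the derivative under a common integrable bound. This is the form
  of integration by parts from which the derivative rule for the transform is obtained.\<close>

lemma integral_deriv_along_eq_0:
  assumes \<phi>: "test_function_on U \<phi>"
  shows "(LINT x|lborel. deriv_along e \<phi> x) = 0"
proof -
  have sm: "smooth \<phi>" and [measurable]: "\<phi> \<in> borel_measurable borel"
    using \<phi> by (auto simp: test_function_on_def smooth_borel)
  obtain B where B: "\<And>x. norm (deriv_along e \<phi> x) \<le> B" "B \<ge> 0"
    using test_function_bounded[OF test_function_deriv_along[OF \<phi>]] by metis
  obtain R where R: "\<And>x. \<phi> x \<noteq> 0 \<Longrightarrow> norm x \<le> R"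
    using \<phi> closure_subset[of "{x. \<phi> x \<noteq> 0}"] unfolding test_function_on_def
    by (auto dest!: compact_imp_bounded simp: bounded_iff)
  define h where "h n = (1::real) / real (Suc n)" for n
  define F where "F n x = (\<phi> (x + h n *\<^sub>R e) - \<phi> x) /\<^sub>R h n" for n x
  have [measurable]: "F n \<in> borel_measurable borel" for n
    unfolding F_def by measurable
  have h: "h n > 0" "h n \<le> 1" for n by (auto simp: h_def)
  have F0: "(LINT x|lborel. F n x) = 0" for n
    using integral_lborel_translate[of \<phi> "h n *\<^sub>R e"] test_function_integrable[OF \<phi>]
      integrable_lborel_translate[of \<phi> "h n *\<^sub>R e"]
    by (simp add: F_def add.commute)
  have "(\<lambda>n. LINT x|lborel. F n x) \<longlonglongrightarrow> (LINT x|lborel. deriv_along e \<phi> x)"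
  proof (rule integral_dominated_convergence)
    \<comment> \<open>The step sizes are at most 1, so outside the ball of radius
      \<open>R + norm e\<close> both \<open>\<phi> (x + h n *\<^sub>R e)\<close> and
      \<open>\<phi> x\<close> are 0; inside, the mean value inequality gives
      \<open>B\<close>.\<close>
    show "integrable lborel (\<lambda>x. indicator (cball 0 (R + norm e)) x *\<^sub>R B :: real)"
      by (intro borel_integrable_compact) auto
    show "AE x in lborel. norm (F n x) \<le> indicator (cball 0 (R + norm e)) x *\<^sub>R B" for n
    proof (rule AE_I2)
      fix x
      show "norm (F n x) \<le> indicator (cball 0 (R + norm e)) x *\<^sub>R B"
      proof (cases "norm x \<le> R + norm e")
        case True
        have "norm (F n x) \<le> B"
          using norm_diff_along_le[OF sm B(1), of x "h n"] h(1)[of n]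
          by (simp add: F_def pos_divide_le_eq divide_inverse mult.commute[of "inverse _"]
              flip: scaleR_diff_right)
            (simp add: divide_inverse[symmetric] pos_divide_le_eq)
        then show ?thesis using True by (simp add: indicator_def)
      next
        case False
        have "norm (h n *\<^sub>R e) \<le> norm e"
          using h[of n] by (simp add: mult_left_le_one_le)
        then have "R < norm (x + h n *\<^sub>R e)" "R < norm x"
          using False norm_triangle_ineq2[of x "- (h n *\<^sub>R e)"] norm_ge_zero[of e]
          by (auto simp del: norm_ge_zero)
        then have "\<phi> (x + h n *\<^sub>R e) = 0" "\<phi> x = 0"
          using R by force+
        then show ?thesis using B(2) by (simp add: F_def)
      qed
    qed
    show "AE x in lborel. (\<lambda>n. F n x) \<longlonglongrightarrow> deriv_along e \<phi> x"
    proof (rule AE_I2)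
      fix x
      have "((\<lambda>t. (\<phi> (x + t *\<^sub>R e) - \<phi> x) /\<^sub>R t) \<longlongrightarrow> deriv_along e \<phi> x) (at 0)"
      proof (rule Lim_null[THEN iffD2], rule tendsto_norm_zero_cancel)
        have "((\<lambda>t. norm (\<phi> (x + t *\<^sub>R e) - \<phi> x - t *\<^sub>R deriv_along e \<phi> x) / norm t) \<longlongrightarrow> 0) (at 0)"
          using has_vector_derivative_deriv_along[OF sm, of x e 0 UNIV]
          by (simp add: has_vector_derivative_def has_derivative_at)
        then show "((\<lambda>t. norm ((\<phi> (x + t *\<^sub>R e) - \<phi> x) /\<^sub>R t - deriv_along e \<phi> x)) \<longlongrightarrow> 0) (at 0)"
        proof (rule Lim_transform_eventually)
          have "norm (\<phi> (x + t *\<^sub>R e) - \<phi> x - t *\<^sub>R deriv_along e \<phi> x) / norm t =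
             norm ((\<phi> (x + t *\<^sub>R e) - \<phi> x) /\<^sub>R t - deriv_along e \<phi> x)" if "t \<noteq> 0" for t
          proof -
            have "(\<phi> (x + t *\<^sub>R e) - \<phi> x) /\<^sub>R t - deriv_along e \<phi> x =
              (\<phi> (x + t *\<^sub>R e) - \<phi> x - t *\<^sub>R deriv_along e \<phi> x) /\<^sub>R t"
              using that by (simp add: scaleR_diff_right)
            then show ?thesis by (simp add: divide_inverse mult.commute)
          qed
          then show "\<forall>\<^sub>F t in at 0. norm (\<phi> (x + t *\<^sub>R e) - \<phi> x - t *\<^sub>R deriv_along e \<phi> x) / norm t =
             norm ((\<phi> (x + t *\<^sub>R e) - \<phi> x) /\<^sub>R t - deriv_along e \<phi> x)"
            by (auto simp: eventually_at_filter)
        qed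
      qed

      moreover have "filterlim h (at 0) sequentially"
        unfolding h_def filterlim_at
        using LIMSEQ_Suc[OF lim_1_over_n[where 'a = real]] by auto
      ultimately show "(\<lambda>n. F n x) \<longlonglongrightarrow> deriv_along e \<phi> x"
        unfolding F_def by (rule filterlim_compose)
    qed
  qed (use smooth_borel[OF smooth_deriv_along[OF sm]] in auto)
  then show ?thesis
    by (simp add: F0 LIMSEQ_const_iff)
qed

section \<open>Rules for the Fourier transform and decay of transforms\<close>

lemma fourier_lborel:
  "\<phi> \<in> borel_measurable borel \<Longrightarrow>
    fourier \<phi> \<xi> = (LINT x|lborel. cis (2 * pi * (x \<bullet> - \<xi>)) * \<phi> x)"
  unfolding fourier_def by (subst integral_completion) auto

lemma integrable_cis_mult:
  fixes \<phi> :: "'a::euclidean_space \<Rightarrow> complex"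
  assumes "integrable lborel \<phi>"
  shows "integrable lborel (\<lambda>x. cis (2 * pi * (x \<bullet> \<eta>)) * \<phi> x)"
  by (rule Bochner_Integration.integrable_bound[OF assms]) (use assms in \<open>auto simp: norm_mult\<close>)

lemma fourier_add:
  assumes "integrable lborel \<phi>" "integrable lborel \<psi>"
  shows "fourier (\<lambda>x. \<phi> x + \<psi> x) \<xi> = fourier \<phi> \<xi> + fourier \<psi> \<xi>"
proof -
  have [measurable]: "\<phi> \<in> borel_measurable borel" "\<psi> \<in> borel_measurable borel"
    using assms[THEN borel_measurable_integrable] by simp_all
  show ?thesis
    using integrable_cis_mult[OF assms(1), of "- \<xi>"] integrable_cis_mult[OF assms(2), of "- \<xi>"]
    by (simp add: fourier_lborel distrib_left)
qed

lemma fourier_diff: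
  assumes "integrable lborel \<phi>" "integrable lborel \<psi>"
  shows "fourier (\<lambda>x. \<phi> x - \<psi> x) \<xi> = fourier \<phi> \<xi> - fourier \<psi> \<xi>"
proof -
  have [measurable]: "\<phi> \<in> borel_measurable borel" "\<psi> \<in> borel_measurable borel"
    using assms[THEN borel_measurable_integrable] by simp_all
  show ?thesis
    using integrable_cis_mult[OF assms(1), of "- \<xi>"] integrable_cis_mult[OF assms(2), of "- \<xi>"]
    by (simp add: fourier_lborel right_diff_distrib)
qed

lemma fourier_modulate:
  "fourier (\<lambda>x. cis (2 * pi * (x \<bullet> \<eta>)) * \<phi> x) \<xi> = fourier \<phi> (\<xi> - \<eta>)"
proof -
  have "cis (- 2 * pi * (x \<bullet> \<xi>)) * (cis (2 * pi * (x \<bullet> \<eta>)) * \<phi> x)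
      = cis (- 2 * pi * (x \<bullet> (\<xi> - \<eta>))) * \<phi> x" for x
  proof -
    have "- 2 * pi * (x \<bullet> \<xi>) + 2 * pi * (x \<bullet> \<eta>) = - 2 * pi * (x \<bullet> (\<xi> - \<eta>))"
      by (simp add: inner_diff_right right_diff_distrib)
    then show ?thesis
      by (simp only: mult.assoc[symmetric] cis_mult)
  qed
  then show ?thesis
    by (simp only: fourier_def)
qed

lemma norm_fourier_le:
  assumes "integrable lborel \<phi>"
  shows "norm (fourier \<phi> \<xi>) \<le> (LINT x|lborel. norm (\<phi> x))"
proof -
  have [measurable]: "\<phi> \<in> borel_measurable borel"
    using assms[THEN borel_measurable_integrable] by simp
  have "norm (fourier \<phi> \<xi>) \<le> (LINT x|lborel. norm (cis (2 * pi * (x \<bullet> - \<xi>)) * \<phi> x))"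
    unfolding fourier_lborel[OF \<open>\<phi> \<in> borel_measurable borel\<close>] by (rule integral_norm_bound)
  then show ?thesis by (simp add: norm_mult)
qed

lemma fourier_measurable [measurable]:
  fixes \<phi> :: "'a::euclidean_space \<Rightarrow> complex"
  assumes [measurable]: "\<phi> \<in> borel_measurable borel"
  shows "fourier \<phi> \<in> borel_measurable borel"
proof -
  have "(\<lambda>\<xi>. LINT x|lborel. (\<lambda>(\<xi>, x). cis (2 * pi * (x \<bullet> - \<xi>)) * \<phi> x) (\<xi>, x)) \<in> borel_measurable borel"
    by (rule lborel.borel_measurable_lebesgue_integral) (simp add: cis_conv_exp)
  then show ?thesis
    by (simp add: fourier_lborel[OF assms] cong: measurable_cong)
qed

text \<open>The product of \<open>\<phi>\<close> with the character is a test function too, so its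
  directional derivative integrates to 0; the Leibniz rule splits this integral into the two
  sides.\<close>

lemma fourier_deriv_along:
  assumes \<phi>: "test_function_on U \<phi>"
  shows "fourier (deriv_along e \<phi>) \<xi> = 2 * pi * \<i> * (e \<bullet> \<xi>) * fourier \<phi> \<xi>"
proof -
  let ?E = "\<lambda>x. cis (2 * pi * (x \<bullet> - \<xi>))"
  have sm: "smooth \<phi>" using \<phi> by (rule test_function_smooth)
  have meas: "\<phi> \<in> borel_measurable borel" "deriv_along e \<phi> \<in> borel_measurable borel"
    using sm smooth_borel smooth_deriv_along by blast+
  have d: "deriv_along e (\<lambda>x. ?E x * \<phi> x) =
    (\<lambda>x. ?E x * deriv_along e \<phi> x + 2 * pi * (e \<bullet> - \<xi>) * \<i> * (?E x * \<phi> x))"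
    by (rule ext, rule deriv_alongI, rule has_derivative_eq_rhs,
        rule has_derivative_mult[OF has_derivative_cis_inner
          has_derivative_deriv_along[OF smooth_differentiable[OF sm]]])
      (simp add: algebra_simps)
  have "0 = (LINT x|lborel. deriv_along e (\<lambda>x. ?E x * \<phi> x) x)"
    by (rule integral_deriv_along_eq_0[OF test_function_mult[OF \<phi> smooth_cis], symmetric])
  also have "\<dots> = fourier (deriv_along e \<phi>) \<xi> + 2 * pi * (e \<bullet> - \<xi>) * \<i> * fourier \<phi> \<xi>"
    unfolding d fourier_lborel[OF meas(1)] fourier_lborel[OF meas(2)]
    using integrable_cis_mult[OF test_function_integrable[OF \<phi>], of "- \<xi>"]
      integrable_cis_mult[OF test_function_integrable[OF test_function_deriv_along[OF \<phi>]], of "- \<xi>" e]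
    by (subst Bochner_Integration.integral_add) auto
  finally show ?thesis
    by (simp add: algebra_simps)
qed

text \<open>At a fixed first coordinate the shear is a translation of the second one, so Fubini
  separates the variables. The case \<open>m = 0\<close> is the ordinary tensor product.\<close>

lemma integrable_lborel_shear:
  fixes f g :: "real \<Rightarrow> 'b::{real_normed_field,banach,second_countable_topology}"
  assumes f: "integrable lborel f" and g: "integrable lborel g"
  shows "integrable lborel (\<lambda>z. f (fst z) * g (snd z - m * fst z))"
    and "(LINT z|lborel. f (fst z) * g (snd z - m * fst z)) = (LINT x|lborel. f x) * (LINT x|lborel. g x)"
proof -
  have [measurable]: "f \<in> borel_measurable borel" "g \<in> borel_measurable borel"
    using assms[THEN borel_measurable_integrable] by simp_all
  have inner: "integrable lborel (\<lambda>y. g (y - c))" "(LINT y|lborel. g (y - c)) = (LINT y|lborel. g y)"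
    "(LINT y|lborel. norm (g (y - c))) = (LINT y|lborel. norm (g y))" for c
    using integrable_lborel_translate[OF g, of "- c"] integral_lborel_translate[of g "- c"]
      integral_lborel_translate[of "\<lambda>y. norm (g y)" "- c"] by simp_all
  have int: "integrable (lborel \<Otimes>\<^sub>M lborel) (\<lambda>z. f (fst z) * g (snd z - m * fst z))"
    by (rule lborel_pair.Fubini_integrable) (use f in \<open>simp_all add: inner norm_mult\<close>)
  then show "integrable lborel (\<lambda>z. f (fst z) * g (snd z - m * fst z))"
    by (simp add: lborel_prod)
  show "(LINT z|lborel. f (fst z) * g (snd z - m * fst z)) = (LINT x|lborel. f x) * (LINT x|lborel. g x)"
    using lborel_pair.integral_fst'[OF int] by (simp add: lborel_prod inner)
qed

text \<open>Two derivatives in each coordinate, and all four together, bound the transform by a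
  constant over \<open>(1 + x^2) * (1 + y^2)\<close>, a product of integrable functions. This is
  what makes the pairing with a bounded function absolutely convergent.\<close>

lemma integrable_fourier_test_function:
  fixes \<phi> :: "plane \<Rightarrow> complex"
  assumes \<phi>: "test_function_on U \<phi>"
  shows "integrable lborel (fourier \<phi>)"
proof -
  let ?d = "\<lambda>e f. deriv_along e (deriv_along e f)"
  let ?e = "(1, 0) :: plane" and ?e' = "(0, 1) :: plane"
  define c where "c = 4 * pi\<^sup>2"
  define C where "C f = (LINT x|lborel. norm (f x))" for f :: "plane \<Rightarrow> complex"
  have c: "c > 0" by (simp add: c_def)
  have dd: "fourier (?d e f) \<xi> = - c * (e \<bullet> \<xi>)\<^sup>2 * fourier f \<xi>" if "test_function_on U f" for e \<xi> f
    by (subst fourier_deriv_along[OF test_function_deriv_along[OF that]], subst fourier_deriv_along[OF that])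
      (simp add: c_def power2_eq_square algebra_simps)
  \<comment> \<open>The four summands bound \<open>n\<close>, \<open>X * n\<close>,
    \<open>Y * n\<close> and \<open>X * Y * n\<close>, where \<open>n\<close> is the modulus of the
    transform and \<open>X\<close>, \<open>Y\<close> are the squared coordinates; these add up to
    \<open>n * ((1 + X) * (1 + Y))\<close>. Each pair of derivatives contributes a factor
    \<open>c\<close>, the square of \<open>2 * pi\<close>.\<close>
  define M where "M = C \<phi> + C (?d ?e \<phi>) / c + C (?d ?e' \<phi>) / c + C (?d ?e' (?d ?e \<phi>)) / c\<^sup>2"
  have *: "norm (fourier \<phi> z) \<le> M * (inverse (1 + (fst z)\<^sup>2) * inverse (1 + (snd z)\<^sup>2))" for z
  proof -
    have 1: "norm (fourier f \<xi>) \<le> C f" if "test_function_on U f" for f \<xi>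
      unfolding C_def by (intro norm_fourier_le test_function_integrable[OF that])
    have t1: "test_function_on U (?d ?e \<phi>)" "test_function_on U (?d ?e' \<phi>)"
      "test_function_on U (?d ?e' (?d ?e \<phi>))"
      by (intro test_function_deriv_along \<phi>)+
    define n X Y where "n = norm (fourier \<phi> z)" and "X = (fst z)\<^sup>2" and "Y = (snd z)\<^sup>2"
    have XY: "X \<ge> 0" "Y \<ge> 0" by (auto simp: X_def Y_def)
    have "c * (X * n) \<le> C (?d ?e \<phi>)"
      using 1[OF t1(1), of z] c
      by (subst (asm) dd[OF \<phi>]) (cases z, simp add: norm_mult norm_power n_def X_def mult.assoc)
    moreover have "c * (Y * n) \<le> C (?d ?e' \<phi>)"
      using 1[OF t1(2), of z] c
      by (subst (asm) dd[OF \<phi>]) (cases z, simp add: norm_mult norm_power n_def Y_def mult.assoc)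
    moreover have "c\<^sup>2 * (X * Y * n) \<le> C (?d ?e' (?d ?e \<phi>))"
      using 1[OF t1(3), of z] c
      by (subst (asm) dd[OF t1(1)], subst (asm) dd[OF \<phi>])
        (cases z, simp add: norm_mult norm_power n_def X_def Y_def power2_eq_square[of c] mult.assoc mult.left_commute)
    moreover have "x \<le> y / d" if "d * x \<le> y" "d > 0" for x y d :: real
      using that by (simp add: pos_le_divide_eq mult.commute)
    ultimately have "X * n \<le> C (?d ?e \<phi>) / c" "Y * n \<le> C (?d ?e' \<phi>) / c"
      "X * Y * n \<le> C (?d ?e' (?d ?e \<phi>)) / c\<^sup>2"
      using c by auto
    moreover have "n \<le> C \<phi>"
      using 1[OF \<phi>, of z] by (simp add: n_def)
    ultimately have "n + X * n + Y * n + X * Y * n \<le> M"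
      unfolding M_def by linarith
    then have "n * ((1 + X) * (1 + Y)) \<le> M"
      by (simp add: algebra_simps)
    moreover have "(1 + X) * (1 + Y) > 0"
      using XY by (intro mult_pos_pos) auto
    ultimately have "n \<le> M / ((1 + X) * (1 + Y))"
      by (simp add: pos_le_divide_eq)
    then show ?thesis by (simp add: n_def X_def Y_def divide_inverse inverse_mult_distrib)
  qed
  have "integrable lborel (\<lambda>x::real. inverse (1 + x\<^sup>2))"
    using integrable_inverse_1_plus_square by (simp add: set_integrable_def)
  from integrable_lborel_shear(1)[OF this this, of 0]
  have "integrable lborel (\<lambda>z::plane. M * (inverse (1 + (fst z)\<^sup>2) * inverse (1 + (snd z)\<^sup>2)))"
    by (intro integrable_mult_right) simp
  then show ?thesis
  proof (rule Bochner_Integration.integrable_bound)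
    show "fourier \<phi> \<in> borel_measurable lborel"
      using smooth_borel[OF test_function_smooth[OF \<phi>]] by simp
    have "norm (fourier \<phi> z) \<le> norm (M * (inverse (1 + (fst z)\<^sup>2) * inverse (1 + (snd z)\<^sup>2)))" for z
      using order_trans[OF *[of z] abs_ge_self] by (simp only: real_norm_def)
    then show "AE z in lborel. norm (fourier \<phi> z)
        \<le> norm (M * (inverse (1 + (fst z)\<^sup>2) * inverse (1 + (snd z)\<^sup>2)))"
      by simp
  qed
qed

section \<open>Spectra of functions invariant in one direction\<close>

lemma fourier_dist_lborel:
  "f \<in> borel_measurable borel \<Longrightarrow> \<phi> \<in> borel_measurable borel \<Longrightarrow>
    fourier_dist f \<phi> = (LINT x|lborel. f x * fourier \<phi> x)"
  unfolding fourier_dist_def by (subst integral_completion) auto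

lemma cis_2pi_eq_1: "cis (2 * pi * t) = 1 \<longleftrightarrow> t \<in> \<int>"
proof -
  have "cis (2 * pi * t) = 1 \<longleftrightarrow> (\<exists>n::int. 2 * pi * t = of_int (2 * n) * pi)"
    unfolding cis_conv_exp exp_eq_1 by simp
  also have "\<dots> \<longleftrightarrow> (\<exists>n::int. t = of_int n)"
  proof -
    have "2 * pi * t = of_int (2 * n) * pi \<longleftrightarrow> (2 * pi) * t = (2 * pi) * of_int n" for n :: int
      by (simp only: of_int_mult of_int_numeral mult_ac)
    then show ?thesis
      by simp
  qed
  also have "\<dots> \<longleftrightarrow> t \<in> \<int>"
    by (auto simp: Ints_def)
  finally show ?thesis .
qed

lemma bounded_mult_integrable:
  fixes f g :: "'a::euclidean_space \<Rightarrow> complex"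
  assumes "f \<in> borel_measurable borel" "\<And>z. norm (f z) \<le> C" "integrable lborel g"
  shows "integrable lborel (\<lambda>z. f z * g z)"
proof (rule Bochner_Integration.integrable_bound[OF integrable_mult_right[OF assms(3), of "of_real C"]])
  have "norm (f z * g z) \<le> norm (complex_of_real C * g z)" for z
    using mult_right_mono[OF order_trans[OF assms(2)[of z] abs_ge_self], of "norm (g z)"]
    by (simp add: norm_mult)
  then show "AE z in lborel. norm (f z * g z) \<le> norm (complex_of_real C * g z)" by simp
qed (use assms borel_measurable_integrable[OF assms(3)] in auto)

text \<open>On the support of the test function \<open>\<phi>\<close> the factor \<open>cis (2 * pi * t * (\<tau> \<bullet> \<xi>)) - 1\<close> can be
  divided out for small \<open>t\<close>; on the other side of the Fourier transform multiplication by this factor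
  is a difference operator in the direction \<open>\<tau>\<close>, which annihilates \<open>f\<close>.\<close>

lemma fourier_dist_invariant_eq_0:
  fixes f :: "plane \<Rightarrow> complex"
  assumes f: "f \<in> borel_measurable borel" "\<And>z. norm (f z) \<le> C"
    and inv: "\<And>z t. f (z + t *\<^sub>R \<tau>) = f z"
    and \<phi>: "test_function_on U \<phi>" and supp: "\<And>\<xi>. \<xi> \<in> closure {x. \<phi> x \<noteq> 0} \<Longrightarrow> \<xi> \<bullet> \<tau> \<noteq> 0"
  shows "fourier_dist f \<phi> = 0"
proof -
  obtain R where R: "\<And>\<xi>. \<xi> \<in> closure {x. \<phi> x \<noteq> 0} \<Longrightarrow> norm \<xi> \<le> R" "R > 0"
    using \<phi> unfolding test_function_on_def by (metis bounded_pos compact_imp_bounded)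
  \<comment> \<open>With this \<open>t\<close> the number
    \<open>\<xi> \<bullet> (t *\<^sub>R \<tau>)\<close> has modulus below 1 on the support, so the
    only integer it could equal is 0, which \<open>supp\<close> excludes. Adding 1 to
    \<open>norm \<tau>\<close> keeps the denominator positive for every
    \<open>\<tau>\<close>.\<close>
  define t where "t = 1 / (2 * R * (norm \<tau> + 1))"
  have t: "t > 0" using R(2) by (auto simp: t_def add_nonneg_pos)
  define g where "g \<xi> = cis (2 * pi * (\<xi> \<bullet> (t *\<^sub>R \<tau>))) - 1" for \<xi>
  have g0: "g \<xi> \<noteq> 0" if \<xi>: "\<xi> \<in> closure {x. \<phi> x \<noteq> 0}" for \<xi>
  proof -
    have "\<bar>\<xi> \<bullet> (t *\<^sub>R \<tau>)\<bar> \<le> t * (norm \<xi> * norm \<tau>)"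
      using Cauchy_Schwarz_ineq2[of \<xi> \<tau>] t by (simp add: abs_mult)
    also have "\<dots> \<le> t * (R * norm \<tau>)"
      using t R(1)[OF \<xi>] by (intro mult_left_mono mult_right_mono) auto
    also have "\<dots> < t * (2 * R * (norm \<tau> + 1))"
      using t R(2) by (intro mult_strict_left_mono) (auto simp: algebra_simps add_nonneg_pos)
    also have "\<dots> = 1"
      unfolding t_def using R(2) norm_ge_zero[of \<tau>] by (simp add: add_nonneg_eq_0_iff)
    finally have "\<bar>\<xi> \<bullet> (t *\<^sub>R \<tau>)\<bar> < 1" .
    moreover have "\<xi> \<bullet> (t *\<^sub>R \<tau>) \<noteq> 0"
      using supp[OF \<xi>] t by simp
    ultimately have "\<xi> \<bullet> (t *\<^sub>R \<tau>) \<notin> \<int>"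
      using Ints_nonzero_abs_less1 by blast
    then show ?thesis by (simp add: g_def cis_2pi_eq_1)
  qed
  have gsm: "smooth g"
    unfolding g_def by (intro smooth_diff smooth_cis smooth_const)
  define \<psi> where "\<psi> \<xi> = \<phi> \<xi> / g \<xi>" for \<xi>
  have \<psi>: "test_function_on U \<psi>"
    unfolding \<psi>_def by (intro test_function_divide \<phi> gsm g0)
  note int\<psi> = test_function_integrable[OF \<psi>]
  have [measurable]: "\<phi> \<in> borel_measurable borel" "\<psi> \<in> borel_measurable borel"
    using \<phi> \<psi> by (auto intro: smooth_borel test_function_smooth)
  have \<phi>_eq: "\<phi> = (\<lambda>\<xi>. cis (2 * pi * (\<xi> \<bullet> (t *\<^sub>R \<tau>))) * \<psi> \<xi> - \<psi> \<xi>)"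
  proof
    fix \<xi>
    have "\<phi> \<xi> = g \<xi> * \<psi> \<xi>"
      using g0[of \<xi>] closure_subset[of "{x. \<phi> x \<noteq> 0}"] by (cases "\<phi> \<xi> = 0") (auto simp: \<psi>_def)
    then show "\<phi> \<xi> = cis (2 * pi * (\<xi> \<bullet> (t *\<^sub>R \<tau>))) * \<psi> \<xi> - \<psi> \<xi>"
      unfolding g_def by (simp only: left_diff_distrib mult_1)
  qed
  have F: "fourier \<phi> z = fourier \<psi> (z - t *\<^sub>R \<tau>) - fourier \<psi> z" for z
    by (subst \<phi>_eq, subst fourier_diff[OF integrable_cis_mult[OF int\<psi>] int\<psi>])
      (simp only: fourier_modulate)
  have int: "integrable lborel (\<lambda>z. f z * fourier \<psi> z)"
    by (rule bounded_mult_integrable[OF f integrable_fourier_test_function[OF \<psi>]])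
  \<comment> \<open>By invariance \<open>f\<close> can be shifted together with the transform of
    \<open>\<psi>\<close>, so the two integrals that are subtracted below are the integral of one
    function and of its translate.\<close>
  have eq: "f z * fourier \<psi> (z - t *\<^sub>R \<tau>) = f (- t *\<^sub>R \<tau> + z) * fourier \<psi> (- t *\<^sub>R \<tau> + z)" for z
    using inv[of z "- t"] by (simp add: algebra_simps)
  have "fourier_dist f \<phi> = (LINT z|lborel. f z * fourier \<psi> (z - t *\<^sub>R \<tau>) - f z * fourier \<psi> z)"
    using f(1) by (simp add: fourier_dist_lborel F right_diff_distrib)
  also have "\<dots> = (LINT z|lborel. f z * fourier \<psi> (z - t *\<^sub>R \<tau>)) - (LINT z|lborel. f z * fourier \<psi> z)"
    unfolding eq by (intro Bochner_Integration.integral_diff integrable_lborel_translate[OF int] int)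
  also have "\<dots> = 0"
    unfolding eq using f(1) integral_lborel_translate[of "\<lambda>z. f z * fourier \<psi> z" "- t *\<^sub>R \<tau>"] by simp
  finally show ?thesis .
qed

text \<open>In the coordinates \<open>x\<close> and \<open>y' = y - m * x\<close> the phase
  \<open>x * a + y * b\<close> becomes \<open>x * (a + m * b) + y' * b\<close>, so the transform
  factorises.\<close>

lemma fourier_shear:
  fixes f g :: "real \<Rightarrow> complex"
  assumes f: "integrable lborel f" and g: "integrable lborel g"
  shows "fourier (\<lambda>z. f (fst z) * g (snd z - m * fst z)) (a, b) = fourier f (a + m * b) * fourier g b"
proof -
  have [measurable]: "f \<in> borel_measurable borel" "g \<in> borel_measurable borel"
    using assms[THEN borel_measurable_integrable] by simp_all
  let ?f = "\<lambda>x. cis (2 * pi * (x \<bullet> - (a + m * b))) * f x"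
  let ?g = "\<lambda>y. cis (2 * pi * (y \<bullet> - b)) * g y"
  have "cis (2 * pi * (z \<bullet> - (a, b))) * (f (fst z) * g (snd z - m * fst z))
      = ?f (fst z) * ?g (snd z - m * fst z)" for z
  proof -
    have "2 * pi * (z \<bullet> - (a, b)) =
        2 * pi * (fst z \<bullet> - (a + m * b)) + 2 * pi * ((snd z - m * fst z) \<bullet> - b)"
      by (cases z) (simp add: algebra_simps)
    then have "cis (2 * pi * (z \<bullet> - (a, b))) =
        cis (2 * pi * (fst z \<bullet> - (a + m * b))) * cis (2 * pi * ((snd z - m * fst z) \<bullet> - b))"
      by (simp only: cis_mult)
    then show ?thesis by (simp only: mult_ac)
  qed
  moreover have "(\<lambda>z. f (fst z) * g (snd z - m * fst z)) \<in> borel_measurable borel"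
    using integrable_lborel_shear(1)[OF assms, THEN borel_measurable_integrable] by simp
  ultimately have "fourier (\<lambda>z. f (fst z) * g (snd z - m * fst z)) (a, b)
      = (LINT z|lborel. ?f (fst z) * ?g (snd z - m * fst z))"
    by (simp only: fourier_lborel)
  also have "\<dots> = (LINT x|lborel. ?f x) * (LINT x|lborel. ?g x)"
    by (intro integrable_lborel_shear(2) integrable_cis_mult assms)
  finally show ?thesis by (simp add: fourier_lborel)
qed

lemma fourier_reflect:
  fixes g :: "real \<Rightarrow> complex"
  assumes [measurable]: "g \<in> borel_measurable borel"
  shows "fourier (\<lambda>x. g (- x)) \<xi> = fourier g (- \<xi>)"
  by (simp add: fourier_lborel,
      subst lborel_integral_real_affine[where c = "- 1" and t = 0]) simp_all

section \<open>Abel summation\<close>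

lemma power_exp_tendsto_0:
  assumes "\<epsilon> > (0::real)"
  shows "((\<lambda>x. x ^ k * exp (- (\<epsilon> * x))) \<longlongrightarrow> 0) at_top"
proof -
  have "((\<lambda>x. (\<epsilon> * x) ^ k / exp (\<epsilon> * x)) \<longlongrightarrow> 0) at_top"
    by (rule filterlim_compose[OF tendsto_power_div_exp_0])
      (use assms in \<open>auto intro!: filterlim_tendsto_pos_mult_at_top[OF tendsto_const] filterlim_ident\<close>)
  then have "((\<lambda>x. 1 / \<epsilon> ^ k * ((\<epsilon> * x) ^ k / exp (\<epsilon> * x))) \<longlongrightarrow> 1 / \<epsilon> ^ k * 0) at_top"
    by (intro tendsto_intros)
  also have "(\<lambda>x. 1 / \<epsilon> ^ k * ((\<epsilon> * x) ^ k / exp (\<epsilon> * x))) = (\<lambda>x. x ^ k * exp (- (\<epsilon> * x)))"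
    using assms by (auto simp: fun_eq_iff exp_minus power_mult_distrib field_simps)
  finally show ?thesis by simp
qed

lemma integrable_power_exp:
  assumes "\<epsilon> > (0::real)"
  shows "integrable lborel (\<lambda>x. indicator {0<..} x * (x ^ k * exp (- (\<epsilon> * x))))"
proof -
  have "integrable lborel (\<lambda>x::real. x ^ k * exp (- x) * indicator {0<..} x)"
    using has_bochner_integral_I0i_power_exp_m by (rule integrable.intros)
  from lborel_integrable_real_affine[OF this, of \<epsilon> 0] assms
  have "integrable lborel (\<lambda>x. (1 / \<epsilon> ^ k) * ((\<epsilon> * x) ^ k * exp (- (\<epsilon> * x)) * indicator {0<..} (\<epsilon> * x)))"
    by (intro integrable_mult_right) simp
  also have "(\<lambda>x. (1 / \<epsilon> ^ k) * ((\<epsilon> * x) ^ k * exp (- (\<epsilon> * x)) * indicator {0<..} (\<epsilon> * x)))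
     = (\<lambda>x. indicator {0<..} x * (x ^ k * exp (- (\<epsilon> * x))))"
    using assms by (auto simp: fun_eq_iff indicator_def power_mult_distrib zero_less_mult_iff)
  finally show ?thesis .
qed

lemma integral_halfline_FTC:
  fixes f F :: "real \<Rightarrow> complex"
  assumes F: "\<And>x. (F has_vector_derivative f x) (at x)" and f: "\<And>x. isCont f x"
    and int: "integrable lborel (\<lambda>x. indicator {0<..} x *\<^sub>R f x)"
    and lim: "(F \<longlongrightarrow> 0) at_top"
  shows "(LINT x|lborel. indicator {0<..} x *\<^sub>R f x) = - F 0"
proof -
  have e: "einterval 0 \<infinity> = {0::real<..}"
    by (simp add: zero_ereal_def)
  have "(LBINT x=0..\<infinity>. f x) = 0 - F 0"
  proof (rule interval_integral_FTC_integrable)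
    show "set_integrable lborel (einterval 0 \<infinity>) f"
      using int by (simp add: e set_integrable_def)
    have "isCont F 0"
      using F by (rule has_vector_derivative_continuous)
    then show "((F \<circ> real_of_ereal) \<longlongrightarrow> F 0) (at_right 0)"
      unfolding zero_ereal_def ereal_tendsto_simps
      by (simp add: isCont_def filterlim_at_split)
    show "((F \<circ> real_of_ereal) \<longlongrightarrow> 0) (at_left \<infinity>)"
      unfolding ereal_tendsto_simps using lim .
  qed (use F f in auto)
  then show ?thesis
    by (simp add: interval_lebesgue_integral_def e set_lebesgue_integral_def)
qed

lemma norm_exp_decay: "norm (of_real x ^ k * exp (- (c * complex_of_real x))) = \<bar>x\<bar> ^ k * exp (- (Re c * x))"
  by (simp add: norm_mult norm_power norm_exp_eq_Re)

text \<open>Explicit antiderivatives give both values. At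
  \<open>c = \<epsilon> + 2 * pi * \<beta> * \<i>\<close> these Laplace transforms are the Fourier
  transforms of one-sided exponentials.\<close>

lemma
  assumes c: "Re c > 0"
  shows integrable_laplace:
      "integrable lborel (\<lambda>x. indicator {0<..} x *\<^sub>R (of_real x ^ k * exp (- (c * complex_of_real x))))"
    and integral_laplace_0:
      "(LINT x|lborel. indicator {0<..} x *\<^sub>R exp (- (c * complex_of_real x))) = 1 / c"
    and integral_laplace_1:
      "(LINT x|lborel. indicator {0<..} x *\<^sub>R (of_real x * exp (- (c * complex_of_real x)))) = 1 / c\<^sup>2"
proof -
  have c0: "c \<noteq> 0" using c by auto
  show int: "integrable lborel (\<lambda>x. indicator {0<..} x *\<^sub>R (of_real x ^ k * exp (- (c * complex_of_real x))))" for k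
    by (rule Bochner_Integration.integrable_bound[OF integrable_power_exp[OF c, of k]])
      (auto simp: norm_exp_decay indicator_def)
  have lim: "((\<lambda>x. of_real x ^ k * exp (- (c * complex_of_real x))) \<longlongrightarrow> 0) at_top" for k
  proof (rule tendsto_norm_zero_cancel, unfold norm_exp_decay)
    show "((\<lambda>x. \<bar>x\<bar> ^ k * exp (- (Re c * x))) \<longlongrightarrow> 0) at_top"
      by (rule Lim_transform_eventually[OF power_exp_tendsto_0[OF c, of k]])
        (auto simp: eventually_at_top_linorder intro!: exI[of _ 0])
  qed
  note lim0 = lim[of 0] and lim1 = lim[of 1]
  have "((\<lambda>x. - (1 / c) * exp (- (c * complex_of_real x))) has_vector_derivative
      exp (- (c * complex_of_real x))) (at x)" for x
    using c0 by (auto intro!: derivative_eq_intros has_vector_derivative_real_field simp: field_simps)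
  from integral_halfline_FTC[OF this] int[of 0] tendsto_mult_right_zero[OF lim0[simplified], of "- (1 / c)"]
  show "(LINT x|lborel. indicator {0<..} x *\<^sub>R exp (- (c * complex_of_real x))) = 1 / c"
    by (auto intro!: continuous_intros)
  have "((\<lambda>x. - (1 / c) * (complex_of_real x * exp (- (c * complex_of_real x))) + - (1 / c\<^sup>2) * exp (- (c * complex_of_real x)))
      has_vector_derivative of_real x * exp (- (c * complex_of_real x))) (at x)" for x
    using c0 by (auto intro!: derivative_eq_intros has_vector_derivative_real_field simp: field_simps power2_eq_square)
  from integral_halfline_FTC[OF this] int[of 1]
    tendsto_add_zero[OF tendsto_mult_right_zero[OF lim1[simplified], of "- (1 / c)"]
      tendsto_mult_right_zero[OF lim0[simplified], of "- (1 / c\<^sup>2)"]]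
  show "(LINT x|lborel. indicator {0<..} x *\<^sub>R (of_real x * exp (- (c * complex_of_real x)))) = 1 / c\<^sup>2"
    by (auto intro!: continuous_intros)
qed

text \<open>Both sides are iterated integrals of one kernel, whose modulus is
  \<open>norm (g x) * norm (\<phi> y)\<close>; integrability of both functions is what allows
  Fubini.\<close>

lemma fourier_mult_formula:
  fixes \<phi> g :: "'a::euclidean_space \<Rightarrow> complex"
  assumes g: "integrable lborel g" and \<phi>: "integrable lborel \<phi>"
  shows "(LINT x|lborel. g x * fourier \<phi> x) = (LINT x|lborel. \<phi> x * fourier g x)"
proof -
  have [measurable]: "g \<in> borel_measurable borel" "\<phi> \<in> borel_measurable borel"
    using assms[THEN borel_measurable_integrable] by simp_all
  let ?K = "\<lambda>x y. cis (2 * pi * (x \<bullet> - y)) * (g x * \<phi> y)"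
  have K: "integrable lborel (\<lambda>y. ?K x y)" for x
    using integrable_mult_right[OF integrable_cis_mult[OF \<phi>, of "- x"], of "g x"]
    by (simp add: inner_commute mult.left_commute)
  have "integrable (lborel \<Otimes>\<^sub>M lborel) (\<lambda>z. (\<lambda>(x, y). ?K x y) z)"
    by (rule lborel_pair.Fubini_integrable)
      (use g K in \<open>simp_all add: norm_mult case_prod_beta' del: inner_minus_right\<close>)
  from lborel_pair.Fubini_integral[OF this]
  have "(LINT y|lborel. LINT x|lborel. ?K x y) = (LINT x|lborel. LINT y|lborel. ?K x y)" by simp
  moreover have "(LINT x|lborel. ?K x y) = \<phi> y * fourier g y" for y
    by (simp add: fourier_lborel flip: integral_mult_right_zero) (simp add: mult_ac)
  moreover have "(LINT y|lborel. ?K x y) = g x * fourier \<phi> x" for x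
    by (simp add: fourier_lborel inner_commute flip: integral_mult_right_zero) (simp add: mult_ac)
  ultimately show ?thesis by simp
qed

text \<open>The pairing with the transform of \<open>\<phi>\<close> converges absolutely, so the
  weights can be removed by dominated convergence; while they are present, the transform sits on the
  weighted function and can be computed.\<close>

lemma fourier_dist_abel_limit:
  fixes f :: "plane \<Rightarrow> complex"
  assumes f: "f \<in> borel_measurable borel" "\<And>z. norm (f z) \<le> C" and \<phi>: "test_function_on U \<phi>"
    and w: "\<And>n. w n \<in> borel_measurable borel" "\<And>n z. norm (w n z) \<le> 1"
      "\<And>z. (\<lambda>n. w n z) \<longlonglongrightarrow> 1" "\<And>n. integrable lborel (\<lambda>z. f z * w n z)"
  shows "(\<lambda>n. LINT x|lborel. \<phi> x * fourier (\<lambda>z. f z * w n z) x) \<longlonglongrightarrow> fourier_dist f \<phi>"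
proof -
  note [measurable] = f(1) w(1) smooth_borel[OF test_function_smooth[OF \<phi>]]
  have int: "integrable lborel (\<lambda>z. f z * fourier \<phi> z)"
    by (rule bounded_mult_integrable[OF f integrable_fourier_test_function[OF \<phi>]])
  have "(\<lambda>n. LINT z|lborel. f z * w n z * fourier \<phi> z) \<longlonglongrightarrow> (LINT z|lborel. f z * fourier \<phi> z)"
  proof (rule integral_dominated_convergence[OF _ _ integrable_norm[OF int]])
    show "AE z in lborel. (\<lambda>n. f z * w n z * fourier \<phi> z) \<longlonglongrightarrow> f z * fourier \<phi> z"
      using w(3) by (auto intro!: AE_I2 tendsto_eq_intros)
    show "AE z in lborel. norm (f z * w n z * fourier \<phi> z) \<le> norm (f z * fourier \<phi> z)" for n
    proof (rule AE_I2)
      fix z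
      have "norm (w n z) * norm (f z * fourier \<phi> z) \<le> 1 * norm (f z * fourier \<phi> z)"
        by (intro mult_right_mono w(2)) auto
      then show "norm (f z * w n z * fourier \<phi> z) \<le> norm (f z * fourier \<phi> z)"
        by (simp add: norm_mult mult_ac)
    qed
  qed auto
  then show ?thesis
    by (simp add: fourier_dist_lborel fourier_mult_formula[OF w(4) test_function_integrable[OF \<phi>]])
qed

section \<open>One-dimensional weights and their transforms\<close>

definition decay :: "real \<Rightarrow> real \<Rightarrow> complex"
  where "decay \<epsilon> x = of_real (exp (- (\<epsilon> * \<bar>x\<bar>)))"

definition sgn_decay :: "real \<Rightarrow> real \<Rightarrow> complex"
  where "sgn_decay \<epsilon> x = of_real (sgn x * exp (- (\<epsilon> * \<bar>x\<bar>)))"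

text \<open>The factor \<open>\<bar>x\<bar>\<close> is the Jacobian of \<open>y = x * t\<close>,
  which appears when a double cone is parametrised by the slope \<open>t\<close>.\<close>

definition abs_decay :: "real \<Rightarrow> real \<Rightarrow> complex"
  where "abs_decay \<epsilon> x = of_real (\<bar>x\<bar> * exp (- (\<epsilon> * \<bar>x\<bar>)))"

lemma decay_measurable [measurable]:
  "decay \<epsilon> \<in> borel_measurable borel" "sgn_decay \<epsilon> \<in> borel_measurable borel"
  "abs_decay \<epsilon> \<in> borel_measurable borel"
  unfolding decay_def[abs_def] sgn_decay_def[abs_def] abs_decay_def[abs_def] by measurable

context
  fixes \<epsilon> :: real
  assumes \<epsilon>: "\<epsilon> > 0"
begin

lemma fourier_halfline:
  fixes \<beta> :: real
  defines "c \<equiv> Complex \<epsilon> (2 * pi * \<beta>)"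
  shows "integrable lborel (\<lambda>x. complex_of_real (indicator {0<..} x * (x ^ k * exp (- (\<epsilon> * x)))))"
    and "fourier (\<lambda>x. complex_of_real (indicator {0<..} x * exp (- (\<epsilon> * x)))) \<beta> = 1 / c"
    and "fourier (\<lambda>x. complex_of_real (indicator {0<..} x * (x * exp (- (\<epsilon> * x))))) \<beta> = 1 / c\<^sup>2"
proof -
  show "integrable lborel (\<lambda>x. complex_of_real (indicator {0<..} x * (x ^ k * exp (- (\<epsilon> * x)))))"
    by (intro integrable_of_real integrable_power_exp \<epsilon>)
  have c: "Re c > 0" using \<epsilon> by (simp add: c_def)
  have e: "cis (2 * pi * (x \<bullet> - \<beta>)) * complex_of_real (exp (- (\<epsilon> * x))) = exp (- (c * complex_of_real x))" for x
    unfolding cis_conv_exp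
    by (simp add: c_def Complex_eq algebra_simps flip: exp_add exp_of_real)
  show "fourier (\<lambda>x. complex_of_real (indicator {0<..} x * exp (- (\<epsilon> * x)))) \<beta> = 1 / c"
    by (subst fourier_lborel, simp, subst integral_laplace_0[OF c, symmetric],
        rule Bochner_Integration.integral_cong[OF refl])
      (simp only: e[symmetric] of_real_mult scaleR_conv_of_real mult_ac)
  show "fourier (\<lambda>x. complex_of_real (indicator {0<..} x * (x * exp (- (\<epsilon> * x))))) \<beta> = 1 / c\<^sup>2"
    by (subst fourier_lborel, simp, subst integral_laplace_1[OF c, symmetric],
        rule Bochner_Integration.integral_cong[OF refl])
      (simp only: e[symmetric] of_real_mult scaleR_conv_of_real mult_ac)
qed

text \<open>Each function is an even or odd combination of a one-sided exponential and its
  reflection, and reflecting replaces \<open>c\<close> by its conjugate. The results are the Poisson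
  kernel, the conjugate Poisson kernel, and minus the \<open>\<epsilon>\<close>-derivative of the
  Poisson kernel; the last is negative as soon as \<open>2 * pi * \<bar>\<beta>\<bar>\<close>
  exceeds \<open>\<epsilon>\<close>.\<close>

lemma
  shows integrable_decay: "integrable lborel (decay \<epsilon>)"
    and integrable_sgn_decay: "integrable lborel (sgn_decay \<epsilon>)"
    and integrable_abs_decay: "integrable lborel (abs_decay \<epsilon>)"
    and fourier_decay: "fourier (decay \<epsilon>) \<beta> = of_real (2 * \<epsilon> / (\<epsilon>\<^sup>2 + (2 * pi * \<beta>)\<^sup>2))"
    and fourier_sgn_decay: "fourier (sgn_decay \<epsilon>) \<beta> = - \<i> * of_real (4 * pi * \<beta> / (\<epsilon>\<^sup>2 + (2 * pi * \<beta>)\<^sup>2))"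
    and fourier_abs_decay: "fourier (abs_decay \<epsilon>) \<beta> =
      of_real (2 * (\<epsilon>\<^sup>2 - (2 * pi * \<beta>)\<^sup>2) / (\<epsilon>\<^sup>2 + (2 * pi * \<beta>)\<^sup>2)\<^sup>2)"
proof -
  define h where "h x = complex_of_real (indicator {0<..} x * exp (- (\<epsilon> * x)))" for x
  define k where "k x = complex_of_real (indicator {0<..} x * (x * exp (- (\<epsilon> * x))))" for x
  have h: "integrable lborel h" and k: "integrable lborel k"
    using fourier_halfline(1)[of 0] fourier_halfline(1)[of 1] by (simp_all add: h_def[abs_def] k_def[abs_def])
  have h': "integrable lborel (\<lambda>x. h (- x))" and k': "integrable lborel (\<lambda>x. k (- x))"
    using lborel_integrable_real_affine[OF h, of "-1" 0] lborel_integrable_real_affine[OF k, of "-1" 0]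
    by simp_all
  define q where "q = 2 * pi * \<beta>"
  define D where "D = \<epsilon>\<^sup>2 + q\<^sup>2"
  have D: "D > 0" unfolding D_def using \<epsilon> by (intro add_pos_nonneg) auto
  define c where "c = Complex \<epsilon> q"
  have c0: "c \<noteq> 0" "cnj c \<noteq> 0" using \<epsilon> by (auto simp: c_def complex_eq_iff)
  have cc: "c * cnj c = of_real D"
    by (simp add: c_def D_def complex_eq_iff power2_eq_square)
  have hm: "h \<in> borel_measurable borel" "k \<in> borel_measurable borel"
    using borel_measurable_integrable[OF h] borel_measurable_integrable[OF k] by simp_all
  have c': "Complex \<epsilon> (2 * pi * - \<beta>) = cnj c"
    by (simp add: c_def q_def complex_cnj)
  have F: "fourier h \<beta> = 1 / c" "fourier k \<beta> = 1 / c\<^sup>2"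
    unfolding h_def[abs_def] k_def[abs_def] c_def q_def by (rule fourier_halfline)+
  have F': "fourier (\<lambda>x. h (- x)) \<beta> = 1 / cnj c" "fourier (\<lambda>x. k (- x)) \<beta> = 1 / (cnj c)\<^sup>2"
    unfolding fourier_reflect[OF hm(1)] fourier_reflect[OF hm(2)] c'[symmetric]
    unfolding h_def[abs_def] k_def[abs_def] by (rule fourier_halfline)+
  \<comment> \<open>At 0 the left side is 1 and the right side 0, so this identity, unlike the next
    two, holds only almost everywhere.\<close>
  have ae: "AE x in lborel. decay \<epsilon> x = h x + h (- x)"
    using AE_lborel_singleton[of 0]
    by eventually_elim (auto simp: decay_def h_def indicator_def)
  have s: "sgn_decay \<epsilon> = (\<lambda>x. h x - h (- x))"
    by (auto simp: sgn_decay_def h_def indicator_def fun_eq_iff sgn_if)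
  have a: "abs_decay \<epsilon> = (\<lambda>x. k x + k (- x))"
    by (auto simp: abs_decay_def k_def indicator_def fun_eq_iff)
  show "integrable lborel (sgn_decay \<epsilon>)" "integrable lborel (abs_decay \<epsilon>)"
    unfolding s a using h h' k k' by auto
  have [measurable]: "h \<in> borel_measurable borel"
    using borel_measurable_integrable[OF h] by simp
  show "integrable lborel (decay \<epsilon>)"
    using h h' by (subst integrable_cong_AE[OF _ _ ae]) auto
  have "fourier (decay \<epsilon>) \<beta> = fourier (\<lambda>x. h x + h (- x)) \<beta>"
    unfolding fourier_lborel[OF decay_measurable(1)]
    by (subst fourier_lborel, measurable, rule integral_cong_AE, measurable) (use ae in auto)
  also have "\<dots> = 1 / c + 1 / cnj c"
    by (subst fourier_add[OF h h']) (simp add: F F')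
  also have "\<dots> = (c + cnj c) / (c * cnj c)"
    using c0 by (simp add: field_simps)
  also have "\<dots> = of_real (2 * \<epsilon> / D)"
    unfolding cc by (simp add: complex_add_cnj c_def)
  finally show "fourier (decay \<epsilon>) \<beta> = of_real (2 * \<epsilon> / (\<epsilon>\<^sup>2 + (2 * pi * \<beta>)\<^sup>2))"
    by (simp add: D_def q_def)
  have "fourier (sgn_decay \<epsilon>) \<beta> = 1 / c - 1 / cnj c"
    unfolding s by (subst fourier_diff[OF h h']) (simp add: F F')
  also have "\<dots> = (cnj c - c) / (c * cnj c)"
    using c0 by (simp add: field_simps)
  also have "\<dots> = - \<i> * of_real (2 * q / D)"
    unfolding cc by (simp add: c_def complex_eq_iff)
  finally show "fourier (sgn_decay \<epsilon>) \<beta> = - \<i> * of_real (4 * pi * \<beta> / (\<epsilon>\<^sup>2 + (2 * pi * \<beta>)\<^sup>2))"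
    by (simp add: D_def q_def)
  have "fourier (abs_decay \<epsilon>) \<beta> = 1 / c\<^sup>2 + 1 / (cnj c)\<^sup>2"
    unfolding a by (subst fourier_add[OF k k']) (simp add: F F')
  also have "\<dots> = (c\<^sup>2 + (cnj c)\<^sup>2) / (c * cnj c)\<^sup>2"
    using c0 by (simp add: field_simps power_mult_distrib)
  also have "\<dots> = of_real (2 * (\<epsilon>\<^sup>2 - q\<^sup>2) / D\<^sup>2)"
    unfolding cc by (simp add: c_def complex_eq_iff power2_eq_square)
  finally show "fourier (abs_decay \<epsilon>) \<beta> =
      of_real (2 * (\<epsilon>\<^sup>2 - (2 * pi * \<beta>)\<^sup>2) / (\<epsilon>\<^sup>2 + (2 * pi * \<beta>)\<^sup>2)\<^sup>2)"
    by (simp add: D_def q_def)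
qed

end

section \<open>Lower bounds for transforms tested against bumps\<close>

lemma bump_ge_const:
  assumes "r > 0"
  obtains c where "c > 0" "\<And>z. z \<in> cball \<xi> (r / 2) \<Longrightarrow> bump \<xi> r z \<ge> c"
proof -
  \<comment> \<open>On the ball of half the radius the argument of the flat exponential is at least
    \<open>r^2 - (r / 2)^2\<close>, that is, \<open>3 / 4 * r^2\<close>.\<close>
  have "bump \<xi> r z \<ge> exp (- 1 / (3 / 4 * r\<^sup>2))" if "z \<in> cball \<xi> (r / 2)" for z
  proof -
    have "(z - \<xi>) \<bullet> (z - \<xi>) \<le> (r / 2)\<^sup>2"
      using that assms by (simp add: dist_norm norm_minus_commute flip: power2_norm_eq_inner)
    then have "r\<^sup>2 - (z - \<xi>) \<bullet> (z - \<xi>) \<ge> 3 / 4 * r\<^sup>2"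
      by (simp add: power_divide)
    moreover have "3 / 4 * r\<^sup>2 > 0" using assms by simp
    moreover have "exp (- 1 / s) \<le> exp_flat 0 t" if "s > 0" "s \<le> t" for s t :: real
      using that by (simp add: exp_flat_def frac_le)
    ultimately show ?thesis
      unfolding bump_def by blast
  qed
  then show thesis
    by (intro that[of "exp (- 1 / (3 / 4 * r\<^sup>2))"]) auto
qed

lemma bump_integrable: "r > 0 \<Longrightarrow> integrable lborel (bump \<xi> r)"
  using test_function_integrable[OF test_function_bump[of r \<xi> UNIV]]
  by (auto dest: integrable_Re)

lemma bump_eq_0: "r > 0 \<Longrightarrow> z \<notin> ball \<xi> r \<Longrightarrow> bump \<xi> r z = 0"
  using bump_pos_iff[of r \<xi> z] bump_nonneg[of \<xi> r z] by linarith

lemma bump_integral_pos: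
  assumes "r > 0"
  shows "(LINT z|lborel. bump \<xi> r z) > 0"
proof -
  obtain c where c: "c > 0" "\<And>z. z \<in> cball \<xi> (r / 2) \<Longrightarrow> bump \<xi> r z \<ge> c"
    using bump_ge_const[OF assms] by blast
  have "0 < c * measure lborel (cball \<xi> (r / 2))"
    using c(1) assms content_cball_pos[of "r / 2" \<xi>] by simp
  also have "\<dots> = (LINT z|lborel. indicator (cball \<xi> (r / 2)) z *\<^sub>R c)"
    by (simp add: mult.commute)
  also have "\<dots> \<le> (LINT z|lborel. bump \<xi> r z)"
    by (intro integral_mono borel_integrable_compact bump_integrable assms)
      (use c(2) bump_nonneg in \<open>auto simp: indicator_def\<close>)
  finally show ?thesis .
qed

lemma integral_indicator_shear:
  assumes "\<delta> > 0" "\<eta> > 0"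
  shows "integrable lborel (\<lambda>z. indicator {c - \<delta>..c + \<delta>} (fst z) * indicator {- \<eta>..\<eta>} (snd z - m * fst z) :: real)"
    and "(LINT z|lborel. indicator {c - \<delta>..c + \<delta>} (fst z) * indicator {- \<eta>..\<eta>} (snd z - m * fst z) :: real)
      = 4 * \<delta> * \<eta>"
  using integrable_lborel_shear[of "indicator {c - \<delta>..c + \<delta>} :: real \<Rightarrow> real" "indicator {- \<eta>..\<eta>}" m] assms
  by (auto simp: mult_ac)

text \<open>The weighted transform at \<open>(a, b)\<close> is \<open>- \<i>\<close> times a Poisson
  kernel in \<open>a + m * b\<close> times a conjugate Poisson kernel in \<open>b\<close>. Near the
  point \<open>(- m * s, s)\<close> of the normal line the second factor has the sign of
  \<open>s\<close> and is bounded away from 0, while the first keeps a fixed amount of mass on a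
  strip about the line. The integrals against a bump are therefore bounded away from 0 uniformly in
  the weight.\<close>

lemma fourier_dist_sgn_line_nonzero:
  fixes m s r :: real
  assumes m: "m > 0" and s: "s \<noteq> 0" and r: "r > 0"
  obtains \<phi> where "test_function_on (ball (- m * s, s) r) \<phi>"
    "fourier_dist (\<lambda>z. complex_of_real (sgn (snd z - m * fst z))) \<phi> \<noteq> 0"
proof -
  define \<xi> where "\<xi> = (- m * s, s)"
  \<comment> \<open>Radius at most \<open>\<bar>s\<bar> / 2\<close>, so that \<open>snd z\<close>
    keeps the sign of \<open>s\<close> on the ball.\<close>
  define \<rho> where "\<rho> = min r \<bar>s\<bar> / 2"
  have \<rho>: "\<rho> > 0" "\<rho> < r" "\<rho> \<le> \<bar>s\<bar> / 2"
    using s r by (auto simp: \<rho>_def)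
  \<comment> \<open>If \<open>\<bar>a + m * s\<bar> \<le> \<delta>\<close> and
    \<open>\<bar>a + m * b\<bar> \<le> \<epsilon> n \<le> \<delta>\<close>, then
    \<open>\<bar>b - s\<bar> \<le> 2 * \<delta> / m\<close>, and the distance to the centre is at
    most \<open>\<delta> * (1 + 2 / m)\<close>. The choice makes this half the radius of the bump,
    where the bump has a positive lower bound.\<close>
  define \<delta> where "\<delta> = \<rho> / (2 * (1 + 2 / m))"
  have \<delta>: "\<delta> > 0" "\<delta> * (1 + 2 / m) = \<rho> / 2"
    using \<rho>(1) m by (auto simp: \<delta>_def add_pos_pos field_simps add_nonneg_eq_0_iff)
  define \<epsilon> where "\<epsilon> n = min 1 \<delta> / real (Suc n)" for n
  have \<epsilon>: "\<epsilon> n > 0" "\<epsilon> n \<le> 1" "\<epsilon> n \<le> \<delta>" for n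
    using \<delta>(1) by (auto simp: \<epsilon>_def pos_divide_le_eq intro: min.coboundedI1 min.coboundedI2)
  have \<epsilon>_lim: "\<epsilon> \<longlonglongrightarrow> 0"
    unfolding \<epsilon>_def by (rule LIMSEQ_Suc[OF lim_const_over_n])
  define \<phi> where "\<phi> z = complex_of_real (bump \<xi> \<rho> z)" for z
  have test: "test_function_on (ball \<xi> r) \<phi>"
    unfolding \<phi>_def using \<rho> by (intro test_function_bump) (auto simp: cball_subset_ball_iff)
  define f where "f z = complex_of_real (sgn (snd z - m * fst z))" for z
  define w where "w n z = decay (\<epsilon> n) (fst z) * decay (\<epsilon> n) (snd z - m * fst z)" for n z
  define W where "W n z = 2 * \<epsilon> n / ((\<epsilon> n)\<^sup>2 + (2 * pi * (fst z + m * snd z))\<^sup>2)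
    * (4 * pi * snd z / ((\<epsilon> n)\<^sup>2 + (2 * pi * snd z)\<^sup>2))" for n z
  have fw: "(\<lambda>z. f z * w n z) = (\<lambda>z. decay (\<epsilon> n) (fst z) * sgn_decay (\<epsilon> n) (snd z - m * fst z))" for n
    by (auto simp: f_def w_def decay_def sgn_decay_def)
  have fw_int: "integrable lborel (\<lambda>z. f z * w n z)" for n
    unfolding fw by (intro integrable_lborel_shear integrable_decay integrable_sgn_decay \<epsilon>)
  have fw_hat: "fourier (\<lambda>z. f z * w n z) z = - \<i> * of_real (W n z)" for n z
    unfolding fw
    by (cases z, simp only: fourier_shear[OF integrable_decay[OF \<epsilon>(1)] integrable_sgn_decay[OF \<epsilon>(1)]]
        fourier_decay[OF \<epsilon>(1)] fourier_sgn_decay[OF \<epsilon>(1)] W_def of_real_mult fst_conv snd_conv mult_ac)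
  have lim: "(\<lambda>n. LINT z|lborel. \<phi> z * fourier (\<lambda>z. f z * w n z) z) \<longlonglongrightarrow> fourier_dist f \<phi>"
  proof (rule fourier_dist_abel_limit[OF _ _ test, of f 1 w])
    show "f \<in> borel_measurable borel"
      unfolding f_def borel_prod[symmetric] by measurable
    show "norm (f z) \<le> 1" for z
      by (simp add: f_def abs_sgn_eq)
    show "w n \<in> borel_measurable borel" for n
      unfolding w_def borel_prod[symmetric] by measurable
    show "norm (w n z) \<le> 1" for n z
      using \<epsilon>(1)[of n] by (simp add: w_def decay_def norm_mult mult_le_one)
    show "(\<lambda>n. w n z) \<longlonglongrightarrow> 1" for z
      unfolding w_def decay_def by (auto intro!: tendsto_eq_intros \<epsilon>_lim)
  qed (rule fw_int)
  have int: "integrable lborel (\<lambda>z. bump \<xi> \<rho> z * W n z)" for n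
  proof -
    have "integrable lborel (\<lambda>z. fourier (\<lambda>z. f z * w n z) z * \<phi> z)"
      using borel_measurable_integrable[OF fw_int[of n]] norm_fourier_le[OF fw_int[of n]]
      by (intro bounded_mult_integrable[OF _ _ test_function_integrable[OF test]]) auto
    then have "integrable lborel (\<lambda>z. - Im (fourier (\<lambda>z. f z * w n z) z * \<phi> z))"
      by (intro Bochner_Integration.integrable_minus integrable_Im)
    then show ?thesis
      unfolding fw_hat \<phi>_def by (simp add: mult.commute)
  qed
  define I where "I n = (LINT z|lborel. bump \<xi> \<rho> z * W n z)" for n
  have V: "(LINT z|lborel. \<phi> z * fourier (\<lambda>z. f z * w n z) z) = - \<i> * of_real (I n)" for n
  proof -
    have "\<phi> z * fourier (\<lambda>z. f z * w n z) z = - \<i> * complex_of_real (bump \<xi> \<rho> z * W n z)" for z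
      by (simp add: fw_hat \<phi>_def)
    then show ?thesis
      unfolding I_def by (simp only: integral_mult_right_zero integral_complex_of_real)
  qed
  obtain c0 where c0: "c0 > 0" "\<And>z. z \<in> cball \<xi> (\<rho> / 2) \<Longrightarrow> bump \<xi> \<rho> z \<ge> c0"
    using bump_ge_const[OF \<rho>(1)] by blast
  \<comment> \<open>A lower bound for the conjugate Poisson factor:
    \<open>4 * pi * \<bar>b\<bar>\<close> is at least \<open>2 * pi * \<bar>s\<bar>\<close>, and the
    denominator is at most \<open>1 + (2 * pi * (3 / 2 * s))^2\<close>.\<close>
  define \<kappa> where "\<kappa> = 2 * pi * \<bar>s\<bar> / (1 + 9 * pi\<^sup>2 * s\<^sup>2)"
  have pos1: "1 + 9 * pi\<^sup>2 * s\<^sup>2 > 0" "1 + 4 * pi\<^sup>2 > 0"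
    by (auto intro!: add_pos_nonneg)
  have \<kappa>: "\<kappa> > 0"
    using s pos1 by (simp add: \<kappa>_def)
  \<comment> \<open>Where \<open>\<bar>a + m * b\<bar> \<le> \<epsilon> n\<close>, the Poisson
    factor is at least \<open>2 / (1 + 4 * pi^2)\<close> divided by
    \<open>\<epsilon> n\<close>.\<close>
  define \<kappa>' where "\<kappa>' = 2 / (1 + 4 * pi\<^sup>2) * \<kappa>"
  have \<kappa>': "\<kappa>' > 0" using \<kappa> pos1 by (simp add: \<kappa>'_def)
  have bound: "sgn s * I n \<ge> c0 * \<kappa>' * (4 * \<delta> / m)" for n
  proof -
    \<comment> \<open>The indicator of the parallelogram
      \<open>\<bar>a + m * s\<bar> \<le> \<delta>\<close>,
      \<open>\<bar>a + m * b\<bar> \<le> \<epsilon> n\<close>, with the second condition divided by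
      \<open>m\<close> to take the form of a shear. Its area is
      \<open>4 * \<delta> * \<epsilon> n / m\<close>, which cancels the height
      \<open>1 / \<epsilon> n\<close> of the Poisson kernel, so the bound is free of
      \<open>n\<close>.\<close>
    let ?N = "\<lambda>z. indicator {- m * s - \<delta>..- m * s + \<delta>} (fst z)
      * indicator {- (\<epsilon> n / m)..\<epsilon> n / m} (snd z - (- (1 / m)) * fst z) :: real"
    have em: "\<epsilon> n / m > 0" using \<epsilon>(1)[of n] m by simp
    have snd_bounds: "\<bar>s\<bar> / 2 \<le> sgn s * snd z" "\<bar>snd z\<bar> \<le> 3 / 2 * \<bar>s\<bar>" "sgn s * snd z = \<bar>snd z\<bar>"
      if "z \<in> ball \<xi> \<rho>" for z
    proof -
      have "\<bar>snd z - s\<bar> \<le> \<bar>s\<bar> / 2"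
        using that \<rho>(3) dist_snd_le[of z \<xi>] by (simp add: \<xi>_def dist_real_def dist_commute)
      then show "\<bar>s\<bar> / 2 \<le> sgn s * snd z" "\<bar>snd z\<bar> \<le> 3 / 2 * \<bar>s\<bar>" "sgn s * snd z = \<bar>snd z\<bar>"
        using s by (auto simp: sgn_if abs_if split: if_splits)
    qed
    have Wpos: "0 \<le> sgn s * W n z" if "z \<in> ball \<xi> \<rho>" for z
    proof -
      have "sgn s * W n z = 2 * \<epsilon> n / ((\<epsilon> n)\<^sup>2 + (2 * pi * (fst z + m * snd z))\<^sup>2)
        * (4 * pi * \<bar>snd z\<bar> / ((\<epsilon> n)\<^sup>2 + (2 * pi * snd z)\<^sup>2))"
        unfolding snd_bounds(3)[OF that, symmetric] W_def by (simp add: mult_ac)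
      then show ?thesis using \<epsilon>(1)[of n] by simp
    qed
    have "c0 * \<kappa>' * (4 * \<delta> / m) = (LINT z|lborel. c0 * \<kappa>' / \<epsilon> n * ?N z)"
      unfolding integral_mult_right_zero integral_indicator_shear(2)[OF \<delta>(1) em]
      using \<epsilon>(1)[of n] m by simp
    also have "\<dots> \<le> (LINT z|lborel. sgn s * (bump \<xi> \<rho> z * W n z))"
    proof (rule integral_mono)
      show "integrable lborel (\<lambda>z. c0 * \<kappa>' / \<epsilon> n * ?N z)"
        by (intro integrable_mult_right integral_indicator_shear(1) \<delta> em)
      show "integrable lborel (\<lambda>z. sgn s * (bump \<xi> \<rho> z * W n z))"
        by (intro integrable_mult_right int)
      fix z :: plane
      obtain a b where z: "z = (a, b)" by (cases z)
      show "c0 * \<kappa>' / \<epsilon> n * ?N z \<le> sgn s * (bump \<xi> \<rho> z * W n z)"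
      proof (cases "\<bar>a + m * s\<bar> \<le> \<delta> \<and> \<bar>b + a / m\<bar> \<le> \<epsilon> n / m")
        case False
        then have N0: "?N z = 0" unfolding z by (auto simp: indicator_def)
        have "0 \<le> sgn s * (bump \<xi> \<rho> z * W n z)"
        proof (cases "z \<in> ball \<xi> \<rho>")
          case True
          then show ?thesis
            using mult_nonneg_nonneg[OF bump_nonneg[of \<xi> \<rho> z] Wpos[OF True]] by (simp add: mult_ac)
        qed (simp add: bump_eq_0[OF \<rho>(1)])
        then show ?thesis by (simp only: N0 mult_zero_right)
      next
        case True
        have "b - s = (b + a / m) - (a + m * s) / m"
          using m by (simp add: add_divide_distrib)
        moreover have "\<bar>(a + m * s) / m\<bar> \<le> \<delta> / m"
          using True m divide_right_mono[of "\<bar>a + m * s\<bar>" \<delta> m] by (simp add: abs_divide)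
        ultimately have "\<bar>b - s\<bar> \<le> \<epsilon> n / m + \<delta> / m"
          using True by linarith
        also have "\<dots> \<le> \<delta> * (2 / m)"
          using \<epsilon>(3)[of n] m by (simp add: divide_simps)
        finally have bs: "\<bar>b - s\<bar> \<le> \<delta> * (2 / m)" .
        have "dist z \<xi> \<le> \<bar>a + m * s\<bar> + \<bar>b - s\<bar>"
          using norm_Pair_le[of "a + m * s" "b - s"] by (simp add: z \<xi>_def dist_norm)
        also have "\<dots> \<le> \<rho> / 2"
          using True bs \<delta>(2) by (simp add: distrib_left)
        finally have zc: "z \<in> cball \<xi> (\<rho> / 2)" by (simp add: dist_commute)
        then have zb: "z \<in> ball \<xi> \<rho>" using \<rho>(1) by auto
        note sb = snd_bounds[OF zb, unfolded z snd_conv]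
        have "\<bar>a + m * b\<bar> \<le> \<epsilon> n"
        proof -
          have "\<bar>a + m * b\<bar> = m * \<bar>b + a / m\<bar>"
            using m by (simp add: abs_mult_pos' distrib_left add.commute)
          also have "\<dots> \<le> m * (\<epsilon> n / m)"
            using True m by (intro mult_left_mono) auto
          finally show ?thesis using m by simp
        qed
        then have "(a + m * b)\<^sup>2 \<le> (\<epsilon> n)\<^sup>2"
          by (simp add: abs_le_square_iff[symmetric] \<epsilon>(1) less_imp_le)
        moreover have "e + (2 * pi * x)\<^sup>2 \<le> e * (1 + 4 * pi\<^sup>2)" if "x\<^sup>2 \<le> e" for x e :: real
          using mult_left_mono[OF that, of "4 * pi\<^sup>2"] by (simp add: power_mult_distrib algebra_simps)
        ultimately have P1: "(\<epsilon> n)\<^sup>2 + (2 * pi * (a + m * b))\<^sup>2 \<le> (\<epsilon> n)\<^sup>2 * (1 + 4 * pi\<^sup>2)"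
          by blast
        have P: "2 / (1 + 4 * pi\<^sup>2) / \<epsilon> n \<le> 2 * \<epsilon> n / ((\<epsilon> n)\<^sup>2 + (2 * pi * (a + m * b))\<^sup>2)"
        proof -
          have "2 / (1 + 4 * pi\<^sup>2) / \<epsilon> n = 2 * \<epsilon> n / ((\<epsilon> n)\<^sup>2 * (1 + 4 * pi\<^sup>2))"
            using \<epsilon>(1)[of n] pos1 by (simp add: power2_eq_square)
          also have "\<dots> \<le> 2 * \<epsilon> n / ((\<epsilon> n)\<^sup>2 + (2 * pi * (a + m * b))\<^sup>2)"
            using \<epsilon>(1)[of n] pos1 P1 by (intro divide_left_mono mult_pos_pos add_pos_nonneg) auto
          finally show ?thesis .
        qed
        have "b\<^sup>2 \<le> (3 / 2 * \<bar>s\<bar>)\<^sup>2"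
          using sb(2) by (simp add: abs_le_square_iff[symmetric])
        then have "(2 * pi * b)\<^sup>2 \<le> 4 * pi\<^sup>2 * (9 / 4 * s\<^sup>2)"
          unfolding power_mult_distrib by (intro mult_mono) (auto simp: power_divide)
        moreover have "(\<epsilon> n)\<^sup>2 \<le> 1"
          using \<epsilon>(1,2)[of n] by (simp add: power_le_one)
        ultimately have Q1: "(\<epsilon> n)\<^sup>2 + (2 * pi * b)\<^sup>2 \<le> 1 + 9 * pi\<^sup>2 * s\<^sup>2"
          by simp
        have Q: "\<kappa> \<le> 4 * pi * (sgn s * b) / ((\<epsilon> n)\<^sup>2 + (2 * pi * b)\<^sup>2)"
          unfolding \<kappa>_def using sb(1) Q1 \<epsilon>(1)[of n] pi_gt_zero
          by (intro frac_le add_pos_nonneg) (auto simp: mult_ac)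
        have "c0 * (2 / (1 + 4 * pi\<^sup>2) / \<epsilon> n * \<kappa>) \<le>
          bump \<xi> \<rho> z * (2 * \<epsilon> n / ((\<epsilon> n)\<^sup>2 + (2 * pi * (a + m * b))\<^sup>2)
            * (4 * pi * (sgn s * b) / ((\<epsilon> n)\<^sup>2 + (2 * pi * b)\<^sup>2)))"
          using c0 zc P Q \<kappa> \<epsilon>(1)[of n] pos1 bump_nonneg[of \<xi> \<rho> z]
          by (intro mult_mono) auto
        moreover have "c0 * \<kappa>' / \<epsilon> n * ?N z \<le> c0 * \<kappa>' / \<epsilon> n * 1"
          using c0(1) \<kappa>' \<epsilon>(1)[of n] by (intro mult_left_mono) (auto simp: indicator_def)
        moreover have "c0 * \<kappa>' / \<epsilon> n = c0 * (2 / (1 + 4 * pi\<^sup>2) / \<epsilon> n * \<kappa>)"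
          by (simp add: \<kappa>'_def)
        moreover have "sgn s * (bump \<xi> \<rho> z * W n z) = bump \<xi> \<rho> z * (2 * \<epsilon> n / ((\<epsilon> n)\<^sup>2 + (2 * pi * (a + m * b))\<^sup>2)
            * (4 * pi * (sgn s * b) / ((\<epsilon> n)\<^sup>2 + (2 * pi * b)\<^sup>2)))"
          by (simp add: W_def z mult_ac)
        ultimately show ?thesis
          by linarith
      qed
    qed
    also have "\<dots> = sgn s * I n" by (simp add: I_def)
    finally show ?thesis .
  qed
  have "fourier_dist f \<phi> \<noteq> 0"
  proof
    assume "fourier_dist f \<phi> = 0"
    with lim have "(\<lambda>n. - \<i> * of_real (I n)) \<longlonglongrightarrow> 0" by (simp only: V)
    then have "(\<lambda>n. sgn s * - Im (- \<i> * of_real (I n))) \<longlonglongrightarrow> sgn s * - Im 0"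
      by (intro tendsto_intros)
    then have "(\<lambda>n. sgn s * I n) \<longlonglongrightarrow> 0" by simp
    from tendsto_lowerbound[OF this, of "c0 * \<kappa>' * (4 * \<delta> / m)"] bound
    have "c0 * \<kappa>' * (4 * \<delta> / m) \<le> 0" by simp
    moreover have "c0 * \<kappa>' * (4 * \<delta> / m) > 0"
      using c0(1) \<kappa>' \<delta>(1) m by simp
    ultimately show False by simp
  qed
  then show thesis
    using that test unfolding f_def \<xi>_def by blast
qed

text \<open>At fixed \<open>x\<close> the substitution \<open>y = x * t\<close> turns the slope into
  the variable of integration, and its Jacobian turns \<open>decay\<close> into
  \<open>abs_decay\<close>. Exchanging the integrals leaves the transform of
  \<open>abs_decay\<close> at \<open>a + t * b\<close>.\<close>

lemma
  fixes g :: "real \<Rightarrow> real"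
  assumes g: "integrable lborel g" "g 0 = 0" and \<epsilon>: "\<epsilon> > 0"
  defines "F \<equiv> \<lambda>z. complex_of_real (g (snd z / fst z)) * decay \<epsilon> (fst z)"
  shows integrable_cone: "integrable lborel F"
    and fourier_cone: "fourier F (a, b) = (LINT t|lborel. of_real (g t) * fourier (abs_decay \<epsilon>) (a + t * b))"
proof -
  have [measurable]: "g \<in> borel_measurable borel"
    using borel_measurable_integrable[OF g(1)] by simp
  have [measurable]: "F \<in> borel_measurable (borel \<Otimes>\<^sub>M borel)" "F \<in> borel_measurable (lborel \<Otimes>\<^sub>M lborel)"
    unfolding F_def by measurable
  then have [measurable]: "F \<in> borel_measurable borel"
    by (simp add: borel_prod)
  have sc: "(LINT y|lborel. h (y / x) * decay \<epsilon> x) = (LINT t|lborel. h t * abs_decay \<epsilon> x)"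
    if "h 0 = 0" for h :: "real \<Rightarrow> complex" and x
  proof (cases "x = 0")
    case False
    have "(LINT y|lborel. h (y / x) * decay \<epsilon> x) = (LINT t|lborel. h (x * t / x) * decay \<epsilon> x) * of_real \<bar>x\<bar>"
      by (subst lborel_integral_real_affine[OF False, of _ 0]) (simp add: scaleR_conv_of_real)
    also have "\<dots> = (LINT t|lborel. h t * abs_decay \<epsilon> x)"
      using False by (simp add: decay_def abs_decay_def mult_ac)
    finally show ?thesis .
  qed (simp add: that abs_decay_def)
  show F: "integrable lborel F"
    unfolding lborel_prod[symmetric]
  proof (rule lborel_pair.Fubini_integrable)
    have "(LINT y|lborel. norm (F (x, y))) = (LINT t|lborel. \<bar>g t\<bar>) * norm (abs_decay \<epsilon> x)" for x
    proof -
      have "complex_of_real (LINT y|lborel. norm (F (x, y)))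
        = (LINT y|lborel. of_real \<bar>g (y / x)\<bar> * decay \<epsilon> x)"
        unfolding integral_complex_of_real[symmetric]
        by (simp add: F_def norm_mult decay_def)
      also have "\<dots> = (LINT t|lborel. of_real \<bar>g t\<bar> * abs_decay \<epsilon> x)"
        by (rule sc) (simp add: g)
      also have "\<dots> = complex_of_real ((LINT t|lborel. \<bar>g t\<bar>) * norm (abs_decay \<epsilon> x))"
        unfolding integral_mult_left_zero integral_complex_of_real
        by (simp add: abs_decay_def norm_mult)
      finally show ?thesis
        by (simp only: of_real_eq_iff)
    qed
    then show "integrable lborel (\<lambda>x. LINT y|lborel. norm (F (x, y)))"
      using integrable_abs_decay[OF \<epsilon>] by simp
    show "AE x in lborel. integrable lborel (\<lambda>y. F (x, y))"
    proof (rule AE_I2)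
      fix x :: real
      show "integrable lborel (\<lambda>y. F (x, y))"
      proof (cases "x = 0")
        case False
        then show ?thesis
          using lborel_integrable_real_affine[OF g(1), of "1 / x" 0] by (simp add: F_def)
      qed (simp add: F_def g)
    qed
  qed measurable
  let ?K = "\<lambda>x t. cis (2 * pi * (x \<bullet> - (a + t * b))) * (abs_decay \<epsilon> x * of_real (g t))"
  have "integrable lborel (\<lambda>z. abs_decay \<epsilon> (fst z) * complex_of_real (g (snd z - 0 * fst z)))"
    by (rule integrable_lborel_shear(1)[OF integrable_abs_decay[OF \<epsilon>]]) (use g in auto)
  then have "integrable (lborel \<Otimes>\<^sub>M lborel) (\<lambda>z. abs_decay \<epsilon> (fst z) * complex_of_real (g (snd z)))"
    by (simp add: lborel_prod)
  then have K: "integrable (lborel \<Otimes>\<^sub>M lborel) (\<lambda>(x, t). ?K x t)"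
    by (rule Bochner_Integration.integrable_bound) (auto simp: norm_mult)
  have "fourier F (a, b) = (LINT z|lborel. cis (2 * pi * (z \<bullet> - (a, b))) * F z)"
    by (rule fourier_lborel) measurable
  also have "\<dots> = (LINT x|lborel. LINT y|lborel. cis (2 * pi * ((x, y) \<bullet> - (a, b))) * F (x, y))"
    using lborel_pair.integral_fst'[of "\<lambda>z. cis (2 * pi * (z \<bullet> - (a, b))) * F z"]
      integrable_cis_mult[OF F, of "- (a, b)"] by (simp add: lborel_prod)
  also have "\<dots> = (LINT x|lborel. LINT t|lborel. ?K x t)"
  proof (rule Bochner_Integration.integral_cong[OF refl])
    fix x :: real
    have "cis (2 * pi * ((x, y) \<bullet> - (a, b))) * F (x, y) =
        cis (2 * pi * (x \<bullet> - (a + y / x * b))) * of_real (g (y / x)) * decay \<epsilon> x" for y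
      by (cases "x = 0") (auto simp: F_def g algebra_simps)
    then have "(LINT y|lborel. cis (2 * pi * ((x, y) \<bullet> - (a, b))) * F (x, y)) =
        (LINT t|lborel. cis (2 * pi * (x \<bullet> - (a + t * b))) * of_real (g t) * abs_decay \<epsilon> x)"
      by (simp only:) (rule sc, simp add: g)
    then show "(LINT y|lborel. cis (2 * pi * ((x, y) \<bullet> - (a, b))) * F (x, y)) = (LINT t|lborel. ?K x t)"
      by (simp only: mult_ac)
  qed
  also have "\<dots> = (LINT t|lborel. LINT x|lborel. ?K x t)"
    using lborel_pair.Fubini_integral[OF K] by simp
  also have "\<dots> = (LINT t|lborel. of_real (g t) * fourier (abs_decay \<epsilon>) (a + t * b))"
    by (simp add: fourier_lborel[OF decay_measurable(3)] mult_ac flip: integral_mult_right_zero)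
  finally show "fourier F (a, b) = (LINT t|lborel. of_real (g t) * fourier (abs_decay \<epsilon>) (a + t * b))" .
qed

text \<open>For frequencies near \<open>(1, 1)\<close> and slopes \<open>t\<close> in
  \<open>{A..B}\<close> with \<open>A > 0\<close> the number \<open>a + t * b\<close> stays in a
  compact interval of positive reals, where the transform of \<open>abs_decay\<close> is below a
  negative constant uniformly in the weight. Multiplied by \<open>g \<le> 0\<close> it gives a
  positive lower bound. The second localisation, to radius \<open>1 / 2\<close>, keeps the test
  function off the axis \<open>fst \<xi> = 0\<close>, so that the constant function 1 can later be
  discarded.\<close>

lemma fourier_dist_cone_nonzero:
  fixes g :: "real \<Rightarrow> real"
  assumes g: "g \<in> borel_measurable borel" "\<And>t. g t \<le> 0" "\<And>t. \<bar>g t\<bar> \<le> C"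
    and A: "A > 0" and supp: "\<And>t. g t \<noteq> 0 \<Longrightarrow> t \<in> {A..B}"
    and neg: "(LINT t|lborel. g t) < 0" and r: "r > 0"
  obtains \<phi> where "test_function_on (ball (1, 1) r) \<phi>" "test_function_on (ball (1, 1) (1 / 2)) \<phi>"
    "fourier_dist (\<lambda>z. complex_of_real (g (snd z / fst z))) \<phi> \<noteq> 0"
proof -
  note [measurable] = g(1)
  define \<rho> where "\<rho> = min r (1 / 2) / 2"
  have \<rho>: "\<rho> > 0" "\<rho> < r" "\<rho> < 1 / 2" using r by (auto simp: \<rho>_def)
  have gint: "integrable lborel g"
  proof (rule integrableI_bounded_set[where A = "{A..B}" and B = C])
    show "AE x in lborel. x \<in> {A..B} \<longrightarrow> norm (g x) \<le> C" using g(3) by simp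
    show "emeasure lborel {A..B} < \<infinity>" by (cases "A \<le> B") auto
    show "AE x in lborel. x \<notin> {A..B} \<longrightarrow> g x = 0" using supp by blast
  qed auto
  have g0: "g 0 = 0" using supp[of 0] A by auto
  define \<epsilon> where "\<epsilon> n = 1 / real (Suc n)" for n
  have \<epsilon>: "\<epsilon> n > 0" "\<epsilon> n \<le> 1" for n by (auto simp: \<epsilon>_def)
  have \<epsilon>_lim: "\<epsilon> \<longlonglongrightarrow> 0"
    unfolding \<epsilon>_def by (rule LIMSEQ_Suc[OF lim_const_over_n])
  define \<xi> where "\<xi> = (1 :: real, 1 :: real)"
  define \<phi> where "\<phi> z = complex_of_real (bump \<xi> \<rho> z)" for z
  have test: "test_function_on (ball \<xi> r) \<phi>" "test_function_on (ball \<xi> (1 / 2)) \<phi>"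
    unfolding \<phi>_def using \<rho> by (auto intro!: test_function_bump simp: cball_subset_ball_iff)
  define f where "f z = complex_of_real (g (snd z / fst z))" for z
  define w where "w n z = decay (\<epsilon> n) (fst z)" for n and z :: plane
  define K where "K n \<beta> = 2 * ((\<epsilon> n)\<^sup>2 - (2 * pi * \<beta>)\<^sup>2) / ((\<epsilon> n)\<^sup>2 + (2 * pi * \<beta>)\<^sup>2)\<^sup>2" for n and \<beta> :: real
  define J where "J n z = (LINT t|lborel. g t * K n (fst z + t * snd z))" for n z
  have fw_int: "integrable lborel (\<lambda>z. f z * w n z)" for n
    unfolding f_def w_def by (rule integrable_cone[OF gint g0 \<epsilon>(1)])
  have fw_hat: "fourier (\<lambda>z. f z * w n z) z = of_real (J n z)" for n z
    unfolding f_def w_def J_def integral_complex_of_real[symmetric] of_real_mult K_def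
      fourier_abs_decay[OF \<epsilon>(1), symmetric]
    by (cases z) (simp only: fourier_cone[OF gint g0 \<epsilon>(1)] fst_conv snd_conv)
  have lim: "(\<lambda>n. LINT z|lborel. \<phi> z * fourier (\<lambda>z. f z * w n z) z) \<longlonglongrightarrow> fourier_dist f \<phi>"
  proof (rule fourier_dist_abel_limit[OF _ _ test(1), of f C w])
    show "f \<in> borel_measurable borel"
      unfolding f_def borel_prod[symmetric] by measurable
    show "norm (f z) \<le> C" for z
      using g(3) by (simp add: f_def)
    show "w n \<in> borel_measurable borel" for n
      unfolding w_def borel_prod[symmetric] by measurable
    show "norm (w n z) \<le> 1" for n z
      using \<epsilon>(1)[of n] by (simp add: w_def decay_def)
    show "(\<lambda>n. w n z) \<longlonglongrightarrow> 1" for z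
      unfolding w_def decay_def by (auto intro!: tendsto_eq_intros \<epsilon>_lim)
  qed (rule fw_int)
  have int: "integrable lborel (\<lambda>z. bump \<xi> \<rho> z * J n z)" for n
  proof -
    have "integrable lborel (\<lambda>z. fourier (\<lambda>z. f z * w n z) z * \<phi> z)"
      using borel_measurable_integrable[OF fw_int[of n]] norm_fourier_le[OF fw_int[of n]]
      by (intro bounded_mult_integrable[OF _ _ test_function_integrable[OF test(1)]]) auto
    then have "integrable lborel (\<lambda>z. Re (fourier (\<lambda>z. f z * w n z) z * \<phi> z))"
      by (intro integrable_Re)
    then show ?thesis
      unfolding fw_hat \<phi>_def by (simp add: mult.commute)
  qed
  define I where "I n = (LINT z|lborel. bump \<xi> \<rho> z * J n z)" for n
  have V: "(LINT z|lborel. \<phi> z * fourier (\<lambda>z. f z * w n z) z) = of_real (I n)" for n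
    unfolding I_def integral_complex_of_real[symmetric] by (simp add: fw_hat \<phi>_def)
  \<comment> \<open>The largest value of \<open>(2 * pi * \<beta>)^2\<close> over the
    \<open>\<beta> = a + t * b\<close> that occur, since \<open>a\<close> and \<open>b\<close> are
    at most \<open>3 / 2\<close> and \<open>t\<close> is at most \<open>B\<close>.\<close>
  define q where "q = (2 * pi * (3 / 2 * (1 + B)))\<^sup>2"
  have AB: "A \<le> B"
  proof (rule ccontr)
    assume "\<not> A \<le> B"
    then have "g = (\<lambda>_. 0)" using supp by fastforce
    with neg show False by simp
  qed
  have q: "q > 0" using AB A by (auto simp: q_def)
  define \<gamma> where "\<gamma> = - (LINT t|lborel. g t)"
  have \<gamma>: "\<gamma> > 0" using neg by (simp add: \<gamma>_def)
  have Kbound: "K n \<beta> \<le> - (1 / q)" if \<beta>: "1 / 2 \<le> \<beta>" "\<beta> \<le> 3 / 2 * (1 + B)" for n \<beta>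
  proof -
    define y where "y = (2 * pi * \<beta>)\<^sup>2"
    define e where "e = (\<epsilon> n)\<^sup>2"
    have "pi\<^sup>2 \<le> y"
      unfolding y_def using \<beta>(1) pi_gt_zero by (intro power_mono) (auto simp: field_simps)
    moreover have "3\<^sup>2 \<le> pi\<^sup>2"
      using pi_gt3 by (intro power_mono) auto
    ultimately have y9: "9 \<le> y" by simp
    have e: "0 \<le> e" "e \<le> 1" using \<epsilon>[of n] by (auto simp: e_def power_le_one)
    have yq: "y \<le> q"
      unfolding y_def q_def using \<beta> pi_gt_zero by (intro power_mono mult_left_mono) auto
    \<comment> \<open>Equivalent to \<open>e^2 + 4 * e * y \<le> y^2\<close>, which follows from
      \<open>e \<le> 1\<close> and \<open>y \<ge> 9\<close>. It says that half of the limiting size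
      \<open>2 / y\<close> of the kernel is already attained for every weight used.\<close>
    have "(e + y)\<^sup>2 \<le> 2 * (y - e) * y"
    proof -
      have "e * e \<le> 1" "e * y \<le> y" "9 * y \<le> y * y"
        using e y9 mult_le_one[of e e] mult_right_mono[of e 1 y] mult_right_mono[of 9 y y] by auto
      moreover have "(e + y)\<^sup>2 = e * e + 2 * (e * y) + y * y" "2 * (y - e) * y = 2 * (y * y) - 2 * (e * y)"
        by (simp_all add: power2_eq_square algebra_simps)
      ultimately show ?thesis
        using y9 by linarith
    qed
    moreover have "(e + y)\<^sup>2 > 0" using e y9 by simp
    ultimately have "1 / y \<le> 2 * (y - e) / (e + y)\<^sup>2"
      using y9 by (simp add: divide_simps mult_ac)
    moreover have "1 / q \<le> 1 / y"
      using yq y9 by (intro divide_left_mono) auto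
    moreover have "K n \<beta> = - (2 * (y - e) / (e + y)\<^sup>2)"
      unfolding K_def y_def[symmetric] e_def[symmetric] by (simp add: minus_divide_left)
    ultimately show ?thesis by linarith
  qed
  have Jbound: "J n z \<ge> \<gamma> / q" if z: "z \<in> ball \<xi> \<rho>" for n z
  proof -
    obtain a b where ab: "z = (a, b)" by (cases z)
    have "\<bar>a - 1\<bar> \<le> 1 / 2" "\<bar>b - 1\<bar> \<le> 1 / 2"
      using z \<rho>(3) dist_fst_le[of z \<xi>] dist_snd_le[of z \<xi>]
      by (auto simp: ab \<xi>_def dist_real_def dist_commute)
    then have a: "1 / 2 \<le> a" "a \<le> 3 / 2" and b: "1 / 2 \<le> b" "b \<le> 3 / 2" by linarith+
    have *: "g t * - (1 / q) \<le> g t * K n (a + t * b)" for t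
    proof -
      have "1 / 2 \<le> a + t * b \<and> a + t * b \<le> 3 / 2 * (1 + B)" if "g t \<noteq> 0"
      proof
        have t: "A \<le> t" "t \<le> B" using supp[OF that] by auto
        then have "0 \<le> t * b" using A b by (intro mult_nonneg_nonneg) auto
        then show "1 / 2 \<le> a + t * b" using a by linarith
        have "t * b \<le> B * (3 / 2)" using t A b by (intro mult_mono) auto
        then show "a + t * b \<le> 3 / 2 * (1 + B)" using a by (simp add: distrib_left)
      qed
      then show "g t * - (1 / q) \<le> g t * K n (a + t * b)"
        using mult_left_mono_neg[OF Kbound g(2)[of t], of "a + t * b" n] by fastforce
    qed
    have "\<gamma> / q = (LINT t|lborel. g t * - (1 / q))"
      by (simp add: \<gamma>_def)
    also have "\<dots> \<le> (LINT t|lborel. g t * K n (a + t * b))"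
    proof (rule integral_mono)
      show "integrable lborel (\<lambda>t. g t * - (1 / q))" using gint by auto
      show "integrable lborel (\<lambda>t. g t * K n (a + t * b))"
      proof (rule Bochner_Integration.integrable_bound[OF integrable_mult_left[OF gint, of "2 / (\<epsilon> n)\<^sup>2"]])
        show "(\<lambda>t. g t * K n (a + t * b)) \<in> borel_measurable lborel"
          unfolding K_def by measurable
        show "AE t in lborel. norm (g t * K n (a + t * b)) \<le> norm (g t * (2 / (\<epsilon> n)\<^sup>2))"
        proof (rule AE_I2)
          fix t :: real
          define y where "y = (2 * pi * (a + t * b))\<^sup>2"
          define e where "e = (\<epsilon> n)\<^sup>2"
          have e: "e > 0" "y \<ge> 0" using \<epsilon>(1)[of n] by (auto simp: e_def y_def)
          have "\<bar>2 * (e - y) / (e + y)\<^sup>2\<bar> \<le> 2 * (e + y) / (e + y)\<^sup>2"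
            unfolding abs_divide using e by (auto intro!: divide_right_mono simp: abs_le_iff)
          also have "\<dots> = 2 / (e + y)" using e by (simp add: power2_eq_square divide_simps add_nonneg_eq_0_iff)
          also have "\<dots> \<le> 2 / e" using e by (intro divide_left_mono mult_pos_pos) auto
          finally have "\<bar>K n (a + t * b)\<bar> \<le> 2 / e"
            by (simp add: K_def y_def e_def)
          then have "\<bar>g t\<bar> * \<bar>K n (a + t * b)\<bar> \<le> \<bar>g t\<bar> * (2 / e)"
            by (intro mult_left_mono) auto
          then show "norm (g t * K n (a + t * b)) \<le> norm (g t * (2 / (\<epsilon> n)\<^sup>2))"
            using e by (simp add: abs_mult e_def[symmetric])
        qed
      qed
    qed (rule *)
    finally show ?thesis by (simp add: J_def ab)
  qed
  have bound: "\<gamma> / q * (LINT z|lborel. bump \<xi> \<rho> z) \<le> I n" for n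
  proof -
    have "\<gamma> / q * (LINT z|lborel. bump \<xi> \<rho> z) = (LINT z|lborel. bump \<xi> \<rho> z * (\<gamma> / q))"
      by (simp add: mult.commute)
    also have "\<dots> \<le> I n"
      unfolding I_def
    proof (rule integral_mono[OF integrable_mult_left[OF bump_integrable[OF \<rho>(1)]] int])
      fix z
      show "bump \<xi> \<rho> z * (\<gamma> / q) \<le> bump \<xi> \<rho> z * J n z"
        by (cases "z \<in> ball \<xi> \<rho>")
          (simp only: mult_left_mono[OF Jbound bump_nonneg], simp add: bump_eq_0[OF \<rho>(1)])
    qed
    finally show ?thesis .
  qed
  have "fourier_dist f \<phi> \<noteq> 0"
  proof
    assume "fourier_dist f \<phi> = 0"
    with lim have "(\<lambda>n. complex_of_real (I n)) \<longlonglongrightarrow> 0" by (simp only: V)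
    then have "I \<longlonglongrightarrow> 0"
      using tendsto_Re by fastforce
    from tendsto_lowerbound[OF this] bound
    have "\<gamma> / q * (LINT z|lborel. bump \<xi> \<rho> z) \<le> 0" by simp
    moreover have "\<gamma> / q * (LINT z|lborel. bump \<xi> \<rho> z) > 0"
      using \<gamma> q bump_integral_pos[OF \<rho>(1), of \<xi>] by simp
    ultimately show False by linarith
  qed
  then show thesis
    using that test unfolding f_def \<xi>_def by blast
qed

section \<open>Spectra\<close>

text \<open>The equation of a line with its \<open>y\<close> coefficient normalised to 1; every line
  considered has a slope. Coefficients and orientation then enter only as scalar factors.\<close>

definition slope_form :: "plane \<Rightarrow> real \<Rightarrow> plane \<Rightarrow> real"
  where "slope_form p m z = (snd z - snd p) - m * (fst z - fst p)"

lemma slope_form_measurable [measurable]: "slope_form p m \<in> borel_measurable borel"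
  unfolding slope_form_def[abs_def] borel_prod[symmetric] by measurable

lemma normal_line_slope_form:
  "normal_line {z. slope_form p m z = 0} = {\<xi>. fst \<xi> + m * snd \<xi> = 0}"
proof (intro set_eqI iffI)
  fix \<xi> assume "\<xi> \<in> normal_line {z. slope_form p m z = 0}"
  moreover have "p + (1, m) \<in> {z. slope_form p m z = 0}" "p \<in> {z. slope_form p m z = 0}"
    by (simp_all add: slope_form_def)
  ultimately have "\<xi> \<bullet> ((p + (1, m)) - p) = 0"
    unfolding normal_line_def by blast
  then show "\<xi> \<in> {\<xi>. fst \<xi> + m * snd \<xi> = 0}"
    by (cases \<xi>) (simp add: mult.commute)
next
  fix \<xi> assume \<xi>: "\<xi> \<in> {\<xi>. fst \<xi> + m * snd \<xi> = 0}"
  have "\<xi> \<bullet> (z - w) = 0" if "slope_form p m z = 0" "slope_form p m w = 0" for z w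
  proof -
    have "snd z - snd w = m * (fst z - fst w)"
      using that by (simp add: slope_form_def algebra_simps)
    moreover have "\<xi> \<bullet> (z - w) = fst \<xi> * (fst z - fst w) + snd \<xi> * (snd z - snd w)"
      by (simp add: inner_prod_def)
    ultimately have "\<xi> \<bullet> (z - w) = (fst \<xi> + m * snd \<xi>) * (fst z - fst w)"
      by (simp add: distrib_right)
    then show ?thesis using \<xi> by simp
  qed
  then show "\<xi> \<in> normal_line {z. slope_form p m z = 0}"
    unfolding normal_line_def by blast
qed

text \<open>Translating the function is undone by modulating the test function, which does not
  enlarge its support. Spectra of functions centred at \<open>p\<close> can thus be found with the
  centre at the origin.\<close>

lemma fourier_dist_translate:
  fixes f \<phi> :: "plane \<Rightarrow> complex"
  assumes [measurable]: "f \<in> borel_measurable borel" "\<phi> \<in> borel_measurable borel"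
  shows "fourier_dist (\<lambda>z. f (z - p)) (\<lambda>\<xi>. cis (2 * pi * (\<xi> \<bullet> p)) * \<phi> \<xi>) = fourier_dist f \<phi>"
  using integral_lborel_translate[of "\<lambda>z. f z * fourier \<phi> z" "- p"]
  by (simp add: fourier_dist_lborel fourier_modulate)

lemma fourier_dist_sum:
  fixes f :: "'i \<Rightarrow> plane \<Rightarrow> complex"
  assumes f: "\<And>i. i \<in> I \<Longrightarrow> f i \<in> borel_measurable borel" "\<And>i z. i \<in> I \<Longrightarrow> norm (f i z) \<le> C"
    and \<phi>: "test_function_on U \<phi>"
  shows "fourier_dist (\<lambda>z. \<Sum>i\<in>I. c i * f i z) \<phi> = (\<Sum>i\<in>I. c i * fourier_dist (f i) \<phi>)"
proof -
  have \<phi>m: "\<phi> \<in> borel_measurable borel"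
    using \<phi> by (intro smooth_borel test_function_smooth)
  have int: "integrable lborel (\<lambda>z. c i * (f i z * fourier \<phi> z))" if "i \<in> I" for i
    using bounded_mult_integrable[OF f(1)[OF that] f(2)[OF that] integrable_fourier_test_function[OF \<phi>]]
    by (rule integrable_mult_right)
  have "fourier_dist (\<lambda>z. \<Sum>i\<in>I. c i * f i z) \<phi> = (LINT z|lborel. (\<Sum>i\<in>I. c i * f i z) * fourier \<phi> z)"
    by (intro fourier_dist_lborel \<phi>m borel_measurable_sum borel_measurable_times borel_measurable_const f)
  also have "\<dots> = (LINT z|lborel. (\<Sum>i\<in>I. c i * (f i z * fourier \<phi> z)))"
    by (simp add: sum_distrib_right mult.assoc)
  also have "\<dots> = (\<Sum>i\<in>I. c i * fourier_dist (f i) \<phi>)"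
    using f(1) by (subst Bochner_Integration.integral_sum[OF int]) (simp_all add: fourier_dist_lborel \<phi>m)
  finally show ?thesis .
qed

lemma spectrum_cong_AE:
  fixes f f' :: "plane \<Rightarrow> complex"
  assumes f: "f \<in> borel_measurable lebesgue" "f' \<in> borel_measurable borel" "AE z in lebesgue. f z = f' z"
  shows "spectrum f = spectrum f'"
proof -
  have "fourier_dist f \<phi> = fourier_dist f' \<phi>" if "test_function_on U \<phi>" for U \<phi>
  proof -
    have "fourier \<phi> \<in> borel_measurable lborel"
      using smooth_borel[OF test_function_smooth[OF that]] by simp
    then have [measurable]: "fourier \<phi> \<in> borel_measurable lebesgue" "f' \<in> borel_measurable lebesgue"
      using f(2) by (auto intro: measurable_completion)
    note [measurable] = f(1)
    show ?thesis
      unfolding fourier_dist_def by (rule integral_cong_AE) (measurable, use f(3) in auto)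
  qed
  then show ?thesis
    unfolding spectrum_def dist_support_def by (metis (no_types, lifting))
qed

lemma test_function_on_mono: "test_function_on U \<phi> \<Longrightarrow> U \<subseteq> V \<Longrightarrow> test_function_on V \<phi>"
  by (auto simp: test_function_on_def)

lemma not_in_spectrumI:
  "open U \<Longrightarrow> \<xi> \<in> U \<Longrightarrow> (\<And>\<phi>. test_function_on U \<phi> \<Longrightarrow> fourier_dist f \<phi> = 0) \<Longrightarrow> \<xi> \<notin> spectrum f"
  unfolding spectrum_def dist_support_def by blast

lemma in_spectrumI:
  assumes "\<And>U. open U \<Longrightarrow> \<xi> \<in> U \<Longrightarrow> \<exists>\<phi>. test_function_on U \<phi> \<and> fourier_dist f \<phi> \<noteq> 0"
  shows "\<xi> \<in> spectrum f"
  unfolding spectrum_def dist_support_def using assms by blast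

lemma closed_slope_normal: "closed {\<xi>. fst \<xi> + m * snd \<xi> = (0::real)}"
  by (intro closed_Collect_eq continuous_intros)

text \<open>The summand for slope \<open>m i\<close> is invariant along \<open>(1, m i)\<close>, so
  it is invisible off its own normal line. Normal lines of different slopes meet only at the origin;
  near any other point of one of them a single summand acts, and it does not vanish there. The
  origin belongs to the spectrum because every neighbourhood of it contains such points.\<close>

theorem spectrum_sgn_sum:
  assumes I: "finite I" and m: "inj_on m I" "\<And>i. i \<in> I \<Longrightarrow> m i > 0"
    and c: "\<And>i. i \<in> I \<Longrightarrow> c i \<noteq> (0::real)"
  shows "spectrum (\<lambda>z. complex_of_real (\<Sum>i\<in>I. c i * sgn (slope_form p (m i) z)))
    = (\<Union>i\<in>I. {\<xi>. fst \<xi> + m i * snd \<xi> = 0})"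
    (is "spectrum ?f = (\<Union>i\<in>I. ?N i)")
proof -
  define f where "f i z = complex_of_real (sgn (slope_form p (m i) z))" for i z
  have fm: "f i \<in> borel_measurable borel" for i
    unfolding f_def by measurable
  have fb: "norm (f i z) \<le> 1" for i z
    by (simp add: f_def abs_sgn_eq)
  have T: "fourier_dist ?f \<phi> = (\<Sum>i\<in>I. of_real (c i) * fourier_dist (f i) \<phi>)" if "test_function_on U \<phi>" for U \<phi>
    using fourier_dist_sum[where f = f and I = I and c = "\<lambda>i. of_real (c i)", OF fm fb that] by (simp add: f_def)
  have zero: "fourier_dist (f i) \<phi> = 0" if "test_function_on U \<phi>" "U \<inter> ?N i = {}" for i U \<phi>
  proof (rule fourier_dist_invariant_eq_0[OF fm fb _ that(1), where \<tau> = "(1, m i)"])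
    show "f i (z + t *\<^sub>R (1, m i)) = f i z" for z t
      by (simp add: f_def slope_form_def algebra_simps)
    show "\<xi> \<bullet> (1, m i) \<noteq> 0" if "\<xi> \<in> closure {x. \<phi> x \<noteq> 0}" for \<xi>
    proof -
      have "\<xi> \<in> U" using that \<open>test_function_on U \<phi>\<close> by (auto simp: test_function_on_def)
      then show ?thesis
        using \<open>U \<inter> ?N i = {}\<close> by (cases \<xi>) (auto simp: mult.commute)
    qed
  qed
  show ?thesis
  proof (intro set_eqI iffI)
    fix \<xi> assume \<xi>: "\<xi> \<in> spectrum ?f"
    show "\<xi> \<in> (\<Union>i\<in>I. ?N i)"
    proof (rule ccontr)
      assume n: "\<xi> \<notin> (\<Union>i\<in>I. ?N i)"
      have "\<xi> \<notin> spectrum ?f"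
      proof (rule not_in_spectrumI[of "- (\<Union>i\<in>I. ?N i)"])
        show "open (- (\<Union>i\<in>I. ?N i))"
          using I by (intro open_Compl closed_UN closed_slope_normal ballI)
        fix \<phi> assume \<phi>: "test_function_on (- (\<Union>i\<in>I. ?N i)) \<phi>"
        have "fourier_dist (f i) \<phi> = 0" if "i \<in> I" for i
          by (rule zero[OF \<phi>]) (use that in blast)
        then show "fourier_dist ?f \<phi> = 0"
          unfolding T[OF \<phi>] by simp
      qed (use n in simp)
      with \<xi> show False by simp
    qed
  next
    fix \<xi> assume "\<xi> \<in> (\<Union>i\<in>I. ?N i)"
    then obtain i where i: "i \<in> I" "\<xi> \<in> ?N i" by blast
    show "\<xi> \<in> spectrum ?f"
    proof (rule in_spectrumI)
      fix U assume U: "open U" "\<xi> \<in> U"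
      \<comment> \<open>The parameters of the points of the normal line inside \<open>U\<close>.
        This set is open and nonempty, hence contains some \<open>s \<noteq> 0\<close>; this covers
        the case where \<open>\<xi>\<close> is the origin.\<close>
      define A where "A = (\<lambda>s. (- m i * s, s)) -` U"
      have "open A"
        unfolding A_def by (rule open_vimage[OF U(1)]) (intro continuous_intros)
      moreover have "\<xi> = (- m i * snd \<xi>, snd \<xi>)"
        using i(2) by (cases \<xi>) (simp add: eq_neg_iff_add_eq_0)
      then have "snd \<xi> \<in> A"
        using U(2) by (simp add: A_def)
      ultimately have "\<not> A \<subseteq> {0}"
        using not_open_singleton by (metis empty_iff subset_singletonD)
      then obtain s where s: "s \<noteq> 0" "(- m i * s, s) \<in> U"
        by (auto simp: A_def)
      \<comment> \<open>Test functions supported in \<open>V\<close> annihilate all summands but the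
        \<open>i\<close>-th.\<close>
      define V where "V = U - (\<Union>j\<in>I - {i}. ?N j)"
      have "open V"
        unfolding V_def using I by (intro open_Diff U closed_UN closed_slope_normal ballI) auto
      moreover have "(- m i * s, s) \<notin> ?N j" if "j \<in> I - {i}" for j
      proof -
        have "m j \<noteq> m i" using that i(1) m(1) by (auto dest: inj_onD)
        then show ?thesis using s(1) by (simp add: left_diff_distrib[symmetric])
      qed
      then have "(- m i * s, s) \<in> V"
        using s(2) by (auto simp: V_def)
      ultimately obtain r where r: "r > 0" "ball (- m i * s, s) r \<subseteq> V"
        by (meson openE)
      obtain \<phi>0 where \<phi>0: "test_function_on (ball (- m i * s, s) r) \<phi>0"
        "fourier_dist (\<lambda>z. complex_of_real (sgn (snd z - m i * fst z))) \<phi>0 \<noteq> 0"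
        using fourier_dist_sgn_line_nonzero[OF m(2)[OF i(1)] s(1) r(1)] by blast
      define \<phi> where "\<phi> \<xi> = cis (2 * pi * (\<xi> \<bullet> p)) * \<phi>0 \<xi>" for \<xi>
      have \<phi>V: "test_function_on V \<phi>"
        unfolding \<phi>_def by (rule test_function_mult[OF test_function_on_mono[OF \<phi>0(1) r(2)] smooth_cis])
      have "fourier_dist (f j) \<phi> = 0" if "j \<in> I - {i}" for j
        by (rule zero[OF \<phi>V]) (use that in \<open>auto simp: V_def\<close>)
      then have "fourier_dist ?f \<phi> = of_real (c i) * fourier_dist (f i) \<phi>"
        unfolding T[OF \<phi>V] using I i(1) by (simp add: sum.remove)
      moreover have "fourier_dist (f i) \<phi> = fourier_dist (\<lambda>z. complex_of_real (sgn (snd z - m i * fst z))) \<phi>0"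
      proof -
        have "(\<lambda>z. complex_of_real (sgn (snd z - m i * fst z))) \<in> borel_measurable borel"
          unfolding borel_prod[symmetric] by measurable
        from fourier_dist_translate[OF this, of \<phi>0 p] show ?thesis
          using smooth_borel[OF test_function_smooth[OF \<phi>0(1)]]
          by (simp add: \<phi>_def[abs_def] f_def[abs_def] slope_form_def)
      qed
      ultimately have "fourier_dist ?f \<phi> \<noteq> 0"
        using \<phi>0(2) c[OF i(1)] by simp
      moreover have "test_function_on U \<phi>"
        using \<phi>V by (rule test_function_on_mono) (auto simp: V_def)
      ultimately show "\<exists>\<phi>. test_function_on U \<phi> \<and> fourier_dist ?f \<phi> \<noteq> 0" by blast
    qed
  qed
qed

text \<open>The constant part is invariant in the direction \<open>(1, 0)\<close> and so is
  annihilated by test functions supported where \<open>fst \<xi> \<noteq> 0\<close>; what remains is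
  the cone part, moved to the apex \<open>q\<close>.\<close>

lemma one_one_in_spectrum_cone:
  fixes g :: "real \<Rightarrow> real"
  assumes g: "g \<in> borel_measurable borel" "\<And>t. g t \<le> 0" "\<And>t. \<bar>g t\<bar> \<le> C"
    and A: "A > 0" and supp: "\<And>t. g t \<noteq> 0 \<Longrightarrow> t \<in> {A..B}"
    and neg: "(LINT t|lborel. g t) < 0" and k: "k \<noteq> (0::real)"
  shows "(1, 1) \<in> spectrum (\<lambda>z. complex_of_real (k * (1 + g ((snd z - snd q) / (fst z - fst q)))))"
    (is "_ \<in> spectrum ?f")
proof (rule in_spectrumI)
  fix U :: "plane set" assume "open U" "(1, 1) \<in> U"
  then obtain r where r: "r > 0" "ball (1, 1) r \<subseteq> U" by (meson openE)
  note [measurable] = g(1)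
  obtain \<phi>0 where \<phi>0: "test_function_on (ball (1, 1) r) \<phi>0" "test_function_on (ball (1, 1) (1 / 2)) \<phi>0"
    "fourier_dist (\<lambda>z. complex_of_real (g (snd z / fst z))) \<phi>0 \<noteq> 0"
    using fourier_dist_cone_nonzero[OF g A supp neg r(1)] by blast
  define \<phi> where "\<phi> \<xi> = cis (2 * pi * (\<xi> \<bullet> q)) * \<phi>0 \<xi>" for \<xi>
  have \<phi>: "test_function_on U \<phi>" "test_function_on (ball (1, 1) (1 / 2)) \<phi>"
    unfolding \<phi>_def using \<phi>0 test_function_on_mono[OF \<phi>0(1) r(2)]
    by (auto intro!: test_function_mult smooth_cis)
  \<comment> \<open>The constant and the cone part as a family over \<open>bool\<close>, so that
    \<open>fourier_dist_sum\<close> applies to their sum.\<close>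
  define f where "f b z = (if b then 1 else complex_of_real (g (snd (z - q) / fst (z - q))))" for b z
  have gm: "(\<lambda>z. complex_of_real (g (snd z / fst z))) \<in> borel_measurable borel"
    unfolding borel_prod[symmetric] by measurable
  have fm: "f b \<in> borel_measurable borel" for b
    unfolding f_def borel_prod[symmetric] by (cases b) (simp_all, measurable)
  have fb: "norm (f b z) \<le> max 1 C" for b z
    using g(3) by (auto simp: f_def le_max_iff_disj)
  have "fourier_dist (f True) \<phi> = 0"
  proof (rule fourier_dist_invariant_eq_0[OF fm fb _ \<phi>(2), where \<tau> = "(1, 0)"])
    show "\<xi> \<bullet> (1, 0) \<noteq> 0" if "\<xi> \<in> closure {x. \<phi> x \<noteq> 0}" for \<xi>
    proof -
      have "\<xi> \<in> ball (1, 1) (1 / 2)"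
        using that \<phi>(2) by (auto simp: test_function_on_def)
      then have "\<bar>1 - fst \<xi>\<bar> < 1 / 2"
        using dist_fst_le[of "(1, 1)" \<xi>] by (simp add: dist_real_def)
      then show ?thesis by (cases \<xi>) auto
    qed
  qed (simp add: f_def)
  moreover have "fourier_dist (f False) \<phi> = fourier_dist (\<lambda>z. complex_of_real (g (snd z / fst z))) \<phi>0"
    using fourier_dist_translate[OF gm, of \<phi>0 q] smooth_borel[OF test_function_smooth[OF \<phi>0(1)]]
    by (simp add: \<phi>_def[abs_def] f_def[abs_def])
  moreover have "fourier_dist ?f \<phi> = of_real k * fourier_dist (f True) \<phi> + of_real k * fourier_dist (f False) \<phi>"
    using fourier_dist_sum[where f = f and I = UNIV and c = "\<lambda>_. of_real k", OF fm fb \<phi>(1)]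
    by (simp add: UNIV_bool f_def distrib_left add.commute)
  ultimately have "fourier_dist ?f \<phi> \<noteq> 0"
    using \<phi>0(3) k by simp
  with \<phi>(1) show "\<exists>\<phi>. test_function_on U \<phi> \<and> fourier_dist ?f \<phi> \<noteq> 0" by blast
qed

section \<open>Sectors of a pencil of lines\<close>

text \<open>A component that meets one piece cannot leave it: the piece and the union of the other
  pieces are disjoint open sets that cover it.\<close>

lemma components_eqI:
  assumes "\<Union>F = A" and "\<And>C. C \<in> F \<Longrightarrow> open C \<and> connected C \<and> C \<noteq> {}" and "pairwise disjnt F"
  shows "components A = F"
proof -
  have comp: "connected_component_set A z = C" if C: "C \<in> F" "z \<in> C" for C z
  proof
    show "C \<subseteq> connected_component_set A z"
      by (rule connected_component_maximal[OF C(2)]) (use assms(1,2) C in blast)+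
    show "connected_component_set A z \<subseteq> C"
    proof (rule ccontr)
      assume "\<not> connected_component_set A z \<subseteq> C"
      then obtain w where w: "w \<in> connected_component_set A z" "w \<notin> C" by blast
      have z: "z \<in> connected_component_set A z"
        using assms(1) C by (blast intro: connected_component_refl)
      have "A \<subseteq> C \<union> \<Union>(F - {C})"
        using assms(1) by blast
      then have sub: "connected_component_set A z \<subseteq> C \<union> \<Union>(F - {C})"
        using connected_component_subset by fast
      have "open C" "open (\<Union>(F - {C}))"
        using assms(2) C(1) by (blast intro: open_Union)+
      moreover have "C \<inter> \<Union>(F - {C}) \<inter> connected_component_set A z = {}"
        using assms(3) C(1) unfolding pairwise_def disjnt_def by fast
      ultimately have "C \<inter> connected_component_set A z = {} \<or>
          \<Union>(F - {C}) \<inter> connected_component_set A z = {}"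
        by (intro connectedD[OF connected_connected_component] sub)
      then show False
        using z C(2) w sub by blast
    qed
  qed
  show ?thesis
  proof (intro set_eqI iffI)
    fix C assume "C \<in> components A"
    then obtain z where z: "z \<in> A" "C = connected_component_set A z"
      unfolding components_def by blast
    from z(1) obtain D where "D \<in> F" "z \<in> D" using assms(1) by blast
    then show "C \<in> F" unfolding z(2) by (simp only: comp)
  next
    fix C assume C: "C \<in> F"
    then obtain z where z: "z \<in> C" using assms(2) by blast
    then have "z \<in> A" using assms(1) C by blast
    then show "C \<in> components A"
      using comp[OF C z] unfolding components_def by blast
  qed
qed

lemma AE_off_line: "AE z in lebesgue. slope_form q m z \<noteq> 0"
proof -
  have "{z. slope_form q m z = 0} = {z. (- m, 1) \<bullet> z = (- m, 1) \<bullet> q}"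
    by (auto simp: slope_form_def inner_prod_def algebra_simps)
  then have "negligible {z. slope_form q m z = 0}"
    using negligible_hyperplane[of "(- m, 1) :: plane" "(- m, 1) \<bullet> q"] by (simp add: zero_prod_def)
  then show ?thesis
    by (intro AE_I'[of "{z. slope_form q m z = 0}"]) (auto simp: negligible_iff_null_sets)
qed

text \<open>The possible sign patterns off the lines: at a fixed point the form is monotone in the
  slope, so the signs change at most once. Since \<open>(0, \<sigma>)\<close> would repeat the
  pattern of \<open>(n, - \<sigma>)\<close> on \<open>{1..n}\<close>, the index \<open>j\<close> is
  taken from \<open>{1..n}\<close>, and the \<open>2 * n\<close> pairs then stand for distinct
  sectors.\<close>

definition sign_vector :: "nat \<Rightarrow> real \<Rightarrow> nat \<Rightarrow> real"
  where "sign_vector j \<sigma> d = (if d \<le> j then \<sigma> else - \<sigma>)"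

lemma prod_sign_vector:
  assumes "j \<le> n"
  shows "(\<Prod>d = 1..n. sign_vector j \<sigma> d) = \<sigma> ^ n * (- 1) ^ (n - j)"
  using assms
proof (induction rule: dec_induct)
  case base
  then show ?case by (simp add: sign_vector_def)
next
  case (step n)
  then show ?case by (simp add: sign_vector_def Suc_diff_le)
qed

text \<open>The first \<open>j\<close> terms add up to \<open>\<sigma>\<close> or 0 according to the
  parity of \<open>j\<close>; the later terms enter with the opposite sign and contribute the
  difference of the same quantity at \<open>j\<close> and at \<open>n\<close>.\<close>

lemma alternating_sum_sign_vector:
  assumes "j \<le> n"
  shows "(\<Sum>d = 1..n. (- 1) ^ (d - 1) * sign_vector j \<sigma> d)
    = \<sigma> * (2 * of_bool (odd j) - of_bool (odd n))"
  using assms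
proof (induction rule: dec_induct)
  case base
  have "(\<Sum>d = 1..i. (- 1) ^ (d - 1) * \<sigma>) = \<sigma> * of_bool (odd i)" for i
    by (induction i) (auto simp: power_minus_odd)
  moreover have "(\<Sum>d = 1..j. (- 1) ^ (d - 1) * sign_vector j \<sigma> d) = (\<Sum>d = 1..j. (- 1) ^ (d - 1) * \<sigma>)"
    by (intro sum.cong) (auto simp: sign_vector_def)
  ultimately show ?case by simp
next
  case (step n)
  then show ?case by (auto simp: sign_vector_def algebra_simps)
qed

locale line_pencil =
  fixes n :: nat and q :: plane and m :: "nat \<Rightarrow> real"
  assumes n: "n \<ge> 1" and mono: "strict_mono_on {1..n} m"
begin

abbreviation L :: "nat \<Rightarrow> plane \<Rightarrow> real"
  where "L d \<equiv> slope_form q (m d)"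

definition lines :: "plane set set"
  where "lines = (\<lambda>d. {z. L d z = 0}) ` {1..n}"

definition cell :: "(nat \<Rightarrow> real) \<Rightarrow> plane set"
  where "cell \<tau> = {z. \<forall>d\<in>{1..n}. \<tau> d * L d z > 0}"

abbreviation sector :: "nat \<Rightarrow> real \<Rightarrow> plane set"
  where "sector j \<sigma> \<equiv> cell (sign_vector j \<sigma>)"

abbreviation Idx :: "(nat \<times> real) set"
  where "Idx \<equiv> {1..n} \<times> {1, - 1}"

definition parity :: "plane \<Rightarrow> real"
  where "parity z = (\<Prod>d = 1..n. sgn (L d z))"

lemma m_less: "i \<in> {1..n} \<Longrightarrow> j \<in> {1..n} \<Longrightarrow> i < j \<Longrightarrow> m i < m j"
  using mono by (auto simp: strict_mono_on_def)

lemma m_le: "i \<in> {1..n} \<Longrightarrow> j \<in> {1..n} \<Longrightarrow> i \<le> j \<Longrightarrow> m i \<le> m j"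
  using m_less[of i j] by (cases "i = j") auto

lemma L_ray: "L d (q + s *\<^sub>R (1, t)) = s * (t - m d)"
  by (simp add: slope_form_def algebra_simps)

lemma L_affine: "L d (z + t *\<^sub>R (w - z)) = (1 - t) * L d z + t * L d w"
  by (simp add: slope_form_def algebra_simps)

lemma cell_eq: "cell \<tau> = (\<Inter>d\<in>{1..n}. {z. (\<tau> d *\<^sub>R (- m d, 1)) \<bullet> z > \<tau> d * ((- m d, 1) \<bullet> q)})"
  by (auto simp: cell_def slope_form_def inner_prod_def algebra_simps)

lemma cellD: "z \<in> cell \<tau> \<Longrightarrow> d \<in> {1..n} \<Longrightarrow> \<tau> d * L d z > 0"
  by (simp add: cell_def)

lemma open_cell: "open (cell \<tau>)"
  unfolding cell_eq by (intro open_INT ballI open_halfspace_gt) auto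

lemma connected_cell: "connected (cell \<tau>)"
  unfolding cell_eq by (intro convex_connected convex_INT convex_halfspace_gt)

lemma sector_nonempty:
  assumes "j \<in> {1..n}" "\<sigma> \<in> {1, - 1}"
  shows "sector j \<sigma> \<noteq> {}"
proof -
  \<comment> \<open>A slope strictly between the \<open>j\<close>-th and the next one, or above all
    of them for \<open>j = n\<close>. On the ray \<open>q + s *\<^sub>R (1, t)\<close> with
    \<open>s\<close> of sign \<open>\<sigma>\<close> the forms up to index \<open>j\<close> have
    sign \<open>\<sigma>\<close> and the others the opposite one.\<close>
  obtain t where t: "\<And>d. d \<in> {1..n} \<Longrightarrow> d \<le> j \<Longrightarrow> m d < t" "\<And>d. d \<in> {1..n} \<Longrightarrow> d > j \<Longrightarrow> t < m d"
  proof (cases "j = n")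
    case True
    have "m d < m n + 1" if "d \<in> {1..n}" for d
      using m_less[OF that, of n] n that by (cases "d = n") auto
    then show thesis using True by (intro that[of "m n + 1"]) auto
  next
    case False
    then have j: "Suc j \<in> {1..n}" using assms(1) by auto
    have 1: "m d \<le> m j" if "d \<in> {1..n}" "d \<le> j" for d
      using m_less[OF that(1) assms(1)] that(2) by (cases "d = j") auto
    have 2: "m (Suc j) \<le> m d" if "d \<in> {1..n}" "d > j" for d
      using m_less[OF j that(1)] that(2) by (cases "d = Suc j") auto
    have 3: "m j < m (Suc j)" using m_less[OF assms(1) j] by simp
    show thesis
      by (intro that[of "(m j + m (Suc j)) / 2"]) (use 1 2 3 in force)+
  qed
  have "sign_vector j \<sigma> d * L d (q + \<sigma> *\<^sub>R (1, t)) > 0" if "d \<in> {1..n}" for d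
    unfolding L_ray using t[OF that] assms(2) by (auto simp: sign_vector_def not_le)
  then have "q + \<sigma> *\<^sub>R (1, t) \<in> sector j \<sigma>"
    unfolding cell_def by blast
  then show ?thesis by blast
qed

text \<open>As \<open>1 \<le> j\<close>, the sign of the first form is \<open>\<sigma>\<close>;
  after that, two different indices disagree on the form with the larger index.\<close>

lemma sector_disjoint:
  assumes "j \<in> {1..n}" "\<sigma> \<in> {1, - 1}" "j' \<in> {1..n}" "\<sigma>' \<in> {1, - 1}"
    and z: "z \<in> sector j \<sigma>" "z \<in> sector j' \<sigma>'"
  shows "j = j' \<and> \<sigma> = \<sigma>'"
proof -
  have "\<sigma> * L 1 z > 0" "\<sigma>' * L 1 z > 0"
    using cellD[OF z(1), of 1] cellD[OF z(2), of 1] assms(1,3) n by (simp_all add: sign_vector_def)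
  then have \<sigma>: "\<sigma> = \<sigma>'" using assms(2,4) by auto
  have False if "i < i'" "i' \<in> {1..n}" "z \<in> sector i \<sigma>" "z \<in> sector i' \<sigma>" for i i'
    using cellD[OF that(3,2)] cellD[OF that(4,2)] that(1) by (simp add: sign_vector_def)
  from this[of j j'] this[of j' j] have "j = j'"
    using assms(1,3) z \<sigma> by (cases j j' rule: linorder_cases) blast+
  with \<sigma> show ?thesis by simp
qed

text \<open>\<open>\<sigma>\<close> is the sign of the first form and \<open>j\<close> the last
  index with that sign. The indices in between agree because \<open>y - m d * x\<close> is monotone
  in \<open>d\<close>: it is compared with its value at \<open>j\<close> if \<open>x \<ge> 0\<close>
  and with its value at 1 if \<open>x < 0\<close>.\<close>

lemma sector_cover:
  assumes z: "\<And>d. d \<in> {1..n} \<Longrightarrow> L d z \<noteq> 0"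
  obtains j \<sigma> where "j \<in> {1..n}" "\<sigma> \<in> {1, - 1}" "z \<in> sector j \<sigma>"
proof -
  define \<sigma> where "\<sigma> = sgn (L 1 z)"
  have \<sigma>: "\<sigma> \<in> {1, - 1}" "\<sigma> * L 1 z > 0"
    using z[of 1] n by (auto simp: \<sigma>_def sgn_if)
  define P where "P = {d \<in> {1..n}. \<sigma> * L d z > 0}"
  have P: "finite P" "1 \<in> P" using \<sigma> n by (auto simp: P_def)
  define j where "j = Max P"
  have j: "j \<in> P" using Max_in[of P] P unfolding j_def by blast
  define x y where "x = \<sigma> * (fst z - fst q)" and "y = \<sigma> * (snd z - snd q)"
  have Lxy: "\<sigma> * L d z = y - m d * x" for d
    by (simp add: slope_form_def x_def y_def algebra_simps)
  have down: "\<sigma> * L d z > 0" if d: "d \<in> {1..n}" "d \<le> j" for d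
  proof -
    have jn: "j \<in> {1..n}" "\<sigma> * L j z > 0" using j by (auto simp: P_def)
    have "m d \<le> m j" "m 1 \<le> m d"
      using m_le[OF d(1) jn(1) d(2)] m_le[of 1 d] d(1) n by auto
    show ?thesis
    proof (cases "x \<ge> 0")
      case True
      then have "m d * x \<le> m j * x" using \<open>m d \<le> m j\<close> by (intro mult_right_mono)
      then show ?thesis using jn(2) unfolding Lxy by linarith
    next
      case False
      then have "m d * x \<le> m 1 * x" using \<open>m 1 \<le> m d\<close> by (intro mult_right_mono_neg) auto
      then show ?thesis using \<sigma>(2) unfolding Lxy by linarith
    qed
  qed
  have up: "\<sigma> * L d z < 0" if d: "d \<in> {1..n}" "d > j" for d
  proof -
    have "d \<notin> P" using Max_ge[OF P(1), of d] d(2) by (auto simp: j_def)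
    then have "\<not> \<sigma> * L d z > 0" using d(1) by (simp add: P_def)
    moreover have "\<sigma> * L d z \<noteq> 0" using z[OF d(1)] \<sigma>(1) by auto
    ultimately show ?thesis by (meson linorder_neqE_linordered_idom)
  qed
  have "z \<in> sector j \<sigma>"
    using down up by (auto simp: cell_def sign_vector_def)
  then show thesis using that j \<sigma>(1) by (auto simp: P_def)
qed

lemma sector_imageE:
  assumes "A \<in> (\<lambda>(j, \<sigma>). sector j \<sigma>) ` Idx"
  obtains j \<sigma> where "j \<in> {1..n}" "\<sigma> \<in> {1, - 1}" "A = sector j \<sigma>"
proof -
  obtain x where x: "A = (case x of (j, \<sigma>) \<Rightarrow> sector j \<sigma>)" "x \<in> Idx"
    using assms by (rule imageE)
  obtain j \<sigma> where "x = (j, \<sigma>)" by (cases x)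
  then show thesis
    using x by (intro that[of j \<sigma>]) (simp_all only: case_prod_conv mem_Sigma_iff)
qed

lemma sectors_eq: "sectors lines = (\<lambda>(j, \<sigma>). sector j \<sigma>) ` Idx"
  unfolding sectors_def
proof (rule components_eqI)
  show "\<Union> ((\<lambda>(j, \<sigma>). sector j \<sigma>) ` Idx) = - \<Union>lines"
  proof (intro set_eqI iffI)
    fix z assume "z \<in> \<Union> ((\<lambda>(j, \<sigma>). sector j \<sigma>) ` Idx)"
    then obtain j \<sigma> where "z \<in> sector j \<sigma>"
      by (elim UnionE sector_imageE) blast
    show "z \<in> - \<Union>lines"
    proof (rule ComplI)
      assume "z \<in> \<Union>lines"
      then obtain d where d: "d \<in> {1..n}" "L d z = 0" unfolding lines_def by blast
      show False using cellD[OF \<open>z \<in> sector j \<sigma>\<close> d(1)] d(2) by simp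
    qed
  next
    fix z assume "z \<in> - \<Union>lines"
    then have "L d z \<noteq> 0" if "d \<in> {1..n}" for d
      using that by (auto simp: lines_def)
    from sector_cover[OF this] obtain j \<sigma> where "j \<in> {1..n}" "\<sigma> \<in> {1, - 1}" "z \<in> sector j \<sigma>" .
    then show "z \<in> \<Union> ((\<lambda>(j, \<sigma>). sector j \<sigma>) ` Idx)"
      by (intro UN_I[of "(j, \<sigma>)"] SigmaI) (simp_all only: case_prod_conv)
  qed
  show "pairwise disjnt ((\<lambda>(j, \<sigma>). sector j \<sigma>) ` Idx)"
  proof (rule pairwiseI)
    fix A B assume AB: "A \<in> (\<lambda>(j, \<sigma>). sector j \<sigma>) ` Idx" "B \<in> (\<lambda>(j, \<sigma>). sector j \<sigma>) ` Idx" "A \<noteq> B"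
    obtain j \<sigma> where j: "j \<in> {1..n}" "\<sigma> \<in> {1, - 1}" "A = sector j \<sigma>"
      using AB(1) by (rule sector_imageE)
    obtain j' \<sigma>' where j': "j' \<in> {1..n}" "\<sigma>' \<in> {1, - 1}" "B = sector j' \<sigma>'"
      using AB(2) by (rule sector_imageE)
    show "disjnt A B"
      using sector_disjoint[OF j(1,2) j'(1,2)] AB(3) j(3) j'(3) unfolding disjnt_iff by blast
  qed
  fix C assume "C \<in> (\<lambda>(j, \<sigma>). sector j \<sigma>) ` Idx"
  then obtain j \<sigma> where "j \<in> {1..n}" "\<sigma> \<in> {1, - 1}" "C = sector j \<sigma>"
    by (rule sector_imageE)
  then show "open C \<and> connected C \<and> C \<noteq> {}"
    using sector_nonempty open_cell connected_cell by blast
qed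

lemma inj_sector: "inj_on (\<lambda>(j, \<sigma>). sector j \<sigma>) Idx"
proof (rule inj_onI)
  fix a b assume ab: "a \<in> Idx" "b \<in> Idx" "(\<lambda>(j, \<sigma>). sector j \<sigma>) a = (\<lambda>(j, \<sigma>). sector j \<sigma>) b"
  obtain z where "z \<in> (\<lambda>(j, \<sigma>). sector j \<sigma>) a"
    using sector_nonempty[of "fst a" "snd a"] ab(1) by (auto simp: case_prod_beta)
  then show "a = b"
    using sector_disjoint[of "fst a" "snd a" "fst b" "snd b" z] ab
    by (auto simp: case_prod_beta prod_eq_iff)
qed

lemma card_sectors: "card (sectors lines) = 2 * n"
  unfolding sectors_eq card_image[OF inj_sector] by (simp add: card_cartesian_product)

text \<open>From a point satisfying the weak inequalities, any move along the segment towards a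
  point of the cell makes all of them strict, and the moves can be made arbitrarily small.\<close>

lemma closure_cell:
  assumes "cell \<tau> \<noteq> {}"
  shows "closure (cell \<tau>) = {z. \<forall>d\<in>{1..n}. \<tau> d * L d z \<ge> 0}"
proof
  have "{z. \<forall>d\<in>{1..n}. \<tau> d * L d z \<ge> 0} = (\<Inter>d\<in>{1..n}. {z. 0 \<le> \<tau> d * L d z})"
    by auto
  moreover have "closed {z. 0 \<le> \<tau> d * L d z}" for d
    unfolding slope_form_def by (intro closed_Collect_le continuous_intros)
  ultimately have "closed {z. \<forall>d\<in>{1..n}. \<tau> d * L d z \<ge> 0}"
    by (simp add: closed_INT)
  then show "closure (cell \<tau>) \<subseteq> {z. \<forall>d\<in>{1..n}. \<tau> d * L d z \<ge> 0}"
    by (intro closure_minimal) (auto simp: cell_def less_imp_le)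
  obtain w where w: "w \<in> cell \<tau>" using assms by blast
  show "{z. \<forall>d\<in>{1..n}. \<tau> d * L d z \<ge> 0} \<subseteq> closure (cell \<tau>)"
  proof
    fix z assume z: "z \<in> {z. \<forall>d\<in>{1..n}. \<tau> d * L d z \<ge> 0}"
    have "z + (1 / real (Suc i)) *\<^sub>R (w - z) \<in> cell \<tau>" for i
    proof -
      define t where "t = 1 / real (Suc i)"
      have t: "0 < t" "t \<le> 1" by (auto simp: t_def)
      have "\<tau> d * L d (z + t *\<^sub>R (w - z)) > 0" if d: "d \<in> {1..n}" for d
      proof -
        have "\<tau> d * L d (z + t *\<^sub>R (w - z)) = (1 - t) * (\<tau> d * L d z) + t * (\<tau> d * L d w)"
          unfolding L_affine by (simp add: algebra_simps)
        moreover have "(1 - t) * (\<tau> d * L d z) \<ge> 0" "t * (\<tau> d * L d w) > 0"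
          using t z w d by (auto simp: cell_def intro!: mult_nonneg_nonneg)
        ultimately show ?thesis by linarith
      qed
      then show ?thesis by (simp add: cell_def t_def)
    qed
    moreover have "(\<lambda>i. z + (1 / real (Suc i)) *\<^sub>R (w - z)) \<longlonglongrightarrow> z + 0 *\<^sub>R (w - z)"
      by (intro tendsto_intros LIMSEQ_Suc[OF lim_1_over_n])
    ultimately show "z \<in> closure (cell \<tau>)"
      unfolding closure_sequential by (auto intro!: exI[of _ "\<lambda>i. z + (1 / real (Suc i)) *\<^sub>R (w - z)"])
  qed
qed

lemma two_lines_meet:
  assumes "d \<in> {1..n}" "d' \<in> {1..n}" "d \<noteq> d'" "L d z = 0" "L d' z = 0"
  shows "z = q"
proof -
  have "m d \<noteq> m d'" using m_less[of d d'] m_less[of d' d] assms by (cases "d < d'") auto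
  moreover have "(m d - m d') * (fst z - fst q) = 0"
    using assms(4,5) by (simp add: slope_form_def algebra_simps)
  ultimately have "fst z = fst q" by simp
  then show ?thesis using assms(4) by (simp add: slope_form_def prod_eq_iff)
qed

section \<open>Adjacent sectors and the two alternating classes\<close>

definition index_parity :: "nat \<Rightarrow> real \<Rightarrow> real"
  where "index_parity j \<sigma> = (\<Prod>d = 1..n. sign_vector j \<sigma> d)"

lemma index_parity: "\<sigma> \<in> {1, - 1} \<Longrightarrow> index_parity j \<sigma> \<in> {1, - 1}"
proof -
  assume "\<sigma> \<in> {1, - 1}"
  then have "\<bar>index_parity j \<sigma>\<bar> = 1"
    unfolding index_parity_def abs_prod by (intro prod.neutral) (auto simp: sign_vector_def)
  then show ?thesis by (auto simp: abs_if split: if_splits)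
qed

text \<open>On the intersection of the closures every form on which the sign vectors differ must
  vanish. If there were two such forms the intersection would be contained in \<open>{q}\<close>,
  hence finite; so exactly one sign is flipped.\<close>

lemma adjacent_index_parity:
  assumes i: "j \<in> {1..n}" "\<sigma> \<in> {1, - 1}" "j' \<in> {1..n}" "\<sigma>' \<in> {1, - 1}"
    and adj: "adjacent (sector j \<sigma>) (sector j' \<sigma>')"
  shows "index_parity j' \<sigma>' = - index_parity j \<sigma>"
proof -
  let ?s = "sign_vector j \<sigma>" and ?s' = "sign_vector j' \<sigma>'"
  have val: "?s d \<in> {1, - 1}" "?s' d \<in> {1, - 1}" for d
    using i by (auto simp: sign_vector_def)
  have "\<exists>d\<in>{1..n}. ?s d \<noteq> ?s' d"
  proof (rule ccontr)
    assume "\<not> ?thesis"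
    then have "sector j \<sigma> = sector j' \<sigma>'" by (auto simp: cell_def)
    with adj show False by (simp add: adjacent_def)
  qed
  then obtain d0 where d0: "d0 \<in> {1..n}" "?s d0 \<noteq> ?s' d0" by blast
  have same: "?s d = ?s' d" if d: "d \<in> {1..n} - {d0}" for d
  proof (rule ccontr)
    assume ne: "?s d \<noteq> ?s' d"
    have zero: "L e z = 0" if "e \<in> {1..n}" "?s e \<noteq> ?s' e"
      "z \<in> closure (sector j \<sigma>) \<inter> closure (sector j' \<sigma>')" for e z
    proof -
      have "?s e * L e z \<ge> 0" "?s' e * L e z \<ge> 0"
        using that(1,3) closure_cell[OF sector_nonempty[OF i(1,2)]]
          closure_cell[OF sector_nonempty[OF i(3,4)]] by auto
      then show ?thesis using val[of e] that(2) by auto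
    qed
    have "closure (sector j \<sigma>) \<inter> closure (sector j' \<sigma>') \<subseteq> {q}"
      using two_lines_meet[of d d0] zero[OF d0] zero[of d] d ne d0(1) by blast
    then have "finite (closure (sector j \<sigma>) \<inter> closure (sector j' \<sigma>'))"
      by (rule finite_subset) simp
    with adj show False by (simp add: adjacent_def)
  qed
  have "?s' d0 = - ?s d0" using val[of d0] d0(2) by auto
  moreover have "(\<Prod>d\<in>{1..n} - {d0}. ?s' d) = (\<Prod>d\<in>{1..n} - {d0}. ?s d)"
    by (intro prod.cong) (auto simp: same)
  ultimately show ?thesis
    unfolding index_parity_def using d0(1) by (simp add: prod.remove)
qed

lemma infinite_ray: "infinite ((\<lambda>s. q + s *\<^sub>R (1, t)) ` {0<..})" "infinite ((\<lambda>s. q + s *\<^sub>R (1, t)) ` {..<0})"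
  by (subst finite_image_iff; auto simp: inj_on_def infinite_Ioi infinite_Iio)+

text \<open>A ray from \<open>q\<close> of slope \<open>t\<close> that lies in both closures makes
  their intersection infinite. \<open>\<rho>\<close> selects the side of \<open>q\<close>, and
  \<open>\<rho> * (t - m d)\<close> has the sign of the \<open>d\<close>-th form on the ray.\<close>

lemma adjacent_rayI:
  assumes "j \<in> {1..n}" "\<sigma> \<in> {1, - 1}" "j' \<in> {1..n}" "\<sigma>' \<in> {1, - 1}" "(j, \<sigma>) \<noteq> (j', \<sigma>')"
    and \<rho>: "\<rho> \<in> {1, - 1}"
    and ray: "\<And>d. d \<in> {1..n} \<Longrightarrow> sign_vector j \<sigma> d * \<rho> * (t - m d) \<ge> 0"
      "\<And>d. d \<in> {1..n} \<Longrightarrow> sign_vector j' \<sigma>' d * \<rho> * (t - m d) \<ge> 0"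
  shows "adjacent (sector j \<sigma>) (sector j' \<sigma>')"
  unfolding adjacent_def
proof
  show "sector j \<sigma> \<noteq> sector j' \<sigma>'"
    using inj_onD[OF inj_sector, of "(j, \<sigma>)" "(j', \<sigma>')"] assms by auto
  let ?R = "(\<lambda>s. q + s *\<^sub>R (1, t)) ` (if \<rho> = 1 then {0<..} else {..<0})"
  have "?R \<subseteq> closure (sector i \<theta>)"
    if i: "i \<in> {1..n}" "\<theta> \<in> {1, - 1}" "\<And>d. d \<in> {1..n} \<Longrightarrow> sign_vector i \<theta> d * \<rho> * (t - m d) \<ge> 0" for i \<theta>
  proof
    fix z assume "z \<in> ?R"
    then obtain s where s: "z = q + s *\<^sub>R (1, t)" "s = \<rho> * \<bar>s\<bar>"
      using \<rho> by (auto split: if_splits)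
    have eq: "sign_vector i \<theta> d * L d z = \<bar>s\<bar> * (sign_vector i \<theta> d * \<rho> * (t - m d))" for d
      unfolding s(1) L_ray by (subst s(2)) (simp add: mult_ac)
    have "sign_vector i \<theta> d * L d z \<ge> 0" if "d \<in> {1..n}" for d
      unfolding eq using mult_nonneg_nonneg[OF abs_ge_zero i(3)[OF that]] .
    then show "z \<in> closure (sector i \<theta>)"
      unfolding closure_cell[OF sector_nonempty[OF i(1,2)]] by blast
  qed
  then have "?R \<subseteq> closure (sector j \<sigma>) \<inter> closure (sector j' \<sigma>')"
    using assms by blast
  moreover have "infinite ?R" using infinite_ray by simp
  ultimately show "infinite (closure (sector j \<sigma>) \<inter> closure (sector j' \<sigma>'))"
    by (rule infinite_super)
qed

text \<open>The common ray lies on the line of index \<open>Suc j\<close>, the only one on which the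
  two sign vectors differ.\<close>

lemma adjacent_Suc:
  assumes "j \<in> {1..n}" "Suc j \<le> n" "\<sigma> \<in> {1, - 1}"
  shows "adjacent (sector j \<sigma>) (sector (Suc j) \<sigma>)"
proof (rule adjacent_rayI[where \<rho> = \<sigma> and t = "m (Suc j)"])
  fix d assume d: "d \<in> {1..n}"
  have "d \<le> Suc j \<Longrightarrow> m d \<le> m (Suc j)" "d \<ge> Suc j \<Longrightarrow> m (Suc j) \<le> m d"
    using m_le[of d "Suc j"] m_le[of "Suc j" d] d assms by auto
  then show "sign_vector j \<sigma> d * \<sigma> * (m (Suc j) - m d) \<ge> 0"
    "sign_vector (Suc j) \<sigma> d * \<sigma> * (m (Suc j) - m d) \<ge> 0"
    using assms(3) by (auto simp: sign_vector_def)
qed (use assms in auto)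

text \<open>The common ray lies on the first line, on the side \<open>- \<sigma>\<close>. Together
  with \<open>adjacent_Suc\<close> this closes the cycle of the \<open>2 * n\<close>
  sectors.\<close>

lemma adjacent_wrap:
  assumes "\<sigma> \<in> {1, - 1}"
  shows "adjacent (sector n \<sigma>) (sector 1 (- \<sigma>))"
proof (rule adjacent_rayI[where \<rho> = "- \<sigma>" and t = "m 1"])
  fix d assume d: "d \<in> {1..n}"
  have "m 1 \<le> m d" using m_le[of 1 d] d n by auto
  then show "sign_vector n \<sigma> d * - \<sigma> * (m 1 - m d) \<ge> 0"
    "sign_vector 1 (- \<sigma>) d * - \<sigma> * (m 1 - m d) \<ge> 0"
    using assms d by (cases "d = 1"; auto simp: sign_vector_def)+
qed (use assms n in auto)

definition half :: "real \<Rightarrow> plane set set"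
  where "half c = {sector j \<sigma> | j \<sigma>. j \<in> {1..n} \<and> \<sigma> \<in> {1, - 1} \<and> index_parity j \<sigma> = c}"

lemma sector_in_half:
  assumes "j \<in> {1..n}" "\<sigma> \<in> {1, - 1}"
  shows "sector j \<sigma> \<in> half c \<longleftrightarrow> index_parity j \<sigma> = c"
proof
  assume "sector j \<sigma> \<in> half c"
  then obtain j' \<sigma>' where j': "j' \<in> {1..n}" "\<sigma>' \<in> {1, - 1}" "sector j \<sigma> = sector j' \<sigma>'"
    "index_parity j' \<sigma>' = c"
    unfolding half_def by blast
  have "(j, \<sigma>) = (j', \<sigma>')"
    by (rule inj_onD[OF inj_sector]) (use assms j' in auto)
  then show "index_parity j \<sigma> = c" using j'(4) by simp
qed (use assms in \<open>auto simp: half_def\<close>)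

lemma alternate_half: "c \<in> {1, - 1} \<Longrightarrow> alternate lines (half c)"
  unfolding alternate_def
proof (intro conjI ballI impI)
  show "half c \<subseteq> sectors lines"
    unfolding half_def sectors_eq by auto
  fix A B assume c: "c \<in> {1, - 1}" and AB: "A \<in> sectors lines" "B \<in> sectors lines" "adjacent A B"
  obtain j \<sigma> where j: "j \<in> {1..n}" "\<sigma> \<in> {1, - 1}" "A = sector j \<sigma>"
    using AB(1) unfolding sectors_eq by (rule sector_imageE)
  obtain j' \<sigma>' where j': "j' \<in> {1..n}" "\<sigma>' \<in> {1, - 1}" "B = sector j' \<sigma>'"
    using AB(2) unfolding sectors_eq by (rule sector_imageE)
  have "index_parity j' \<sigma>' = - index_parity j \<sigma>"
    using adjacent_index_parity j j' AB(3) by blast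
  then show "(A \<in> half c) = (B \<notin> half c)"
    unfolding j(3) j'(3) sector_in_half[OF j(1,2)] sector_in_half[OF j'(1,2)]
    using c index_parity[OF j(2), of j] by auto
qed

text \<open>Membership of the sector \<open>(1, 1)\<close> determines everything: alternation
  carries it along neighbours up to \<open>(n, 1)\<close>, across to \<open>(1, - 1)\<close>, and up
  again to \<open>(n, - 1)\<close>.\<close>

lemma alternate_imp_half:
  assumes alt: "alternate lines SS"
  obtains c where "c \<in> {1, - 1}" "SS = half c"
proof -
  define c where "c = (if sector 1 1 \<in> SS then index_parity 1 1 else - index_parity 1 1)"
  have c: "c \<in> {1, - 1}" using index_parity[of 1 1] by (auto simp: c_def)
  define Q where "Q j \<sigma> \<longleftrightarrow> (sector j \<sigma> \<in> SS \<longleftrightarrow> index_parity j \<sigma> = c)" for j \<sigma>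
  have propagate: "Q j' \<sigma>'" if "Q j \<sigma>" "j \<in> {1..n}" "\<sigma> \<in> {1, - 1}" "j' \<in> {1..n}" "\<sigma>' \<in> {1, - 1}"
    "adjacent (sector j \<sigma>) (sector j' \<sigma>')" for j \<sigma> j' \<sigma>'
  proof -
    have "sector j \<sigma> \<in> sectors lines" "sector j' \<sigma>' \<in> sectors lines"
      unfolding sectors_eq using that by auto
    then have "sector j \<sigma> \<in> SS \<longleftrightarrow> sector j' \<sigma>' \<notin> SS"
      using alt that(6) unfolding alternate_def by blast
    then show ?thesis
      using that(1) adjacent_index_parity[OF that(2-6)] index_parity[OF that(3), of j] c
      unfolding Q_def by auto
  qed
  have up: "Q j \<sigma>" if "Q 1 \<sigma>" "\<sigma> \<in> {1, - 1}" "1 \<le> j" "j \<le> n" for j \<sigma>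
    using that(3,4)
  proof (induction rule: dec_induct)
    case (step i)
    have i: "i \<in> {1..n}" "Suc i \<in> {1..n}" using step.hyps step.prems by auto
    have "Q i \<sigma>" using step.IH i by simp
    from propagate[OF this i(1) that(2) i(2) that(2)] adjacent_Suc[OF i(1) _ that(2)] i(2)
    show ?case by simp
  qed (use that(1) in simp)
  have "Q 1 1" using index_parity[of 1 1] by (auto simp: Q_def c_def)
  then have "Q n 1" using up n by auto
  then have "Q 1 (- 1)" using propagate[of n 1 1 "- 1"] adjacent_wrap[of 1] n by auto
  then have all: "Q j \<sigma>" if "j \<in> {1..n}" "\<sigma> \<in> {1, - 1}" for j \<sigma>
    using that up \<open>Q 1 1\<close> by auto
  have "SS = half c"
  proof (intro set_eqI)
    fix A
    show "A \<in> SS \<longleftrightarrow> A \<in> half c"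
    proof (cases "A \<in> sectors lines")
      case True
      then obtain j \<sigma> where "j \<in> {1..n}" "\<sigma> \<in> {1, - 1}" "A = sector j \<sigma>"
        unfolding sectors_eq by (rule sector_imageE)
      then show ?thesis
        using all sector_in_half unfolding Q_def by blast
    next
      case False
      then show ?thesis
        using alt alternate_half[OF c] unfolding alternate_def by blast
    qed
  qed
  with c show thesis by (rule that)
qed

lemma parity_sector:
  assumes "j \<in> {1..n}" "\<sigma> \<in> {1, - 1}" "z \<in> sector j \<sigma>"
  shows "d \<in> {1..n} \<Longrightarrow> sgn (L d z) = sign_vector j \<sigma> d" "parity z = index_parity j \<sigma>"
proof -
  have s: "sgn (L d z) = sign_vector j \<sigma> d" if "d \<in> {1..n}" for d
  proof -
    have "sgn x = t" if "t * x > 0" "t \<in> {1, - 1}" for t x :: real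
      using that by (auto simp: sgn_if)
    moreover have "sign_vector j \<sigma> d \<in> {1, - 1}"
      using assms(2) by (auto simp: sign_vector_def)
    ultimately show ?thesis
      using cellD[OF assms(3) that] by blast
  qed
  then show "d \<in> {1..n} \<Longrightarrow> sgn (L d z) = sign_vector j \<sigma> d" .
  show "parity z = index_parity j \<sigma>"
    unfolding parity_def index_parity_def by (intro prod.cong) (auto simp: s)
qed

lemma Union_half_iff:
  assumes z: "\<And>d. d \<in> {1..n} \<Longrightarrow> L d z \<noteq> 0"
  shows "z \<in> \<Union>(half c) \<longleftrightarrow> parity z = c"
proof -
  obtain j \<sigma> where j: "j \<in> {1..n}" "\<sigma> \<in> {1, - 1}" "z \<in> sector j \<sigma>"
    using sector_cover[OF z] by blast
  show ?thesis
  proof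
    assume "z \<in> \<Union>(half c)"
    then obtain j' \<sigma>' where "j' \<in> {1..n}" "\<sigma>' \<in> {1, - 1}" "z \<in> sector j' \<sigma>'" "index_parity j' \<sigma>' = c"
      unfolding half_def by blast
    then show "parity z = c" using parity_sector(2) by simp
  next
    assume "parity z = c"
    then have "sector j \<sigma> \<in> half c"
      using sector_in_half[OF j(1,2)] parity_sector(2)[OF j] by simp
    then show "z \<in> \<Union>(half c)" using j(3) by (rule UnionI)
  qed
qed

text \<open>On the sector \<open>(j, \<sigma>)\<close> both sides equal \<open>\<sigma>\<close> for
  odd \<open>j\<close> and \<open>- \<sigma>\<close> for even \<open>j\<close>.\<close>

lemma alternating_sum_eq_parity:
  assumes "odd n" and z: "\<And>d. d \<in> {1..n} \<Longrightarrow> L d z \<noteq> 0"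
  shows "(\<Sum>d = 1..n. (- 1) ^ (d - 1) * sgn (L d z)) = parity z"
proof -
  obtain j \<sigma> where j: "j \<in> {1..n}" "\<sigma> \<in> {1, - 1}" "z \<in> sector j \<sigma>"
    using sector_cover[OF z] by blast
  have "(\<Sum>d = 1..n. (- 1) ^ (d - 1) * sgn (L d z)) = (\<Sum>d = 1..n. (- 1) ^ (d - 1) * sign_vector j \<sigma> d)"
    by (intro sum.cong refl) (simp add: parity_sector(1)[OF j])
  also have "\<dots> = \<sigma> * (2 * of_bool (odd j) - 1)"
    using j(1) assms(1) by (subst alternating_sum_sign_vector) auto
  also have "\<dots> = index_parity j \<sigma>"
    using j(1,2) assms(1) unfolding index_parity_def by (subst prod_sign_vector) auto
  finally show ?thesis using parity_sector(2)[OF j] by simp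
qed

text \<open>For odd \<open>n\<close> the parity changes sign with \<open>\<sigma>\<close>, so
  exactly one of the two opposite sectors with index \<open>j\<close> belongs to the class;
  \<open>e j\<close> is its sign.\<close>

lemma card_half:
  assumes "odd n" "c \<in> {1, - 1}"
  shows "card (half c) = n"
proof -
  define e where "e j = c * (- 1) ^ (n - j)" for j
  have sq: "(- 1) ^ i * (- 1) ^ i = (1::real)" for i
    by (simp flip: power_mult_distrib)
  have e: "e j \<in> {1, - 1}" for j
    using assms(2) by (cases "even (n - j)") (auto simp: e_def)
  have par: "index_parity j \<sigma> = \<sigma> * (- 1) ^ (n - j)" if "j \<in> {1..n}" "\<sigma> \<in> {1, - 1}" for j \<sigma>
  proof -
    have "\<sigma> ^ n = \<sigma>" using that(2) assms(1) by auto
    then show ?thesis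
      using that(1) unfolding index_parity_def by (subst prod_sign_vector) simp_all
  qed
  have iff: "index_parity j \<sigma> = c \<longleftrightarrow> \<sigma> = e j" if "j \<in> {1..n}" "\<sigma> \<in> {1, - 1}" for j \<sigma>
  proof
    assume "index_parity j \<sigma> = c"
    then have "e j = \<sigma> * ((- 1) ^ (n - j) * (- 1) ^ (n - j))"
      unfolding par[OF that] e_def by (simp only: mult.assoc[symmetric])
    then show "\<sigma> = e j" by (simp only: sq mult_1_right)
  next
    assume "\<sigma> = e j"
    then have "index_parity j \<sigma> = c * ((- 1) ^ (n - j) * (- 1) ^ (n - j))"
      unfolding par[OF that] e_def by (simp only: mult.assoc)
    then show "index_parity j \<sigma> = c" by (simp only: sq mult_1_right)
  qed
  have "half c = (\<lambda>j. sector j (e j)) ` {1..n}"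
  proof (intro set_eqI iffI)
    fix A assume "A \<in> half c"
    then obtain j \<sigma> where j: "A = sector j \<sigma>" "j \<in> {1..n}" "\<sigma> \<in> {1, - 1}" "index_parity j \<sigma> = c"
      unfolding half_def by blast
    have "\<sigma> = e j" using iff[OF j(2,3)] j(4) by (rule iffD1)
    then show "A \<in> (\<lambda>j. sector j (e j)) ` {1..n}" using j(1,2) by (intro image_eqI[of _ _ j]) simp_all
  next
    fix A assume "A \<in> (\<lambda>j. sector j (e j)) ` {1..n}"
    then obtain j where j: "j \<in> {1..n}" "A = sector j (e j)" by blast
    then show "A \<in> half c"
      using sector_in_half[OF j(1) e] iff[OF j(1) e] by simp
  qed
  moreover have "inj_on (\<lambda>j. sector j (e j)) {1..n}"
  proof (rule inj_onI)
    fix i j assume ij: "i \<in> {1..n}" "j \<in> {1..n}" "sector i (e i) = sector j (e j)"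
    obtain z where z: "z \<in> sector i (e i)" using sector_nonempty[OF ij(1) e] by blast
    show "i = j"
      using sector_disjoint[OF ij(1) e ij(2) e z] z ij(3) by simp
  qed
  ultimately show ?thesis by (simp add: card_image)
qed

lemma AE_off_lines: "AE z in lebesgue. \<forall>d\<in>{1..n}. L d z \<noteq> 0"
  by (rule AE_finite_allI) (simp_all add: AE_off_line)

end

section \<open>Fans\<close>

locale fan_arrangement =
  fixes k :: nat and p :: plane and l :: "nat \<Rightarrow> plane \<Rightarrow> real" and a b c :: "nat \<Rightarrow> real"
  assumes odd_k: "odd k" and fan: "fan k p l a b c"
begin

abbreviation slope :: "nat \<Rightarrow> real"
  where "slope d \<equiv> b d / a d"

definition orientation :: real
  where "orientation = sgn (a 1)"

lemma k_pos: "k \<ge> 1"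
  using odd_k by (cases k) auto

lemma sgn_a: "d \<in> {1..k} \<Longrightarrow> sgn (a d) = orientation"
  and orientation: "orientation \<in> {1, - 1}"
  using fan k_pos by (auto simp: fan_def oriented_alike_def orientation_def)

lemma a_nonzero: "d \<in> {1..k} \<Longrightarrow> a d \<noteq> 0"
  using sgn_a orientation by fastforce

text \<open>Every form vanishes at \<open>p\<close>, which eliminates the constant term
  \<open>c d\<close>.\<close>

lemma l_eq: "d \<in> {1..k} \<Longrightarrow> l d z = a d * slope_form p (slope d) z"
proof -
  assume d: "d \<in> {1..k}"
  have "l d z = a d * snd z - b d * fst z + c d" "0 = a d * snd p - b d * fst p + c d"
    using fan d unfolding fan_def by (metis prod.collapse)+
  then have "l d z = a d * (snd z - snd p) - b d * (fst z - fst p)"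
    by (simp add: algebra_simps)
  moreover have "a d * (slope d * w) = b d * w" for w
    using a_nonzero[OF d] by simp
  ultimately show ?thesis
    unfolding slope_form_def by (simp only: right_diff_distrib)
qed

sublocale line_pencil k p slope
  by unfold_locales (use k_pos fan in \<open>auto simp: fan_def\<close>)

lemma slope_pos: "d \<in> {1..k} \<Longrightarrow> slope d > 0"
  using fan by (simp add: fan_def)

lemma zero_line_eq: "d \<in> {1..k} \<Longrightarrow> zero_line (l d) = {z. L d z = 0}"
  using a_nonzero by (auto simp: zero_line_def l_eq)

lemma zero_lines_eq: "(\<lambda>d. zero_line (l d)) ` {1..k} = lines"
  unfolding lines_def by (intro image_cong refl zero_line_eq)

lemma sign_sum_eq: "sign_sum k l z = (\<Sum>d = 1..k. ((- 1) ^ (d - 1) * orientation) * sgn (L d z))"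
  unfolding sign_sum_def by (intro sum.cong refl) (simp add: l_eq sgn_mult sgn_a)

lemma sign_sum_measurable [measurable]: "sign_sum k l \<in> borel_measurable borel"
proof -
  have "(\<lambda>z. \<Sum>d = 1..k. ((- 1) ^ (d - 1) * orientation) * sgn (L d z)) \<in> borel_measurable borel"
    by measurable
  then show ?thesis by (simp add: sign_sum_eq[abs_def])
qed

lemma sign_sum_parity:
  assumes "\<And>d. d \<in> {1..k} \<Longrightarrow> L d z \<noteq> 0"
  shows "sign_sum k l z = orientation * parity z"
proof -
  have "sign_sum k l z = orientation * (\<Sum>d = 1..k. (- 1) ^ (d - 1) * sgn (L d z))"
    unfolding sign_sum_eq by (simp add: sum_distrib_left mult_ac)
  also have "(\<Sum>d = 1..k. (- 1) ^ (d - 1) * sgn (L d z)) = parity z"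
    by (rule alternating_sum_eq_parity[OF odd_k assms])
  finally show ?thesis .
qed

lemma AE_sign_sum: "AE z in lebesgue. sign_sum k l z = orientation * parity z \<and> parity z \<in> {1, - 1}"
  using AE_off_lines
proof eventually_elim
  case (elim z)
  then obtain j \<sigma> where j: "j \<in> {1..k}" "\<sigma> \<in> {1, - 1}" "z \<in> sector j \<sigma>"
    using sector_cover by blast
  then have "parity z \<in> {1, - 1}"
    using parity_sector(2)[OF j] index_parity[OF j(2)] by simp
  with elim show ?case using sign_sum_parity by blast
qed

lemma AE_sign_sum_pm: "AE z in lebesgue. sign_sum k l z \<in> {1, - 1} \<and> sign_sum k l z = pm (fan_set k l) z"
  using AE_sign_sum by eventually_elim (use orientation in \<open>auto simp: pm_def fan_set_def indicator_def\<close>)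

text \<open>Off the lines the alternating sum is the parity times the orientation, a sign; it is 1
  exactly where the two agree.\<close>

lemma fan_set_half: "ae_eq (fan_set k l) (\<Union>(half orientation))"
  unfolding ae_eq_def using AE_sign_sum AE_off_lines
proof eventually_elim
  case (elim z)
  then show ?case
    using Union_half_iff[of z orientation] orientation by (auto simp: fan_set_def)
qed

lemma fan_set_uminus: "ae_eq (fan_set k (\<lambda>d z. - l d z)) (- fan_set k l)"
proof -
  have "sign_sum k (\<lambda>d z. - l d z) z = - sign_sum k l z" for z
    by (simp add: sign_sum_def sum_negf)
  then show ?thesis
    unfolding ae_eq_def using AE_sign_sum_pm by (auto simp: fan_set_def elim!: eventually_mono)
qed

text \<open>The alternating sum is odd at every point, since reflection in \<open>p\<close> negates
  each form; only its agreement with \<open>pm\<close> is restricted to almost every point.\<close>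

lemma odd_about_pm: "odd_about p (pm (fan_set k l))"
proof -
  have "slope_form p t (2 *\<^sub>R p - z) = - slope_form p t z" for t z
    by (simp add: slope_form_def algebra_simps)
  then have "sign_sum k l (2 *\<^sub>R p - z) = - sign_sum k l z" for z
    by (simp add: sign_sum_eq sum_negf)
  then show ?thesis
    unfolding odd_about_def using AE_sign_sum_pm
    by (auto simp: pm_def fan_set_def indicator_def elim!: eventually_mono)
qed

lemma homogeneous0_about_pm: "homogeneous0_about p (pm (fan_set k l))"
proof -
  have "sgn (slope_form p s (p + t *\<^sub>R (z - p))) = sgn (slope_form p s z)" if "t > 0" for s t z
  proof -
    have "slope_form p s (p + t *\<^sub>R (z - p)) = t * slope_form p s z"
      by (simp add: slope_form_def algebra_simps)
    then show ?thesis using that by (simp add: sgn_mult)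
  qed
  then show ?thesis
    by (simp add: homogeneous0_about_def pm_def fan_set_def indicator_def sign_sum_eq)
qed

lemma pm_fan_set_measurable: "pm (fan_set k l) \<in> borel_measurable borel"
proof -
  have "fan_set k l \<in> sets borel" unfolding fan_set_def by measurable
  then show ?thesis unfolding pm_def[abs_def] by measurable
qed

lemma normal_line_eq: "d \<in> {1..k} \<Longrightarrow> normal_line (zero_line (l d)) = {\<xi>. fst \<xi> + slope d * snd \<xi> = 0}"
  by (simp only: zero_line_eq normal_line_slope_form)

lemma slope_inj: "inj_on slope {1..k}"
  using strict_mono_on_imp_inj_on[OF mono] .

lemma spectrum_pm:
  "spectrum (\<lambda>z. complex_of_real (pm (fan_set k l) z)) = (\<Union>d\<in>{1..k}. normal_line (zero_line (l d)))"
proof -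
  have "spectrum (\<lambda>z. complex_of_real (pm (fan_set k l) z)) = spectrum (\<lambda>z. complex_of_real (sign_sum k l z))"
  proof (rule spectrum_cong_AE)
    show "(\<lambda>z. complex_of_real (pm (fan_set k l) z)) \<in> borel_measurable lebesgue"
      using pm_fan_set_measurable by (intro measurable_completion) simp
    show "AE z in lebesgue. complex_of_real (pm (fan_set k l) z) = complex_of_real (sign_sum k l z)"
      using AE_sign_sum_pm by eventually_elim simp
  qed simp
  also have "\<dots> = (\<Union>d\<in>{1..k}. {\<xi>. fst \<xi> + slope d * snd \<xi> = 0})"
    unfolding sign_sum_eq by (rule spectrum_sgn_sum) (use slope_inj slope_pos orientation in auto)
  also have "\<dots> = (\<Union>d\<in>{1..k}. normal_line (zero_line (l d)))"
    by (intro SUP_cong refl) (simp only: normal_line_eq)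
  finally show ?thesis .
qed

text \<open>Where \<open>x + t * y = 0\<close> with \<open>t > 0\<close>, either both coordinates
  are 0 or they have opposite signs: lines of positive slope have their normals in the second and
  fourth quadrants.\<close>

lemma hilbert_fixed_pm: "hilbert_fixed (\<lambda>z. complex_of_real (pm (fan_set k l) z))"
  unfolding hilbert_fixed_def
proof
  have "(\<lambda>z. complex_of_real (pm (fan_set k l) z)) \<in> borel_measurable lebesgue"
    using pm_fan_set_measurable by (intro measurable_completion) simp
  moreover have "norm (complex_of_real (pm (fan_set k l) z)) \<le> 1" for z
    by (simp add: pm_def indicator_def)
  ultimately show "L_infinity (\<lambda>z. complex_of_real (pm (fan_set k l) z))"
    unfolding L_infinity_def by blast
  have "(x, y) \<in> Q24 \<union> {0}" if "t > 0" "x + t * y = 0" for t x y :: real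
  proof -
    have "x = - (t * y)" using that(2) by simp
    then show ?thesis
      using that(1) by (cases y "0::real" rule: linorder_cases)
        (auto simp: Q24_def zero_prod_def mult_less_0_iff zero_less_mult_iff)
  qed
  then have "{\<xi>. fst \<xi> + slope d * snd \<xi> = 0} \<subseteq> Q24 \<union> {0}" if "d \<in> {1..k}" for d
    using slope_pos[OF that] by fastforce
  then show "spectrum (\<lambda>z. complex_of_real (pm (fan_set k l) z)) \<subseteq> Q24 \<union> {0}"
    unfolding spectrum_pm by (intro UN_least) (simp only: normal_line_eq)
qed

lemma card_normal_lines: "card ((\<lambda>d. normal_line (zero_line (l d))) ` {1..k}) = k"
proof -
  have "inj_on (\<lambda>d. normal_line (zero_line (l d))) {1..k}"
  proof (rule inj_onI)
    fix i j assume ij: "i \<in> {1..k}" "j \<in> {1..k}" "normal_line (zero_line (l i)) = normal_line (zero_line (l j))"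
    have "(- slope i, 1) \<in> normal_line (zero_line (l i))"
      unfolding normal_line_eq[OF ij(1)] by simp
    then have "slope i = slope j"
      unfolding ij(3) normal_line_eq[OF ij(2)] by simp
    then show "i = j" using slope_inj ij(1,2) by (auto dest: inj_onD)
  qed
  then show ?thesis by (simp add: card_image)
qed

end

section \<open>Alternate unions: the converse for odd and the obstruction for even numbers of
  lines\<close>

lemma ex_increasing_enumeration:
  fixes M :: "real set"
  assumes "finite M" "card M = n"
  obtains m where "strict_mono_on {1..n} m" "m ` {1..n} = M"
proof -
  define xs where "xs = sorted_list_of_set M"
  have xs: "set xs = M" "length xs = n" "sorted_wrt (<) xs"
    using assms by (auto simp: xs_def)
  define m where "m d = xs ! (d - 1)" for d
  have "strict_mono_on {1..n} m"
    unfolding strict_mono_on_def m_def using xs(2) sorted_wrt_nth_less[OF xs(3)] by auto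
  moreover have "m ` {1..n} = M"
  proof -
    have "m ` Suc ` {..<n} = (\<lambda>i. xs ! i) ` {..<n}"
      unfolding image_image by (simp add: m_def)
    also have "\<dots> = M"
      unfolding xs(1)[symmetric] xs(2)[symmetric] by (auto simp: in_set_conv_nth)
    finally show ?thesis by (simp only: image_Suc_lessThan)
  qed
  ultimately show thesis by (rule that)
qed

context line_pencil
begin

lemma pencil_eq_lines: "pencil q (m ` {1..n}) = lines"
  unfolding pencil_def lines_def image_image by (simp add: slope_form_def)

lemma alternate_unionE:
  assumes "alternate_union (pencil q (m ` {1..n})) F"
  obtains c where "c \<in> {1, - 1}" "ae_eq F {z. parity z = c}"
proof -
  obtain SS where SS: "alternate lines SS" "ae_eq F (\<Union>SS)"
    using assms unfolding alternate_union_def pencil_eq_lines by blast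
  obtain c where c: "c \<in> {1, - 1}" "SS = half c"
    using alternate_imp_half[OF SS(1)] by blast
  have "ae_eq F {z. parity z = c}"
    using SS(2) AE_off_lines unfolding ae_eq_def c(2)
    by eventually_elim (use Union_half_iff in auto)
  with c(1) show thesis by (rule that)
qed

text \<open>The class \<open>c\<close> is used as the common \<open>y\<close> coefficient. The
  orientation is then \<open>c\<close>, and the set where \<open>c * parity z = 1\<close> is the
  class with parity \<open>c\<close>.\<close>

lemma alternate_union_is_fan:
  assumes "odd n" and pos: "\<And>d. d \<in> {1..n} \<Longrightarrow> m d > 0" and F: "alternate_union (pencil q (m ` {1..n})) F"
  shows "\<exists>l' a' b' c'. fan n q l' a' b' c' \<and>
    (\<lambda>d. zero_line (l' d)) ` {1..n} = pencil q (m ` {1..n}) \<and> ae_eq F (fan_set n l')"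
proof -
  obtain c where c: "c \<in> {1, - 1}" "ae_eq F {z. parity z = c}"
    using alternate_unionE[OF F] .
  define l' where "l' d z = c * slope_form q (m d) z" for d z
  have quot: "c * m d / c = m d" for d using c(1) by auto
  have fan': "fan n q l' (\<lambda>_. c) (\<lambda>d. c * m d) (\<lambda>d. c * (m d * fst q - snd q))"
    unfolding fan_def quot using mono pos c(1)
    by (auto simp: l'_def slope_form_def oriented_alike_def algebra_simps)
  interpret G: fan_arrangement n q l' "\<lambda>_. c" "\<lambda>d. c * m d" "\<lambda>d. c * (m d * fst q - snd q)"
    using \<open>odd n\<close> fan' by unfold_locales
  have par: "G.parity = parity"
    unfolding G.parity_def[abs_def] parity_def[abs_def] quot ..
  have lin: "G.lines = lines"
    unfolding G.lines_def lines_def quot ..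
  have "G.orientation = c" using c(1) by (auto simp: G.orientation_def)
  then have "AE z in lebesgue. sign_sum n l' z = c * parity z \<and> parity z \<in> {1, - 1}"
    using G.AE_sign_sum unfolding par by simp
  then have "ae_eq F (fan_set n l')"
    using c(2) unfolding ae_eq_def by eventually_elim (use c(1) in \<open>auto simp: fan_set_def\<close>)
  then show ?thesis
    using fan' G.zero_lines_eq unfolding lin pencil_eq_lines by blast
qed

text \<open>For even \<open>n\<close> the alternating function is constant on the second and fourth quadrants about
  \<open>q\<close>, and it differs from this constant by a function of one sign which is supported in a double cone
  inside the first and third quadrants; that puts the point \<open>(1, 1)\<close> into the spectrum.\<close>

lemma even_not_hilbert_fixed:
  assumes "even n" and pos: "\<And>d. d \<in> {1..n} \<Longrightarrow> m d > 0"
    and F: "alternate_union (pencil q (m ` {1..n})) F"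
  shows "\<not> hilbert_fixed (\<lambda>z. complex_of_real (pm F z))"
proof
  assume hf: "hilbert_fixed (\<lambda>z. complex_of_real (pm F z))"
  obtain c where c: "c \<in> {1, - 1}" "ae_eq F {z. parity z = c}"
    using alternate_unionE[OF F] .
  \<comment> \<open>For even \<open>n\<close> the common factor \<open>sgn x ^ n\<close> is 1, so
    the parity depends only on the slope \<open>t\<close> seen from \<open>q\<close>; it is 1 for
    slopes below \<open>m 1\<close> and above \<open>m n\<close>, where \<open>g\<close> is
    therefore 0.\<close>
  define g where "g t = (\<Prod>d = 1..n. sgn (t - m d)) - 1" for t
  have gm: "g \<in> borel_measurable borel" unfolding g_def[abs_def] by measurable
  have prod_le: "\<bar>\<Prod>d = 1..n. sgn (t - m d)\<bar> \<le> 1" for t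
    unfolding abs_prod by (intro prod_le_1) (auto simp: abs_sgn_eq)
  have g: "g t \<le> 0" "\<bar>g t\<bar> \<le> 2" for t
    using prod_le[of t] by (simp_all add: g_def abs_le_iff)
  have n2: "n \<ge> 2" using n \<open>even n\<close> by (cases "n = 1") auto
  then have n1: "n - 1 \<in> {1..n}" "n \<in> {1..n}" "1 \<in> {1..n}" by auto
  have supp: "t \<in> {m 1..m n}" if "g t \<noteq> 0" for t
  proof (rule ccontr)
    assume "t \<notin> {m 1..m n}"
    then consider "t < m 1" | "t > m n" by force
    then have "g t = 0"
    proof cases
      case 1
      have "sgn (t - m d) = - 1" if "d \<in> {1..n}" for d
        using 1 m_le[of 1 d] that by simp
      then have "(\<Prod>d = 1..n. sgn (t - m d)) = (- 1) ^ n" by simp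
      then show ?thesis using \<open>even n\<close> by (simp add: g_def)
    next
      case 2
      have "sgn (t - m d) = 1" if "d \<in> {1..n}" for d
        using 2 m_le[of d n] that by simp
      then show ?thesis by (simp add: g_def)
    qed
    with that show False by simp
  qed
  \<comment> \<open>Between the two largest slopes exactly one factor is negative. This interval of
    positive length makes the integral of \<open>g\<close> strictly negative.\<close>
  have gap: "g t = - 2" if t: "m (n - 1) < t" "t < m n" for t
  proof -
    have "sgn (t - m d) = 1" if "d \<in> {1..n} - {n}" for d
    proof -
      have "d \<in> {1..n}" "d \<le> n - 1" using that by auto
      from m_le[OF this(1) n1(1) this(2)] show ?thesis using t(1) by simp
    qed
    moreover have "sgn (t - m n) = - 1" using t(2) by simp
    ultimately have "(\<Prod>d = 1..n. sgn (t - m d)) = - 1"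
      by (subst prod.remove[OF _ n1(2)]) simp_all
    then show ?thesis by (simp add: g_def)
  qed
  have gint: "integrable lborel g"
  proof (rule integrableI_bounded_set[where A = "{m 1..m n}" and B = 2])
    show "emeasure lborel {m 1..m n} < \<infinity>"
      using m_le[of 1 n] n1 by simp
    show "AE x in lborel. x \<notin> {m 1..m n} \<longrightarrow> g x = 0" using supp by blast
  qed (use gm g in auto)
  have "(LINT t|lborel. g t) \<le> (LINT t|lborel. indicator {m (n - 1)<..<m n} t *\<^sub>R (- 2))"
  proof (rule integral_mono[OF gint])
    show "integrable lborel (\<lambda>t. indicator {m (n - 1)<..<m n} t *\<^sub>R (- 2 :: real))"
      using m_less[OF n1(1,2)] n2 by simp
    show "g t \<le> indicator {m (n - 1)<..<m n} t *\<^sub>R (- 2)" for t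
      using gap[of t] g(1)[of t] by (auto simp: indicator_def)
  qed
  also have "\<dots> < 0"
    using m_less[OF n1(1,2)] n2 by simp
  finally have neg: "(LINT t|lborel. g t) < 0" .
  let ?f = "\<lambda>z. complex_of_real (c * (1 + g ((snd z - snd q) / (fst z - fst q))))"
  have "negligible {z. ((1, 0) :: plane) \<bullet> z = fst q}"
    by (rule negligible_hyperplane) (simp add: zero_prod_def)
  then have "AE z in lebesgue. fst (z :: plane) \<noteq> fst q"
    by (intro AE_I'[of "{z. ((1, 0) :: plane) \<bullet> z = fst q}"]) (auto simp: negligible_iff_null_sets inner_prod_def)
  then have ae: "AE z in lebesgue. complex_of_real (pm F z) = ?f z"
    using AE_off_lines c(2) unfolding ae_eq_def
  proof eventually_elim
    case (elim z)
    obtain j \<sigma> where j: "j \<in> {1..n}" "\<sigma> \<in> {1, - 1}" "z \<in> sector j \<sigma>"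
      using sector_cover elim(2) by blast
    have par: "parity z \<in> {1, - 1}"
      using parity_sector(2)[OF j] index_parity[OF j(2)] by simp
    define x t where "x = fst z - fst q" and "t = (snd z - snd q) / x"
    have x: "x \<noteq> 0" using elim(1) by (simp add: x_def)
    have xt: "x * t = snd z - snd q" using x by (simp add: t_def)
    have "L d z = x * (t - m d)" for d
      unfolding slope_form_def right_diff_distrib xt x_def[symmetric] by (simp only: mult.commute)
    then have "parity z = (\<Prod>d = 1..n. sgn x * sgn (t - m d))"
      by (simp add: parity_def sgn_mult)
    also have "\<dots> = sgn x ^ n * (\<Prod>d = 1..n. sgn (t - m d))"
      by (simp add: prod.distrib)
    also have "sgn x ^ n = 1"
      using x \<open>even n\<close> by (auto simp: sgn_if)
    finally have "parity z = 1 + g t" by (simp add: g_def)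
    moreover have "pm F z = c * parity z"
      using par elim(3) c(1) by (auto simp: pm_def indicator_def)
    ultimately show ?case by (simp add: t_def x_def)
  qed
  have "spectrum (\<lambda>z. complex_of_real (pm F z)) = spectrum ?f"
  proof (rule spectrum_cong_AE[OF _ _ ae])
    show "(\<lambda>z. complex_of_real (pm F z)) \<in> borel_measurable lebesgue"
      using hf by (simp add: hilbert_fixed_def L_infinity_def)
    note [measurable] = gm
    show "?f \<in> borel_measurable borel"
      unfolding borel_prod[symmetric] by measurable
  qed
  moreover have "(1, 1) \<in> spectrum ?f"
    by (rule one_one_in_spectrum_cone[OF gm g pos[OF n1(3)] supp neg]) (use c(1) in auto)
  moreover have "(1, 1) \<notin> Q24 \<union> {0}" by (simp add: Q24_def zero_prod_def)
  ultimately show False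
    using hf unfolding hilbert_fixed_def by blast
qed

end

section \<open>Three lines\<close>

context fan_arrangement
begin

lemma middle_last_cases:
  assumes "k = 3" "middle_last a b s"
  shows "s 3 = 2 \<and> (s 1 = 1 \<and> s 2 = 3 \<or> s 1 = 3 \<and> s 2 = 1)"
proof -
  have "bij_betw s {1..3} {1..3}"
    using assms(2) unfolding middle_last_def by blast
  from bij_betw_apply[OF this] have s: "s 1 \<in> {1..3}" "s 2 \<in> {1..3}" "s 3 \<in> {1..3}"
    by simp_all
  have less: "i < j" if "slope i < slope j" "i \<in> {1..3}" "j \<in> {1..3}" for i j
    using that m_less[of j i] assms(1) by (cases i j rule: linorder_cases) auto
  from assms(2) have "slope (s 1) < slope (s 3) \<and> slope (s 3) < slope (s 2) \<or>
      slope (s 2) < slope (s 3) \<and> slope (s 3) < slope (s 1)"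
    unfolding middle_last_def Let_def by blast
  then have "s 1 < s 3 \<and> s 3 < s 2 \<or> s 2 < s 3 \<and> s 3 < s 1"
    using less s by blast
  then show ?thesis using s by auto
qed

text \<open>The middle slope is a convex combination of the outer ones, and normalised forms combine
  with the same weights; restoring the coefficients multiplies these by \<open>a 2 / a 1\<close> and
  \<open>a 2 / a 3\<close>, positive because of the common orientation.\<close>

lemma middle_line_combination:
  assumes "k = 3"
  shows "\<exists>t1>0. \<exists>t2>0. \<forall>z. l 2 z = t1 * l 1 z + t2 * l 3 z"
proof -
  have I: "1 \<in> {1..k}" "2 \<in> {1..k}" "3 \<in> {1..k}" using assms by auto
  have less: "slope 1 < slope 2" "slope 2 < slope 3"
    using m_less I by auto
  have "\<exists>\<alpha>. \<alpha> > 0 \<and> 1 - \<alpha> > 0 \<and> y = \<alpha> * x + (1 - \<alpha>) * w" if "x < y" "y < w" for x y w :: real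
  proof (intro exI conjI)
    let ?\<alpha> = "(w - y) / (w - x)"
    have "?\<alpha> * (w - x) = w - y" using that by simp
    then show "y = ?\<alpha> * x + (1 - ?\<alpha>) * w" by (simp only: algebra_simps)
  qed (use that in simp_all)
  then obtain \<alpha> where \<alpha>: "\<alpha> > 0" "1 - \<alpha> > 0" and slope2: "slope 2 = \<alpha> * slope 1 + (1 - \<alpha>) * slope 3"
    using less by blast
  have L2: "L 2 z = \<alpha> * L 1 z + (1 - \<alpha>) * L 3 z" for z
    unfolding slope_form_def slope2 by (simp only: algebra_simps)
  have ratio: "a 2 / a d > 0" if "d \<in> {1..k}" for d
    using sgn_a[OF that] sgn_a[OF I(2)] orientation by (auto simp: sgn_if zero_less_divide_iff split: if_splits)
  have "l 2 z = (a 2 / a 1 * \<alpha>) * l 1 z + (a 2 / a 3 * (1 - \<alpha>)) * l 3 z" for z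
  proof -
    have "(a 2 / a 1 * \<alpha>) * (a 1 * L 1 z) + (a 2 / a 3 * (1 - \<alpha>)) * (a 3 * L 3 z) =
        a 2 * (\<alpha> * L 1 z + (1 - \<alpha>) * L 3 z)"
      using a_nonzero[OF I(1)] a_nonzero[OF I(3)] by (simp add: distrib_left)
    then show ?thesis
      unfolding l_eq[OF I(1)] l_eq[OF I(2)] l_eq[OF I(3)] L2 by simp
  qed
  moreover have "a 2 / a 1 * \<alpha> > 0" "a 2 / a 3 * (1 - \<alpha>) > 0"
    using ratio I \<alpha> by (blast intro: mult_pos_pos)+
  ultimately show ?thesis by blast
qed

text \<open>Off the lines the Heaviside function is \<open>(sgn x + 1) / 2\<close>, so the
  combination of three Heaviside values is half of the alternating sum plus 1.\<close>

lemma fan_set_three_set: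
  assumes "k = 3"
  shows "ae_eq (fan_set k l) (three_set (l 1) (l 3) (l 2))"
  unfolding ae_eq_def using AE_off_lines
proof eventually_elim
  case (elim z)
  have nz: "l d z \<noteq> 0" if "d \<in> {1..k}" for d
    using elim that a_nonzero[OF that] by (simp add: l_eq[OF that])
  have H: "heaviside x = (sgn x + 1) / 2" if "x \<noteq> 0" for x
    using that by (simp add: heaviside_def sgn_if indicator_def)
  have "{1..k} = {1, 2, 3}" using assms by auto
  then have "sign_sum k l z = sgn (l 1 z) - sgn (l 2 z) + sgn (l 3 z)"
    by (simp add: sign_sum_def)
  then show ?case
    using nz[of 1] nz[of 2] nz[of 3] assms by (simp add: fan_set_def three_set_def H) argo
qed

lemma middle_last_three_set:
  assumes "k = 3" "middle_last a b s"
  shows "(\<exists>t1>0. \<exists>t2>0. \<forall>z. l (s 3) z = t1 * l (s 1) z + t2 * l (s 2) z) \<and>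
    ae_eq (fan_set k l) (three_set (l (s 1)) (l (s 2)) (l (s 3)))"
proof -
  have comm: "three_set f g h = three_set g f h" for f g h
    by (simp add: three_set_def add.commute)
  obtain t1 t2 where t: "t1 > 0" "t2 > 0" "\<And>z. l 2 z = t1 * l 1 z + t2 * l 3 z"
    using middle_line_combination[OF assms(1)] by blast
  have t': "l 2 z = t2 * l 3 z + t1 * l 1 z" for z
    by (simp only: t(3) add.commute)
  from middle_last_cases[OF assms] show ?thesis
  proof (elim conjE disjE)
    assume s: "s 3 = 2" "s 1 = 1" "s 2 = 3"
    show ?thesis
      unfolding s using t fan_set_three_set[OF assms(1)] by blast
  next
    assume s: "s 3 = 2" "s 1 = 3" "s 2 = 1"
    show ?thesis
      unfolding s comm[of "l 3"] using t(1,2) t' fan_set_three_set[OF assms(1)] by blast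
  qed
qed

end

section \<open>Blowing up at a vertex\<close>

text \<open>Distinct lines of one family are parallel, so two lines through \<open>q\<close> come
  from different families; any two of \<open>u q\<close>, \<open>v q\<close>,
  \<open>u q + v q\<close> being integers, all three are.\<close>

lemma vertex_arrangement_Ints:
  assumes "vertex arrangement q"
  shows "u q \<in> \<int>" "v q \<in> \<int>"
proof -
  obtain A B where AB: "A \<in> arrangement" "B \<in> arrangement" "A \<noteq> B" "q \<in> A" "q \<in> B"
    using assms unfolding vertex_def by blast
  have "\<exists>n::int. A = {z. u z = n} \<or> A = {z. v z = n} \<or> A = {z. u z + v z = n}" if "A \<in> arrangement" for A
    using that unfolding arrangement_def by auto
  then obtain i j :: int where
    i: "A = {z. u z = i} \<or> A = {z. v z = i} \<or> A = {z. u z + v z = i}" and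
    j: "B = {z. u z = j} \<or> B = {z. v z = j} \<or> B = {z. u z + v z = j}"
    using AB(1,2) by meson
  have "u q = i \<and> v q = j \<or> u q = j \<and> v q = i \<or> u q = i \<and> u q + v q = j \<or> u q = j \<and> u q + v q = i
     \<or> v q = i \<and> u q + v q = j \<or> v q = j \<and> u q + v q = i"
    using i j AB(3-5) by (elim disjE) auto
  moreover have "x \<in> \<int> \<and> y \<in> \<int>" if "x = of_int i \<and> x + y = of_int j" for x y :: real and i j
  proof -
    have "x = of_int i" "y = of_int (j - i)" using that by auto
    then show ?thesis by (metis Ints_of_int)
  qed
  ultimately have "u q \<in> \<int> \<and> v q \<in> \<int>"
    by (metis Ints_of_int add.commute)
  then show "u q \<in> \<int>" "v q \<in> \<int>" by auto
qed

lemma frac_near_Int: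
  assumes "n \<in> \<int>" "\<bar>x\<bar> < 1" "x \<noteq> 0"
  shows "frac (n + x) = (if x > 0 then x else 1 + x)"
proof -
  have "n - 1 \<in> \<int>" using assms(1) by auto
  then show ?thesis
    using assms by (auto simp: frac_unique_iff)
qed

text \<open>At a vertex the fractional parts jump: near \<open>q\<close> each is the small increment
  or 1 plus it, according to its sign. The sum exceeds 1 never if both increments are positive,
  always if both are negative, and otherwise exactly if \<open>U + V > 0\<close>; the Heaviside
  condition makes the same distinction.\<close>

lemma S_blow_up:
  assumes q: "u q \<in> \<int>" "v q \<in> \<int>"
  shows "AE z in lebesgue. ((\<lambda>\<epsilon>. indicator S (q + \<epsilon> *\<^sub>R (z - q)) :: real) \<longlongrightarrow>
    indicator (three_set (\<lambda>z. u q - u z) (\<lambda>z. v q - v z) (\<lambda>z. (u q - u z) + (v q - v z))) z) (at_right 0)"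
  \<comment> \<open>The lines through \<open>q\<close> on which \<open>u\<close>, \<open>v\<close>
    and \<open>u + v\<close> are constant have slopes 1, \<open>1 / 2\<close> and
    \<open>3 / 4\<close>.\<close>
  using AE_off_line[of q 1] AE_off_line[of q "1 / 2"] AE_off_line[of q "3 / 4"]
proof eventually_elim
  case (elim z)
  define U V where "U = u z - u q" and "V = v z - v q"
  have "U = slope_form q 1 z" "V = slope_form q (1 / 2) z" "U + V = 2 * slope_form q (3 / 4) z"
    by (simp_all add: U_def V_def u_def v_def slope_form_def case_prod_beta field_simps)
  then have nz: "U \<noteq> 0" "V \<noteq> 0" "U + V \<noteq> 0" using elim by simp_all
  \<comment> \<open>Below this \<open>\<delta>\<close> both scaled increments are smaller than
    \<open>1 / 2\<close> in modulus, so that two positive ones add up to less than 1 and two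
    negative ones to more than \<open>- 1\<close>.\<close>
  define \<delta> where "\<delta> = 1 / (2 * (\<bar>U\<bar> + \<bar>V\<bar> + 1))"
  have \<delta>: "\<delta> > 0" by (simp add: \<delta>_def add_nonneg_pos)
  have "indicator S (q + \<epsilon> *\<^sub>R (z - q)) =
      (indicator (three_set (\<lambda>z. u q - u z) (\<lambda>z. v q - v z) (\<lambda>z. (u q - u z) + (v q - v z))) z :: real)"
    if \<epsilon>: "0 < \<epsilon>" "\<epsilon> < \<delta>" for \<epsilon>
  proof -
    have "\<epsilon> * (2 * (\<bar>U\<bar> + \<bar>V\<bar> + 1)) < 1"
      using \<epsilon> by (simp add: \<delta>_def pos_less_divide_eq add_nonneg_pos)
    moreover have "\<epsilon> * \<bar>U\<bar> \<ge> 0" "\<epsilon> * \<bar>V\<bar> \<ge> 0" using \<epsilon> by auto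
    ultimately have "\<epsilon> * \<bar>U\<bar> < 1 / 2" "\<epsilon> * \<bar>V\<bar> < 1 / 2"
      using \<epsilon>(1) unfolding distrib_left by linarith+
    then have small: "\<bar>\<epsilon> * U\<bar> < 1 / 2" "\<bar>\<epsilon> * V\<bar> < 1 / 2"
      using \<epsilon>(1) by (simp_all add: abs_mult)
    have uv: "u (q + \<epsilon> *\<^sub>R (z - q)) = u q + \<epsilon> * U" "v (q + \<epsilon> *\<^sub>R (z - q)) = v q + \<epsilon> * V"
      by (simp_all add: U_def V_def u_def v_def case_prod_beta algebra_simps diff_divide_distrib)
    have fr: "frac (u q + \<epsilon> * U) = (if U > 0 then \<epsilon> * U else 1 + \<epsilon> * U)"
      "frac (v q + \<epsilon> * V) = (if V > 0 then \<epsilon> * V else 1 + \<epsilon> * V)"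
      using frac_near_Int[OF q(1), of "\<epsilon> * U"] frac_near_Int[OF q(2), of "\<epsilon> * V"] small nz \<epsilon>(1)
      by (simp_all add: zero_less_mult_iff)
    have sum: "\<epsilon> * U + \<epsilon> * V > 0 \<longleftrightarrow> U + V > 0"
      using \<epsilon>(1) by (simp add: distrib_left[symmetric] zero_less_mult_iff)
    have "frac (u q + \<epsilon> * U) + frac (v q + \<epsilon> * V) > 1 \<longleftrightarrow>
      heaviside (- U) + heaviside (- V) - heaviside (- U - V) = 1"
      unfolding fr using small nz sum by (auto simp: heaviside_def indicator_def split: if_splits)
    moreover have "u q - u z = - U" "v q - v z = - V" "(u q - u z) + (v q - v z) = - U - V"
      by (simp_all add: U_def V_def)
    ultimately show ?thesis
      by (simp only: S_def three_set_def indicator_def mem_Collect_eq uv)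
  qed
  then have "\<forall>\<^sub>F \<epsilon> in at_right 0. indicator S (q + \<epsilon> *\<^sub>R (z - q)) =
      (indicator (three_set (\<lambda>z. u q - u z) (\<lambda>z. v q - v z) (\<lambda>z. (u q - u z) + (v q - v z))) z :: real)"
    using eventually_at_right_real[OF \<delta>] by (auto elim!: eventually_mono)
  then show ?case by (rule tendsto_eventually)
qed

text \<open>A fan lists its lines by increasing slope, here \<open>1 / 2\<close>,
  \<open>3 / 4\<close>, 1, which puts \<open>v\<close> first, the sum second and \<open>u\<close>
  third; \<open>s\<close> translates this order into the order \<open>u\<close>, \<open>v\<close>,
  sum. All \<open>y\<close> coefficients are negative.\<close>

lemma blow_up_fan:
  "\<exists>l' a' b' c' s. fan 3 q l' a' b' c' \<and> middle_last a' b' s \<and>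
    l' (s 1) = (\<lambda>z. u q - u z) \<and> l' (s 2) = (\<lambda>z. v q - v z) \<and>
    l' (s 3) = (\<lambda>z. (u q - u z) + (v q - v z))"
proof -
  let ?l = "\<lambda>d. if d = 1 then (\<lambda>z. v q - v z) else if d = 2 then (\<lambda>z. (u q - u z) + (v q - v z))
    else (\<lambda>z. u q - u z)"
  let ?a = "\<lambda>d::nat. if d = 2 then - 2 else - 1 :: real"
  let ?b = "\<lambda>d::nat. if d = 1 then - (1 / 2) else if d = 2 then - (3 / 2) else - 1 :: real"
  let ?c = "\<lambda>d::nat. if d = 1 then v q else if d = 2 then u q + v q else u q"
  let ?s = "\<lambda>d::nat. if d = 1 then 3 else if d = 2 then 1 else 2 :: nat"
  have I: "{1..3} = {1, 2, 3 :: nat}" by auto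
  have bij: "bij_betw ?s {1..3} {1..3}"
    unfolding I bij_betw_def by auto
  have "fan 3 q ?l ?a ?b ?c"
    unfolding fan_def oriented_alike_def strict_mono_on_def I by (auto simp: u_def v_def field_simps)
  moreover have "middle_last ?a ?b ?s"
    using bij unfolding middle_last_def by simp
  ultimately show ?thesis
    by (intro exI[of _ ?l] exI[of _ ?a] exI[of _ ?b] exI[of _ ?c] exI[of _ ?s]) simp
qed

theorem proposition5:
  fixes k :: nat and p :: plane
    and l :: "nat \<Rightarrow> plane \<Rightarrow> real" and a b c :: "nat \<Rightarrow> real"
  assumes "odd k" and "fan k p l a b c"
  shows
    "((AE z in lebesgue. sign_sum k l z \<in> {1, -1}) \<and>
      (AE z in lebesgue. sign_sum k l z = pm (fan_set k l) z) \<and>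
      card (sectors ((\<lambda>d. zero_line (l d)) ` {1..k})) = 2 * k \<and>
      (\<exists>SS. alternate ((\<lambda>d. zero_line (l d)) ` {1..k}) SS \<and> card SS = k \<and>
        ae_eq (fan_set k l) (\<Union>SS)) \<and>
      ae_eq (fan_set k (\<lambda>d z. - l d z)) (- fan_set k l) \<and>
      (\<forall>n q M F'. odd n \<and> finite M \<and> card M = n \<and> M \<subseteq> {0<..} \<and>
        alternate_union (pencil q M) F' \<longrightarrow>
        (\<exists>l' a' b' c'. fan n q l' a' b' c' \<and>
          (\<lambda>d. zero_line (l' d)) ` {1..n} = pencil q M \<and>
          ae_eq F' (fan_set n l'))) \<and>
      (\<forall>n q M F'. n \<ge> 1 \<and> finite M \<and> card M = n \<and> M \<subseteq> {0<..} \<and>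
        alternate_union (pencil q M) F' \<and>
        hilbert_fixed (\<lambda>z. complex_of_real (pm F' z)) \<longrightarrow> odd n)) \<and>

     (odd_about p (pm (fan_set k l)) \<and>
      homogeneous0_about p (pm (fan_set k l)) \<and>
      hilbert_fixed (\<lambda>z. complex_of_real (pm (fan_set k l) z)) \<and>
      spectrum (\<lambda>z. complex_of_real (pm (fan_set k l) z)) =
        (\<Union>d\<in>{1..k}. normal_line (zero_line (l d))) \<and>
      card ((\<lambda>d. normal_line (zero_line (l d))) ` {1..k}) = k) \<and>

     (k = 3 \<longrightarrow> (\<forall>s. middle_last a b s \<longrightarrow>
        (\<exists>t1>0. \<exists>t2>0. \<forall>z. l (s 3) z = t1 * l (s 1) z + t2 * l (s 2) z) \<and>
        ae_eq (fan_set k l) (three_set (l (s 1)) (l (s 2)) (l (s 3))))) \<and>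
     (\<forall>q. vertex arrangement q \<longrightarrow>
       (let l1 = (\<lambda>z. u q - u z); l2 = (\<lambda>z. v q - v z); l3 = (\<lambda>z. l1 z + l2 z) in
         (\<exists>l' a' b' c' s. fan 3 q l' a' b' c' \<and> middle_last a' b' s \<and>
           l' (s 1) = l1 \<and> l' (s 2) = l2 \<and> l' (s 3) = l3) \<and>
         (AE z in lebesgue.
           ((\<lambda>\<epsilon>. indicator S (q + \<epsilon> *\<^sub>R (z - q)) :: real)
             \<longlongrightarrow> indicator (three_set l1 l2 l3) z) (at_right 0))))"
proof -
  interpret fan_arrangement k p l a b c
    using assms by unfold_locales
  have sectors_k: "\<exists>SS. alternate ((\<lambda>d. zero_line (l d)) ` {1..k}) SS \<and> card SS = k \<and>
      ae_eq (fan_set k l) (\<Union>SS)"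
    unfolding zero_lines_eq
    by (intro exI[of _ "half orientation"] conjI alternate_half orientation card_half fan_set_half \<open>odd k\<close>)
  have converse: "\<exists>l' a' b' c'. fan n q l' a' b' c' \<and>
      (\<lambda>d. zero_line (l' d)) ` {1..n} = pencil q M \<and> ae_eq F' (fan_set n l')"
    if "odd n \<and> finite M \<and> card M = n \<and> M \<subseteq> {0<..} \<and> alternate_union (pencil q M) F'" for n q M F'
  proof -
    have M: "finite M" "card M = n" "M \<subseteq> {0<..}" using that by simp_all
    from M(1,2) obtain m where m: "strict_mono_on {1..n} m" "m ` {1..n} = M"
      by (rule ex_increasing_enumeration)
    interpret P: line_pencil n q m
    proof
      show "n \<ge> 1" using that odd_pos[of n] by simp
    qed (rule m(1))
    have pos: "m d \<in> {0<..}" if "d \<in> {1..n}" for d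
      using M(3) m(2) that by blast
    show ?thesis
      by (rule P.alternate_union_is_fan[unfolded m(2)]) (use that pos in auto)
  qed
  have fixed_odd: "odd n"
    if "n \<ge> 1 \<and> finite M \<and> card M = n \<and> M \<subseteq> {0<..} \<and> alternate_union (pencil q M) F' \<and>
      hilbert_fixed (\<lambda>z. complex_of_real (pm F' z))" for n q M F'
  proof -
    have M: "finite M" "card M = n" "M \<subseteq> {0<..}" using that by simp_all
    from M(1,2) obtain m where m: "strict_mono_on {1..n} m" "m ` {1..n} = M"
      by (rule ex_increasing_enumeration)
    interpret P: line_pencil n q m
    proof
      show "n \<ge> 1" using that by simp
    qed (rule m(1))
    have pos: "m d \<in> {0<..}" if "d \<in> {1..n}" for d
      using M(3) m(2) that by blast
    show ?thesis
    proof (rule ccontr)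
      assume "\<not> odd n"
      then have "\<not> hilbert_fixed (\<lambda>z. complex_of_real (pm F' z))"
        by (intro P.even_not_hilbert_fixed[unfolded m(2)]) (use that pos in auto)
      then show False using that by simp
    qed
  qed
  have blow_up: "let l1 = (\<lambda>z. u q - u z); l2 = (\<lambda>z. v q - v z); l3 = (\<lambda>z. l1 z + l2 z) in
      (\<exists>l' a' b' c' s. fan 3 q l' a' b' c' \<and> middle_last a' b' s \<and>
        l' (s 1) = l1 \<and> l' (s 2) = l2 \<and> l' (s 3) = l3) \<and>
      (AE z in lebesgue.
        ((\<lambda>\<epsilon>. indicator S (q + \<epsilon> *\<^sub>R (z - q)) :: real)
          \<longlongrightarrow> indicator (three_set l1 l2 l3) z) (at_right 0))"
    if "vertex arrangement q" for q
    unfolding Let_def by (rule conjI[OF blow_up_fan S_blow_up[OF vertex_arrangement_Ints[OF that]]])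
  have signs: "AE z in lebesgue. sign_sum k l z \<in> {1, - 1}"
    and sign_pm: "AE z in lebesgue. sign_sum k l z = pm (fan_set k l) z"
    using AE_sign_sum_pm by (auto elim: eventually_mono)
  have card_sec: "card (sectors ((\<lambda>d. zero_line (l d)) ` {1..k})) = 2 * k"
    unfolding zero_lines_eq by (rule card_sectors)
  note part1 = signs sign_pm card_sec sectors_k fan_set_uminus
  note part2 = odd_about_pm homogeneous0_about_pm hilbert_fixed_pm spectrum_pm card_normal_lines
  show ?thesis
    by (intro conjI allI impI;
        (rule part1 | rule part2 | erule converse | erule fixed_odd | erule blow_up
          | erule (1) middle_last_three_set[THEN conjunct1]
          | erule (1) middle_last_three_set[THEN conjunct2]))
qed

end
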